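(* Let $m \geq 1$ be an integer and set $$q(m,n)= \left\lfloor\frac{(m+1)\binom{n+2}{2}}{m+n+1} \right\rfloor .$$ If $n$ is sufficiently large (i.e. for all integers $n \geq n_0$, for some $n_0$ depending on $m$), then the secant variety $\sigma_{s}(X_{m,n})$ has the expected dimension for all $1\le s \leq q(m,n)$.
   Context: We work over $\mathbb{C}$. For an irreducible non-singular variety $X\subset \mathbb{P}^N$ of dimension $d$ and $s\ge 1$, the $s$-th secant variety $\sigma_s(X)$ is the Zariski closure of the union of the linear spans of all $s$-tuples of points of $X$. Its expected dimension is $\min\{N, s(d+1)-1\}$; we say $\sigma_s(X)$ has the expected dimension if $\dim\sigma_s(X)$ equals this number. $X_{m,n}$ denotes the Segre-Veronese variety $\mathbb{P}^m\times\mathbb{P}^n$ embedded in $\mathbb{P}^{(m+1)\binom{n+2}{2}-1}$ by the morphism given by $\mathcal{O}(1,2)$; it has dimension $m+n$. *)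

theory Defs
  imports
    "HOL-Analysis.Abstract_Topology"
    "HOL-Library.Poly_Mapping"
    "HOL-Library.Function_Algebras"
    "HOL-Library.Extended_Nat"
begin

section \<open>Complex projective space\<close>

text \<open>
  The coordinates of an affine space are indexed by a finite set \<open>I\<close> of any type; vectors are
  functions vanishing outside \<open>I\<close>.  For \<open>card I = N + 1\<close>, \<open>proj_space I\<close> is \<open>N\<close>-dimensional
  projective space, a point being a one-dimensional linear subspace (including the zero vector).
\<close>

definition coord_space :: "'i set \<Rightarrow> ('i \<Rightarrow> complex) set" where
  "coord_space I = {x. \<forall>i. i \<notin> I \<longrightarrow> x i = 0}"

definition cscale :: "complex \<Rightarrow> ('i \<Rightarrow> complex) \<Rightarrow> 'i \<Rightarrow> complex" where
  "cscale c x = (\<lambda>i. c * x i)"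

lemma vector_space_cscale: "vector_space (cscale :: complex \<Rightarrow> ('i \<Rightarrow> complex) \<Rightarrow> _)"
  by unfold_locales (auto simp: cscale_def fun_eq_iff algebra_simps)

global_interpretation cfun: vector_space "cscale :: complex \<Rightarrow> ('i \<Rightarrow> complex) \<Rightarrow> _"
  defines cspan = cfun.span
  by (rule vector_space_cscale)

definition line :: "('i \<Rightarrow> complex) \<Rightarrow> ('i \<Rightarrow> complex) set" where
  "line x = cspan {x}"

definition proj_space :: "'i set \<Rightarrow> ('i \<Rightarrow> complex) set set" where
  "proj_space I = {line x | x. x \<in> coord_space I \<and> x \<noteq> 0}"

definition proj_span :: "'i set \<Rightarrow> ('i \<Rightarrow> complex) set set \<Rightarrow> ('i \<Rightarrow> complex) set set" where
  "proj_span I S = {p \<in> proj_space I. p \<subseteq> cspan (\<Union>S)}"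


section \<open>The Zariski topology\<close>

text \<open>
  A polynomial maps monomials (finitely supported exponent vectors) to coefficients.
\<close>

type_synonym 'i mpoly = "('i \<Rightarrow>\<^sub>0 nat) \<Rightarrow>\<^sub>0 complex"

definition monom_eval :: "('i \<Rightarrow>\<^sub>0 nat) \<Rightarrow> ('i \<Rightarrow> complex) \<Rightarrow> complex" where
  "monom_eval a x = (\<Prod>i\<in>Poly_Mapping.keys a. x i ^ Poly_Mapping.lookup a i)"

definition poly_eval :: "'i mpoly \<Rightarrow> ('i \<Rightarrow> complex) \<Rightarrow> complex" where
  "poly_eval f x = (\<Sum>a\<in>Poly_Mapping.keys f. Poly_Mapping.lookup f a * monom_eval a x)"

definition monom_degree :: "('i \<Rightarrow>\<^sub>0 nat) \<Rightarrow> nat" where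
  "monom_degree a = (\<Sum>i\<in>Poly_Mapping.keys a. Poly_Mapping.lookup a i)"

definition homogeneous :: "'i set \<Rightarrow> nat \<Rightarrow> 'i mpoly \<Rightarrow> bool" where
  "homogeneous I d f \<longleftrightarrow>
     (\<forall>a\<in>Poly_Mapping.keys f. Poly_Mapping.keys a \<subseteq> I \<and> monom_degree a = d)"

definition homogeneous_polys :: "'i set \<Rightarrow> 'i mpoly set" where
  "homogeneous_polys I = {f. \<exists>d. homogeneous I d f}"

definition zero_locus :: "'i set \<Rightarrow> 'i mpoly set \<Rightarrow> ('i \<Rightarrow> complex) set set" where
  "zero_locus I F = {p \<in> proj_space I. \<forall>f\<in>F. \<forall>x\<in>p. poly_eval f x = 0}"

definition zariski :: "'i set \<Rightarrow> ('i \<Rightarrow> complex) set topology" where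
  "zariski I =
     topology (\<lambda>U. \<exists>F \<subseteq> homogeneous_polys I. U = proj_space I - zero_locus I F)"

text \<open>The next lemmas show that these sets do form a topology, whose closed sets are the
  zero loci of sets of homogeneous polynomials.\<close>

lemma monom_eval_superset:
  assumes "finite A" "Poly_Mapping.keys a \<subseteq> A"
  shows "monom_eval a x = (\<Prod>i\<in>A. x i ^ Poly_Mapping.lookup a i)"
  unfolding monom_eval_def using assms
  by (intro prod.mono_neutral_left) (auto simp: in_keys_iff)

lemma monom_degree_superset:
  assumes "finite A" "Poly_Mapping.keys a \<subseteq> A"
  shows "monom_degree a = (\<Sum>i\<in>A. Poly_Mapping.lookup a i)"
  unfolding monom_degree_def using assms
  by (intro sum.mono_neutral_left) (auto simp: in_keys_iff)

lemma monom_eval_add: "monom_eval (a + b) x = monom_eval a x * monom_eval b x"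
proof -
  let ?A = "Poly_Mapping.keys a \<union> Poly_Mapping.keys b"
  have "Poly_Mapping.keys (a + b) \<subseteq> ?A" by (rule Poly_Mapping.keys_add)
  then show ?thesis
    by (simp add: monom_eval_superset[of ?A] lookup_add power_add prod.distrib)
qed

lemma monom_degree_add: "monom_degree (a + b) = monom_degree a + monom_degree b"
proof -
  let ?A = "Poly_Mapping.keys a \<union> Poly_Mapping.keys b"
  have "Poly_Mapping.keys (a + b) \<subseteq> ?A" by (rule Poly_Mapping.keys_add)
  then show ?thesis
    by (simp add: monom_degree_superset[of ?A] lookup_add sum.distrib)
qed

lemma monom_eval_cscale: "monom_eval a (cscale c x) = c ^ monom_degree a * monom_eval a x"
  by (simp add: monom_eval_def monom_degree_def cscale_def power_mult_distrib prod.distrib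
      power_sum)

lemma poly_eval_superset:
  assumes "finite A" "Poly_Mapping.keys f \<subseteq> A"
  shows "poly_eval f x = (\<Sum>a\<in>A. Poly_Mapping.lookup f a * monom_eval a x)"
  unfolding poly_eval_def using assms
  by (intro sum.mono_neutral_left) (auto simp: in_keys_iff)

lemma poly_eval_zero [simp]: "poly_eval 0 x = 0"
  by (simp add: poly_eval_def)

lemma poly_eval_one [simp]: "poly_eval 1 x = 1"
  by (simp add: poly_eval_def monom_eval_def lookup_one)

lemma poly_eval_single: "poly_eval (Poly_Mapping.single a c) x = c * monom_eval a x"
  by (cases "c = 0") (auto simp: poly_eval_def)

lemma poly_eval_add: "poly_eval (f + g) x = poly_eval f x + poly_eval g x"
proof -
  let ?A = "Poly_Mapping.keys f \<union> Poly_Mapping.keys g"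
  have "Poly_Mapping.keys (f + g) \<subseteq> ?A" by (rule Poly_Mapping.keys_add)
  then show ?thesis
    by (simp add: poly_eval_superset[of ?A] lookup_add algebra_simps sum.distrib)
qed

lemma poly_eval_sum: "poly_eval (\<Sum>i\<in>A. f i) x = (\<Sum>i\<in>A. poly_eval (f i) x)"
  by (induction A rule: infinite_finite_induct) (auto simp: poly_eval_add)

lemma poly_mapping_sum_single:
  "f = (\<Sum>a\<in>Poly_Mapping.keys f. Poly_Mapping.single a (Poly_Mapping.lookup f a))"
  by (rule poly_mapping_eqI)
    (auto simp: lookup_sum lookup_single when_def in_keys_iff sum.delta)

lemma poly_eval_mult: "poly_eval (f * g) x = poly_eval f x * poly_eval g x"
proof -
  let ?l = Poly_Mapping.lookup and ?s = Poly_Mapping.single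
  have "f * g = (\<Sum>a\<in>Poly_Mapping.keys f. ?s a (?l f a)) * (\<Sum>b\<in>Poly_Mapping.keys g. ?s b (?l g b))"
    by (simp flip: poly_mapping_sum_single)
  also have "\<dots> = (\<Sum>a\<in>Poly_Mapping.keys f. \<Sum>b\<in>Poly_Mapping.keys g. ?s (a + b) (?l f a * ?l g b))"
    by (simp add: sum_product mult_single)
  finally have "poly_eval (f * g) x =
      (\<Sum>a\<in>Poly_Mapping.keys f. \<Sum>b\<in>Poly_Mapping.keys g.
         ?l f a * ?l g b * (monom_eval a x * monom_eval b x))"
    by (simp only: poly_eval_sum poly_eval_single monom_eval_add)
  then show ?thesis
    by (simp add: poly_eval_def sum_product algebra_simps)
qed

lemma poly_eval_cscale:
  assumes "homogeneous I d f"
  shows "poly_eval f (cscale c x) = c ^ d * poly_eval f x"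
  using assms unfolding poly_eval_def homogeneous_def
  by (auto simp: monom_eval_cscale sum_distrib_left intro!: sum.cong)

lemma homogeneous_mult:
  assumes "homogeneous I d f" "homogeneous I e g"
  shows "homogeneous I (d + e) (f * g)"
  unfolding homogeneous_def
proof
  fix c assume "c \<in> Poly_Mapping.keys (f * g)"
  then obtain a b where c: "c = a + b" "a \<in> Poly_Mapping.keys f" "b \<in> Poly_Mapping.keys g"
    using keys_mult[of f g] by blast
  then show "Poly_Mapping.keys c \<subseteq> I \<and> monom_degree c = d + e"
    using assms Poly_Mapping.keys_add[of a b]
    unfolding homogeneous_def monom_degree_add by (metis Un_least order_trans monom_degree_add)
qed

lemma homogeneous_polys_mult:
  "f \<in> homogeneous_polys I \<Longrightarrow> g \<in> homogeneous_polys I \<Longrightarrow> f * g \<in> homogeneous_polys I"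
  unfolding homogeneous_polys_def using homogeneous_mult by blast

lemma line_eq: "line x = range (\<lambda>c. cscale c x)"
  by (simp add: line_def cfun.span_singleton)

lemma vanishes_on_line_iff:
  assumes "f \<in> homogeneous_polys I"
  shows "(\<forall>y\<in>line x. poly_eval f y = 0) \<longleftrightarrow> poly_eval f x = 0"
proof
  have "x \<in> line x" by (simp add: line_def cfun.span_base)
  then show "\<forall>y\<in>line x. poly_eval f y = 0 \<Longrightarrow> poly_eval f x = 0" by blast
qed (use assms in \<open>auto simp: line_eq homogeneous_polys_def poly_eval_cscale\<close>)

lemma zero_locus_Union: "zero_locus I (\<Union>\<F>) = proj_space I \<inter> (\<Inter>F\<in>\<F>. zero_locus I F)"
  by (auto simp: zero_locus_def)

lemma zero_locus_mult:
  assumes "F \<subseteq> homogeneous_polys I" "G \<subseteq> homogeneous_polys I"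
  shows "zero_locus I {f * g | f g. f \<in> F \<and> g \<in> G} = zero_locus I F \<union> zero_locus I G"
proof (intro set_eqI iffI)
  fix p assume p: "p \<in> zero_locus I {f * g | f g. f \<in> F \<and> g \<in> G}"
  then have "p \<in> proj_space I" by (simp add: zero_locus_def)
  then obtain x where x: "p = line x" by (auto simp: proj_space_def)
  have "poly_eval f x * poly_eval g x = 0" if "f \<in> F" "g \<in> G" for f g
  proof -
    have "x \<in> p" by (simp add: x line_def cfun.span_base)
    then have "poly_eval (f * g) x = 0" using p that by (auto simp: zero_locus_def)
    then show ?thesis by (simp add: poly_eval_mult)
  qed
  then have "(\<forall>f\<in>F. poly_eval f x = 0) \<or> (\<forall>g\<in>G. poly_eval g x = 0)"
    by (meson mult_eq_0_iff)
  then show "p \<in> zero_locus I F \<union> zero_locus I G"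
    using \<open>p \<in> proj_space I\<close> assms vanishes_on_line_iff[of _ I x]
    unfolding x zero_locus_def by blast
qed (auto simp: zero_locus_def poly_eval_mult)

lemma istopology_zariski:
  "istopology (\<lambda>U. \<exists>F \<subseteq> homogeneous_polys I. U = proj_space I - zero_locus I F)"
  unfolding istopology_def
proof (intro conjI allI impI)
  fix S T
  assume "\<exists>F \<subseteq> homogeneous_polys I. S = proj_space I - zero_locus I F"
    and "\<exists>F \<subseteq> homogeneous_polys I. T = proj_space I - zero_locus I F"
  then obtain F G where *: "F \<subseteq> homogeneous_polys I" "G \<subseteq> homogeneous_polys I"
    "S = proj_space I - zero_locus I F" "T = proj_space I - zero_locus I G" by blast
  let ?H = "{f * g | f g. f \<in> F \<and> g \<in> G}"
  have "?H \<subseteq> homogeneous_polys I"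
    using *(1,2) homogeneous_polys_mult by blast
  moreover have "S \<inter> T = proj_space I - zero_locus I ?H"
    unfolding zero_locus_mult[OF *(1,2)] *(3,4) by (rule Diff_Un[symmetric])
  ultimately show "\<exists>H \<subseteq> homogeneous_polys I. S \<inter> T = proj_space I - zero_locus I H"
    by blast
next
  fix \<K> :: "('a \<Rightarrow> complex) set set set"
  assume "\<forall>K\<in>\<K>. \<exists>F \<subseteq> homogeneous_polys I. K = proj_space I - zero_locus I F"
  then obtain F where F: "\<And>K. K \<in> \<K> \<Longrightarrow> F K \<subseteq> homogeneous_polys I"
    "\<And>K. K \<in> \<K> \<Longrightarrow> proj_space I - zero_locus I (F K) = K"
    by (metis (no_types, lifting))
  have "\<Union>\<K> = (\<Union>K\<in>\<K>. proj_space I - zero_locus I (F K))"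
    by (simp add: F(2))
  also have "\<dots> = proj_space I - zero_locus I (\<Union>(F ` \<K>))"
    by (auto simp: zero_locus_Union)
  finally have "\<Union>\<K> = proj_space I - zero_locus I (\<Union>(F ` \<K>))" .
  moreover have "\<Union>(F ` \<K>) \<subseteq> homogeneous_polys I"
    using F(1) by blast
  ultimately show "\<exists>H \<subseteq> homogeneous_polys I. \<Union>\<K> = proj_space I - zero_locus I H"
    by blast
qed

lemma openin_zariski:
  "openin (zariski I) U \<longleftrightarrow>
     (\<exists>F \<subseteq> homogeneous_polys I. U = proj_space I - zero_locus I F)"
  unfolding zariski_def by (simp add: topology_inverse'[OF istopology_zariski])

lemma topspace_zariski: "topspace (zariski I) = proj_space I"
proof
  show "topspace (zariski I) \<subseteq> proj_space I"
    using openin_topspace[of "zariski I"] unfolding openin_zariski by blast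
  have "1 \<in> homogeneous_polys I"
    by (auto simp: homogeneous_polys_def homogeneous_def monom_degree_def)
  moreover have "zero_locus I {1} = {}"
    by (auto simp: zero_locus_def proj_space_def line_eq)
  ultimately have "openin (zariski I) (proj_space I)"
    unfolding openin_zariski by (intro exI[of _ "{1}"]) auto
  then show "proj_space I \<subseteq> topspace (zariski I)" by (rule openin_subset)
qed

lemma closedin_zariski:
  "closedin (zariski I) Z \<longleftrightarrow> (\<exists>F \<subseteq> homogeneous_polys I. Z = zero_locus I F)"
proof -
  have "zero_locus I F \<subseteq> proj_space I" for F by (auto simp: zero_locus_def)
  then show ?thesis
    unfolding closedin_def openin_zariski topspace_zariski by (metis double_diff order_refl)
qed


section \<open>Dimension\<close>

definition irreducible_space :: "'a topology \<Rightarrow> bool" where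
  "irreducible_space T \<longleftrightarrow> topspace T \<noteq> {} \<and>
     (\<forall>A B. closedin T A \<and> closedin T B \<and> topspace T = A \<union> B
        \<longrightarrow> A = topspace T \<or> B = topspace T)"

text \<open>
  The topological (Krull) dimension: the supremum of the lengths \<open>k\<close> of strictly increasing chains
  \<open>Z 0 \<subset> \<dots> \<subset> Z k\<close> of irreducible closed subsets. The empty space gets the junk value \<open>0\<close>.
\<close>

definition krull_dim :: "'a topology \<Rightarrow> enat" where
  "krull_dim T = Sup {enat k | k. \<exists>Z :: nat \<Rightarrow> 'a set.
     (\<forall>i\<le>k. closedin T (Z i) \<and> irreducible_space (subtopology T (Z i))) \<and>
     (\<forall>i<k. Z i \<subset> Z (Suc i))}"

definition dimension :: "'i set \<Rightarrow> ('i \<Rightarrow> complex) set set \<Rightarrow> enat" where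
  "dimension I X = krull_dim (subtopology (zariski I) X)"


section \<open>Secant varieties\<close>

definition secant_variety ::
  "'i set \<Rightarrow> nat \<Rightarrow> ('i \<Rightarrow> complex) set set \<Rightarrow> ('i \<Rightarrow> complex) set set" where
  "secant_variety I s X =
     zariski I closure_of (\<Union>P \<in> {..<s} \<rightarrow> X. proj_span I (P ` {..<s}))"

text \<open>Here \<open>card I - 1\<close> is the dimension of the ambient projective space.\<close>

definition expected_dimension :: "'i set \<Rightarrow> nat \<Rightarrow> ('i \<Rightarrow> complex) set set \<Rightarrow> enat" where
  "expected_dimension I s X = min (enat (card I - 1)) (enat s * (dimension I X + 1) - 1)"

definition has_expected_dimension :: "'i set \<Rightarrow> nat \<Rightarrow> ('i \<Rightarrow> complex) set set \<Rightarrow> bool" where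
  "has_expected_dimension I s X \<longleftrightarrow>
     dimension I (secant_variety I s X) = expected_dimension I s X"


section \<open>Segre-Veronese varieties\<close>

text \<open>
  The global sections of \<open>\<O>(1,2)\<close> on \<open>\<P>\<^sup>m \<times> \<P>\<^sup>n\<close> have the monomial basis \<open>a\<^sub>i b\<^sub>j b\<^sub>k\<close> with
  \<open>i \<le> m\<close> and \<open>j \<le> k \<le> n\<close>.
\<close>

definition sv_index :: "nat \<Rightarrow> nat \<Rightarrow> (nat \<times> nat \<times> nat) set" where
  "sv_index m n = {(i, j, k). i \<le> m \<and> j \<le> k \<and> k \<le> n}"

lemma card_sv_index: "card (sv_index m n) = (m + 1) * (n + 2 choose 2)"
proof -
  have "sv_index m n = {..m} \<times> prod.swap ` (SIGMA k:{..n}. {..k})"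
    by (force simp: sv_index_def image_iff)
  then have "card (sv_index m n) = (m + 1) * card (SIGMA k:{..n}. {..k})"
    by (simp add: card_cartesian_product card_image)
  also have "card (SIGMA k:{..n}. {..k}) = (\<Sum>k\<le>n. k + 1)" by simp
  also have "\<dots> = (n + 2 choose 2)"
    by (induction n) (auto simp: numeral_2_eq_2)
  finally show ?thesis .
qed

definition sv_map ::
  "nat \<Rightarrow> nat \<Rightarrow> (nat \<Rightarrow> complex) \<Rightarrow> (nat \<Rightarrow> complex) \<Rightarrow> nat \<times> nat \<times> nat \<Rightarrow> complex" where
  "sv_map m n a b = (\<lambda>(i, j, k). if (i, j, k) \<in> sv_index m n then a i * b j * b k else 0)"

definition segre_veronese :: "nat \<Rightarrow> nat \<Rightarrow> (nat \<times> nat \<times> nat \<Rightarrow> complex) set set" where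
  "segre_veronese m n =
     {line (sv_map m n a b) | a b.
        a \<in> coord_space {..m} \<and> a \<noteq> 0 \<and> b \<in> coord_space {..n} \<and> b \<noteq> 0}"

text \<open>Division on \<^typ>\<open>nat\<close> rounds down.\<close>

definition sv_q :: "nat \<Rightarrow> nat \<Rightarrow> nat" where
  "sv_q m n = ((m + 1) * (n + 2 choose 2)) div (m + n + 1)"

end

theory Submission
  imports Defs "HOL-Computational_Algebra.Polynomial"
begin

text \<open>
  For \<open>s \<le> sv_q m n\<close> one has \<open>s (m + n + 1) \<le> (m + 1) (n + 2 choose 2)\<close>, so the expected dimension of the
  \<open>s\<close>-th secant variety is \<open>s (m + n + 1) - 1\<close>.  The argument has two halves.

  \<^bold>\<open>Independent tangent spaces.\<close>  By Terracini's lemma it is enough to find \<open>s\<close> points \<open>a\<^sub>p \<otimes> b\<^sub>p\<^sup>2\<close> of the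
  cone over the Segre-Veronese variety whose tangent spaces \<open>W \<otimes> b\<^sub>p\<^sup>2 + a\<^sub>p \<otimes> b\<^sub>p V\<close> are linearly
  independent in \<open>W \<otimes> S\<^sup>2 V\<close>, where \<open>dim W = m + 1\<close> and \<open>dim V = n + 1\<close>.  From
  \<open>(n + 1) (n + 2) = (m + n + 1) (n + 2 - m) + m\<^sup>2 - m\<close> it follows that, for large \<open>n\<close>, the number
  \<open>sv_q m n\<close> is at most \<open>\<lfloor>(m + 1) (n + 2 - m) / 2\<rfloor>\<close> (lemma \<open>sv_q_le\<close>).  That many points are constructed by
  induction on \<open>dim V\<close> in steps of two (lemma \<open>exists_independent_tangents\<close>).  To pass from \<open>V'\<close> to
  \<open>V = V' \<oplus> U\<close> with \<open>dim U = 2\<close>, the old points are kept in \<open>V'\<close> and \<open>m + 1\<close> new points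
  \<open>e\<^sub>i \<otimes> (c\<^sub>i + u\<^sub>i)\<^sup>2\<close> are added, where the \<open>e\<^sub>i\<close> are the standard basis of \<open>W\<close>, \<open>c\<^sub>i \<in> V'\<close>, the \<open>u\<^sub>i \<in> U\<close>
  are pairwise independent and the vectors \<open>c\<^sub>i + u\<^sub>i\<close> are independent.  Working modulo \<open>W \<otimes> S\<^sup>2 V'\<close>, the new
  tangent spaces and the remaining parts \<open>a\<^sub>p \<otimes> b\<^sub>p U\<close> of the old ones are independent as soon as the old
  points satisfy a linear condition in \<open>W \<otimes> (V / \<langle>c\<^sub>i + u\<^sub>i\<rangle>)\<close>, called \<open>extension_condition\<close>.  An explicit
  sparse configuration satisfies it.  This configuration need not satisfy the induction hypothesis, but both
  conditions say that a matrix with polynomial entries has trivial kernel, so each of them holds for all but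
  finitely many points of the line through a configuration satisfying one and a configuration satisfying the
  other.

  \<^bold>\<open>Dimension.\<close>  Krull dimension is controlled by counting linearly independent forms.  Along a chain
  \<open>Z\<^sub>0 \<subset> \<dots> \<subset> Z\<^sub>k\<close> of irreducible closed sets, choose forms \<open>f\<^sub>i\<close> vanishing on \<open>Z\<^sub>i\<^sub>-\<^sub>1\<close> but not on \<open>Z\<^sub>i\<close>; their
  monomials, padded by powers of a coordinate to a common degree, are independent on \<open>Z\<^sub>k\<close>, which gives
  \<open>(D + 1)\<^sup>k\<close> independent forms of degree proportional to \<open>D\<close> (lemma \<open>independent_forms_chain\<close>).  On the image
  of a polynomial map in \<open>r\<close> variables, the forms of degree \<open>d\<close> span a space of dimension at most
  \<open>(c d + 1)\<^sup>r\<close> (lemma \<open>independent_forms_slice_le\<close>).  Comparing growth bounds the dimension of the closure of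
  the image by \<open>r\<close> (lemma \<open>dimension_le\<close>).  Conversely, if the point of the affine cone and the \<open>r\<close> partial
  derivatives are independent at some parameter, then the lowest order terms of the dual linear forms
  produce \<open>(D + 1)\<^sup>r\<close> independent forms of degree \<open>r D\<close> (lemma \<open>independent_forms_tangent\<close>).  Freeing the
  parameters one after another therefore gives a chain of irreducible closed sets that is strictly
  increasing, because the growth rates differ (lemma \<open>dimension_ge\<close>).  Both bounds are applied to charts of
  the parametrisation \<open>(a\<^sub>p, b\<^sub>p)\<^sub>p \<mapsto> \<Sum>\<^sub>p a\<^sub>p \<otimes> b\<^sub>p\<^sup>2\<close> with \<open>s (m + n + 1) - 1\<close> free variables.
\<close>

section \<open>Matrices with trivial kernel\<close>

text \<open>
  The matrix \<open>f\<close> with rows \<open>R\<close> and columns \<open>C\<close> has linearly independent columns.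
\<close>

definition trivial_kernel :: "'r set \<Rightarrow> 'c set \<Rightarrow> ('r \<Rightarrow> 'c \<Rightarrow> complex) \<Rightarrow> bool" where
  "trivial_kernel R C f \<longleftrightarrow>
     (\<forall>x. (\<forall>r\<in>R. (\<Sum>c\<in>C. f r c * x c) = 0) \<longrightarrow> (\<forall>c\<in>C. x c = 0))"

lemma trivial_kernelD:
  "trivial_kernel R C f \<Longrightarrow> (\<And>r. r \<in> R \<Longrightarrow> (\<Sum>c\<in>C. f r c * x c) = 0) \<Longrightarrow> c \<in> C \<Longrightarrow> x c = 0"
  unfolding trivial_kernel_def by blast

text \<open>One step of division-free Gaussian elimination.\<close>

lemma trivial_kernel_pivot:
  assumes "finite C" "c0 \<notin> C" "r0 \<in> R" "f r0 c0 \<noteq> 0"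
  shows "trivial_kernel R (insert c0 C) f \<longleftrightarrow>
    trivial_kernel R C (\<lambda>r c. f r0 c0 * f r c - f r c0 * f r0 c)"
proof
  assume L: "trivial_kernel R (insert c0 C) f"
  show "trivial_kernel R C (\<lambda>r c. f r0 c0 * f r c - f r c0 * f r0 c)"
    unfolding trivial_kernel_def
  proof (intro allI impI)
    fix x assume x: "\<forall>r\<in>R. (\<Sum>c\<in>C. (f r0 c0 * f r c - f r c0 * f r0 c) * x c) = 0"
    define y where "y = x(c0 := - (\<Sum>c\<in>C. f r0 c * x c) / f r0 c0)"
    have sum_y: "(\<Sum>c\<in>C. f r c * y c) = (\<Sum>c\<in>C. f r c * x c)" for r
      using assms(2) by (intro sum.cong) (auto simp: y_def)
    have "(\<Sum>c\<in>insert c0 C. f r c * y c) = 0" if "r \<in> R" for r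
    proof -
      have "f r0 c0 * (\<Sum>c\<in>C. f r c * x c) - f r c0 * (\<Sum>c\<in>C. f r0 c * x c) = 0"
      proof -
        have "(\<Sum>c\<in>C. (f r0 c0 * f r c - f r c0 * f r0 c) * x c) =
            f r0 c0 * (\<Sum>c\<in>C. f r c * x c) - f r c0 * (\<Sum>c\<in>C. f r0 c * x c)"
          by (simp add: left_diff_distrib sum_subtractf sum_distrib_left mult.assoc)
        then show ?thesis using x that by simp
      qed
      then show ?thesis
        using assms by (simp add: sum_y) (simp add: y_def field_simps)
    qed
    then have "\<forall>c\<in>insert c0 C. y c = 0"
      using L unfolding trivial_kernel_def by blast
    then show "\<forall>c\<in>C. x c = 0"
      using assms(2) by (metis fun_upd_apply insert_iff y_def)
  qed
next
  assume R: "trivial_kernel R C (\<lambda>r c. f r0 c0 * f r c - f r c0 * f r0 c)"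
  show "trivial_kernel R (insert c0 C) f"
    unfolding trivial_kernel_def
  proof (intro allI impI)
    fix x assume x: "\<forall>r\<in>R. (\<Sum>c\<in>insert c0 C. f r c * x c) = 0"
    have eq: "(\<Sum>c\<in>C. f r c * x c) = - f r c0 * x c0" if "r \<in> R" for r
      using x assms(1,2) that by (simp add: add_eq_0_iff)
    have "(\<Sum>c\<in>C. (f r0 c0 * f r c - f r c0 * f r0 c) * x c) = 0" if "r \<in> R" for r
    proof -
      have "(\<Sum>c\<in>C. (f r0 c0 * f r c - f r c0 * f r0 c) * x c) =
          f r0 c0 * (\<Sum>c\<in>C. f r c * x c) - f r c0 * (\<Sum>c\<in>C. f r0 c * x c)"
        by (simp add: algebra_simps sum_subtractf sum_distrib_left)
      then show ?thesis by (simp add: eq that assms(3))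
    qed
    then have C: "\<forall>c\<in>C. x c = 0"
      using R unfolding trivial_kernel_def by blast
    then have "f r0 c0 * x c0 = 0" using eq[OF assms(3)] by simp
    then show "\<forall>c\<in>insert c0 C. x c = 0" using C assms(4) by simp
  qed
qed

lemma trivial_kernel_pivot_exists:
  assumes "finite C" "c0 \<notin> C" "trivial_kernel R (insert c0 C) f"
  obtains r0 where "r0 \<in> R" "f r0 c0 \<noteq> 0"
proof -
  have "\<exists>r0\<in>R. f r0 c0 \<noteq> 0"
  proof (rule ccontr)
    assume "\<not> ?thesis"
    then have "(\<Sum>c\<in>insert c0 C. f r c * (if c = c0 then 1 else 0)) = 0" if "r \<in> R" for r
      using that assms(1) by (simp add: if_distrib[of "\<lambda>x. _ * x"] sum.delta cong: if_cong)
    from trivial_kernelD[OF assms(3) this, of c0] show False by simp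
  qed
  then show ?thesis using that by blast
qed

text \<open>
  Independence of columns is an open condition on a pencil of matrices: the pivots occurring in the
  elimination at \<open>t0\<close> are nonzero polynomials in \<open>t\<close>, so the elimination works for all but finitely many \<open>t\<close>.
\<close>

lemma finite_nontrivial_kernel:
  fixes f :: "'r \<Rightarrow> 'c \<Rightarrow> complex poly"
  assumes "finite C" "trivial_kernel R C (\<lambda>r c. poly (f r c) t0)"
  shows "finite {t. \<not> trivial_kernel R C (\<lambda>r c. poly (f r c) t)}"
  using assms
proof (induction C arbitrary: f rule: finite_induct)
  case empty
  then show ?case by (simp add: trivial_kernel_def)
next
  case (insert c0 C)
  obtain r0 where r0: "r0 \<in> R" "poly (f r0 c0) t0 \<noteq> 0"
    using trivial_kernel_pivot_exists[OF insert.hyps insert.prems] by blast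
  define g where "g r c = f r0 c0 * f r c - f r c0 * f r0 c" for r c
  have piv: "trivial_kernel R (insert c0 C) (\<lambda>r c. poly (f r c) t) \<longleftrightarrow>
      trivial_kernel R C (\<lambda>r c. poly (g r c) t)" if "poly (f r0 c0) t \<noteq> 0" for t
    using trivial_kernel_pivot[OF insert.hyps r0(1), of "\<lambda>r c. poly (f r c) t"] that
    by (simp add: g_def)
  have "finite {t. \<not> trivial_kernel R C (\<lambda>r c. poly (g r c) t)}"
    using insert.IH[of g] piv[OF r0(2)] insert.prems by blast
  moreover have "finite {t. poly (f r0 c0) t = 0}"
    using r0(2) by (intro poly_roots_finite) auto
  ultimately have "finite ({t. \<not> trivial_kernel R C (\<lambda>r c. poly (g r c) t)} \<union>
      {t. poly (f r0 c0) t = 0})" by blast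
  then show ?case by (rule rev_finite_subset) (use piv in blast)
qed

lemma trivial_kernel_left_inverse:
  assumes "finite C" "finite R" "trivial_kernel R C f"
  shows "\<exists>h. \<forall>c\<in>C. \<forall>c'\<in>C. (\<Sum>r\<in>R. h c r * f r c') = (if c = c' then 1 else 0)"
  using assms(1,3)
proof (induction C arbitrary: f rule: finite_induct)
  case (insert c0 C)
  obtain r0 where r0: "r0 \<in> R" "f r0 c0 \<noteq> 0"
    using trivial_kernel_pivot_exists[OF insert.hyps insert.prems] by blast
  let ?g = "\<lambda>r c. f r0 c0 * f r c - f r c0 * f r0 c"
  have "trivial_kernel R C ?g"
    using trivial_kernel_pivot[of C c0 r0 R f, OF insert.hyps r0] insert.prems by blast
  from insert.IH[OF this] obtain h where
    h: "\<And>c c'. c \<in> C \<Longrightarrow> c' \<in> C \<Longrightarrow> (\<Sum>r\<in>R. h c r * ?g r c') = (if c = c' then 1 else 0)"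
    by blast
  define k where "k c r = f r0 c0 * h c r - (if r = r0 then \<Sum>r'\<in>R. h c r' * f r' c0 else 0)" for c r
  have k: "(\<Sum>r\<in>R. k c r * z r) = (\<Sum>r\<in>R. h c r * (f r0 c0 * z r - f r c0 * z r0))" for c z
  proof -
    have "(\<Sum>r\<in>R. k c r * z r) = (\<Sum>r\<in>R. f r0 c0 * h c r * z r)
        - (\<Sum>r\<in>R. if r = r0 then (\<Sum>r'\<in>R. h c r' * f r' c0) * z r else 0)"
      unfolding k_def sum_subtractf[symmetric] by (intro sum.cong) (auto simp: algebra_simps)
    then show ?thesis
      using assms(2) r0(1)
      by (simp add: sum.delta algebra_simps sum_subtractf sum_distrib_left sum_distrib_right)
  qed
  define k0 where "k0 r = ((if r = r0 then 1 else 0) - (\<Sum>c\<in>C. f r0 c * k c r)) / f r0 c0" for r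
  have k0: "(\<Sum>r\<in>R. k0 r * z r) = (z r0 - (\<Sum>c\<in>C. f r0 c * (\<Sum>r\<in>R. k c r * z r))) / f r0 c0" for z
  proof -
    have "(\<Sum>r\<in>R. k0 r * z r) = (\<Sum>r\<in>R. ((if r = r0 then z r else 0) - (\<Sum>c\<in>C. f r0 c * (k c r * z r))) / f r0 c0)"
      unfolding k0_def by (intro sum.cong) (auto simp: field_simps sum_distrib_left sum_distrib_right)
    also have "\<dots> = (z r0 - (\<Sum>r\<in>R. \<Sum>c\<in>C. f r0 c * (k c r * z r))) / f r0 c0"
      using assms(2) r0(1) by (simp add: sum_divide_distrib[symmetric] sum_subtractf sum.delta)
    also have "(\<Sum>r\<in>R. \<Sum>c\<in>C. f r0 c * (k c r * z r)) = (\<Sum>c\<in>C. f r0 c * (\<Sum>r\<in>R. k c r * z r))"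
      by (subst sum.swap) (simp add: sum_distrib_left)
    finally show ?thesis .
  qed
  have kc0: "(\<Sum>r\<in>R. k c r * f r c0) = 0" for c unfolding k by simp
  have kc: "(\<Sum>r\<in>R. k c r * f r c') = (if c = c' then 1 else 0)" if "c \<in> C" "c' \<in> C" for c c'
    unfolding k using h[OF that] by simp
  have k0c0: "(\<Sum>r\<in>R. k0 r * f r c0) = 1" unfolding k0 kc0 using r0 by simp
  have k0c: "(\<Sum>r\<in>R. k0 r * f r c) = 0" if "c \<in> C" for c
  proof -
    have "(\<Sum>c'\<in>C. f r0 c' * (\<Sum>r\<in>R. k c' r * f r c)) = (\<Sum>c'\<in>C. if c' = c then f r0 c' else 0)"
      using that by (intro sum.cong) (auto simp: kc)
    then show ?thesis unfolding k0 using that insert.hyps(1) by (simp add: sum.delta)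
  qed
  show ?case
  proof (intro exI ballI)
    fix c c' assume "c \<in> insert c0 C" "c' \<in> insert c0 C"
    then show "(\<Sum>r\<in>R. (if c = c0 then k0 else k c) r * f r c') = (if c = c' then 1 else 0)"
      using insert.hyps(2) kc0 kc k0c0 k0c by auto
  qed
qed simp

lemma sum_fun_apply: "(\<Sum>l\<in>B. h l) y = (\<Sum>l\<in>B. h l y)"
  for h :: "'a \<Rightarrow> 'b \<Rightarrow> complex"
  by (induction B rule: infinite_finite_induct) auto

lemma card_le_of_independent_family:
  assumes "finite A" "finite M" "\<And>i. i \<in> A \<Longrightarrow> g i \<in> cspan M"
    and ind: "\<And>c i. (\<forall>x. (\<Sum>i\<in>A. c i * g i x) = 0) \<Longrightarrow> i \<in> A \<Longrightarrow> c i = 0"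
  shows "card A \<le> card M"
proof -
  have inj: "inj_on g A"
  proof (rule inj_onI, rule ccontr)
    fix i j assume ij: "i \<in> A" "j \<in> A" "g i = g j" "i \<noteq> j"
    let ?c = "\<lambda>l. if l = i then 1 else if l = j then -1 else (0::complex)"
    have "(\<Sum>l\<in>A. ?c l * g l x) = 0" for x
    proof -
      have "(\<Sum>l\<in>A. ?c l * g l x) = (\<Sum>l\<in>{i,j}. ?c l * g l x)"
        using ij assms(1) by (intro sum.mono_neutral_right) auto
      then show ?thesis using ij by simp
    qed
    from ind[of ?c i] this ij(1) show False by simp
  qed
  have "cfun.independent (g ` A)"
  proof (rule cfun.independent_if_scalars_zero)
    fix f x assume 0: "(\<Sum>x\<in>g ` A. cscale (f x) x) = 0" and x: "x \<in> g ` A"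
    then obtain i where i: "i \<in> A" "x = g i" by blast
    have "(\<Sum>i\<in>A. cscale (f (g i)) (g i)) = 0"
      using 0 by (simp add: sum.reindex[OF inj])
    then have "(\<Sum>i\<in>A. cscale (f (g i)) (g i)) y = 0" for y by simp
    then have "\<forall>y. (\<Sum>i\<in>A. f (g i) * g i y) = 0"
      unfolding sum_fun_apply by (simp add: cscale_def)
    then show "f x = 0" using ind[of "\<lambda>i. f (g i)" i] i by simp
  qed (simp add: assms)
  moreover have "g ` A \<subseteq> cfun.span M" using assms(3) by blast
  ultimately have "card (g ` A) \<le> card M"
    using cfun.independent_span_bound[OF assms(2)] by blast
  then show ?thesis by (simp add: card_image[OF inj])
qed

section \<open>Tangent spaces and their independence\<close>

text \<open>
  The coordinate at \<open>e\<^sub>i \<otimes> e\<^sub>j e\<^sub>k\<close> of \<open>\<Sum>\<^sub>p (w\<^sub>p \<otimes> b\<^sub>p\<^sup>2 + a\<^sub>p \<otimes> (b\<^sub>p v\<^sub>p + v\<^sub>p b\<^sub>p))\<close>, which is the derivative of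
  \<open>\<Sum>\<^sub>p a\<^sub>p \<otimes> b\<^sub>p\<^sup>2\<close> in the direction \<open>(w, v)\<close>.  Elements of \<open>S\<^sup>2 V\<close> are treated as symmetric matrices.
\<close>

definition tangent_sum ::
  "nat \<Rightarrow> (nat \<Rightarrow> nat \<Rightarrow> complex) \<Rightarrow> (nat \<Rightarrow> nat \<Rightarrow> complex) \<Rightarrow> (nat \<Rightarrow> nat \<Rightarrow> complex) \<Rightarrow>
    (nat \<Rightarrow> nat \<Rightarrow> complex) \<Rightarrow> nat \<Rightarrow> nat \<Rightarrow> nat \<Rightarrow> complex" where
  "tangent_sum s a b w v i j k =
     (\<Sum>p<s. w p i * b p j * b p k + a p i * (b p j * v p k + b p k * v p j))"

text \<open>
  The tangent spaces to the cone at the \<open>s\<close> nonzero points \<open>a\<^sub>p \<otimes> b\<^sub>p\<^sup>2\<close> have the maximal dimension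
  \<open>m + N\<close> each and are linearly independent; here \<open>N = dim V\<close>.  Since \<open>(- 2 a\<^sub>p, b\<^sub>p)\<close> always lies in the
  kernel of the derivative, the condition is that the kernel contains nothing else.
\<close>

definition independent_tangents ::
  "nat \<Rightarrow> nat \<Rightarrow> nat \<Rightarrow> (nat \<Rightarrow> nat \<Rightarrow> complex) \<Rightarrow> (nat \<Rightarrow> nat \<Rightarrow> complex) \<Rightarrow> bool" where
  "independent_tangents m N s a b \<longleftrightarrow>
     (\<forall>p<s. (\<exists>i\<le>m. a p i \<noteq> 0) \<and> (\<exists>j<N. b p j \<noteq> 0)) \<and>
     (\<forall>w v. (\<forall>i\<le>m. \<forall>j<N. \<forall>k<N. tangent_sum s a b w v i j k = 0) \<longrightarrow>
        (\<forall>p<s. \<exists>l. (\<forall>i\<le>m. w p i = - 2 * l * a p i) \<and> (\<forall>j<N. v p j = l * b p j)))"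

text \<open>
  The matrix of the derivative, with column \<open>(p, Inl i)\<close> for \<open>w\<^sub>p\<^sub>,\<^sub>i\<close> and \<open>(p, Inr l)\<close> for \<open>v\<^sub>p\<^sub>,\<^sub>l\<close>.  The extra
  rows \<open>Inr q\<close> express \<open>v\<^sub>q\<^sub>,\<^sub>h\<^sub>q = 0\<close>; where \<open>b\<^sub>q\<^sub>,\<^sub>h\<^sub>q \<noteq> 0\<close> they remove the kernel vectors
  \<open>(- 2 a\<^sub>q, b\<^sub>q)\<close>, so that independence of tangent spaces becomes triviality of the kernel.
\<close>

definition tangent_matrix ::
  "(nat \<Rightarrow> nat \<Rightarrow> 'a::comm_ring_1) \<Rightarrow> (nat \<Rightarrow> nat \<Rightarrow> 'a) \<Rightarrow> (nat \<Rightarrow> nat) \<Rightarrow>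
    (nat \<times> nat \<times> nat) + nat \<Rightarrow> nat \<times> (nat + nat) \<Rightarrow> 'a" where
  "tangent_matrix a b h r c = (case r of
     Inl (i, j, k) \<Rightarrow> (case c of
        (p, Inl i') \<Rightarrow> if i' = i then b p j * b p k else 0
      | (p, Inr l) \<Rightarrow> a p i * ((if l = k then b p j else 0) + (if l = j then b p k else 0)))
   | Inr q \<Rightarrow> (case c of (p, Inl i') \<Rightarrow> 0 | (p, Inr l) \<Rightarrow> if p = q \<and> l = h q then 1 else 0))"

definition tangent_rows :: "nat \<Rightarrow> nat \<Rightarrow> nat \<Rightarrow> ((nat \<times> nat \<times> nat) + nat) set" where
  "tangent_rows m N s = Inl ` ({..m} \<times> {..<N} \<times> {..<N}) \<union> Inr ` {..<s}"

definition tangent_cols :: "nat \<Rightarrow> nat \<Rightarrow> nat \<Rightarrow> (nat \<times> (nat + nat)) set" where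
  "tangent_cols m N s = {..<s} \<times> ({..m} <+> {..<N})"

lemma finite_tangent_cols [simp]: "finite (tangent_cols m N s)"
  by (simp add: tangent_cols_def)

lemma sum_tangent_cols:
  "(\<Sum>c\<in>tangent_cols m N s. F c) = (\<Sum>p<s. (\<Sum>i\<le>m. F (p, Inl i)) + (\<Sum>l<N. F (p, Inr l)))"
  proof -
  have "(\<Sum>c\<in>tangent_cols m N s. F c) = (\<Sum>p<s. \<Sum>r\<in>{..m} <+> {..<N}. F (p, r))"
    by (simp add: tangent_cols_def sum.cartesian_product)
  then show ?thesis by (simp add: sum.Plus)
qed

lemma tangent_matrix_row_Inl:
  assumes "i \<le> m" "j < N" "k < N"
  shows "(\<Sum>c\<in>tangent_cols m N s. tangent_matrix a b h (Inl (i, j, k)) c * x c) =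
    tangent_sum s a b (\<lambda>p i. x (p, Inl i)) (\<lambda>p l. x (p, Inr l)) i j k"
  unfolding sum_tangent_cols tangent_sum_def
proof (intro sum.cong refl)
  fix p
  have "(\<Sum>i'\<le>m. tangent_matrix a b h (Inl (i, j, k)) (p, Inl i') * x (p, Inl i')) =
      (\<Sum>i'\<le>m. if i' = i then b p j * b p k * x (p, Inl i') else 0)"
    by (intro sum.cong) (auto simp: tangent_matrix_def)
  also have "\<dots> = x (p, Inl i) * b p j * b p k"
    using assms by simp
  finally have 1: "(\<Sum>i'\<le>m. tangent_matrix a b h (Inl (i, j, k)) (p, Inl i') * x (p, Inl i')) =
    x (p, Inl i) * b p j * b p k" .
  have "(\<Sum>l<N. tangent_matrix a b h (Inl (i, j, k)) (p, Inr l) * x (p, Inr l)) =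
      (\<Sum>l<N. (if l = k then a p i * b p j * x (p, Inr l) else 0) +
             (if l = j then a p i * b p k * x (p, Inr l) else 0))"
    by (intro sum.cong) (auto simp: tangent_matrix_def algebra_simps)
  also have "\<dots> = a p i * (b p j * x (p, Inr k) + b p k * x (p, Inr j))"
    using assms by (simp add: sum.distrib algebra_simps)
  finally show "(\<Sum>i'\<le>m. tangent_matrix a b h (Inl (i, j, k)) (p, Inl i') * x (p, Inl i')) +
      (\<Sum>l<N. tangent_matrix a b h (Inl (i, j, k)) (p, Inr l) * x (p, Inr l)) =
      x (p, Inl i) * b p j * b p k + a p i * (b p j * x (p, Inr k) + b p k * x (p, Inr j))"
    by (simp add: 1)
qed

lemma tangent_matrix_row_Inr:
  assumes "q < s" "h q < N"
  shows "(\<Sum>c\<in>tangent_cols m N s. tangent_matrix a b h (Inr q) c * x c) = x (q, Inr (h q))"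
proof -
  have "(\<Sum>c\<in>tangent_cols m N s. tangent_matrix a b h (Inr q) c * x c) =
      (\<Sum>c\<in>tangent_cols m N s. if c = (q, Inr (h q)) then x c else 0)"
    by (intro sum.cong) (auto simp: tangent_matrix_def split: sum.splits if_splits)
  also have "\<dots> = x (q, Inr (h q))"
    using assms by (auto simp: tangent_cols_def)
  finally show ?thesis .
qed

lemma independent_tangents_iff:
  assumes h: "\<And>p. p < s \<Longrightarrow> h p < N" "\<And>p. p < s \<Longrightarrow> b p (h p) \<noteq> 0"
    and a: "\<And>p. p < s \<Longrightarrow> \<exists>i\<le>m. a p i \<noteq> 0"
  shows "independent_tangents m N s a b \<longleftrightarrow>
    trivial_kernel (tangent_rows m N s) (tangent_cols m N s) (tangent_matrix a b h)"
proof
  assume L: "independent_tangents m N s a b"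
  show "trivial_kernel (tangent_rows m N s) (tangent_cols m N s) (tangent_matrix a b h)"
    unfolding trivial_kernel_def
  proof (intro allI impI ballI)
    fix x c
    assume x: "\<forall>r\<in>tangent_rows m N s. (\<Sum>c\<in>tangent_cols m N s. tangent_matrix a b h r c * x c) = 0"
      and c: "c \<in> tangent_cols m N s"
    define w where "w p i = x (p, Inl i)" for p i
    define v where "v p i = x (p, Inr i)" for p i
    have "tangent_sum s a b w v i j k = 0" if "i \<le> m" "j < N" "k < N" for i j k
    proof -
      have "Inl (i, j, k) \<in> tangent_rows m N s" using that by (simp add: tangent_rows_def)
      then show ?thesis
        using x tangent_matrix_row_Inl[OF that, where s = s and a = a and b = b and h = h and x = x] unfolding w_def v_def by simp
    qed
    then have ker: "\<exists>l. (\<forall>i\<le>m. w p i = - 2 * l * a p i) \<and> (\<forall>j<N. v p j = l * b p j)" if "p < s" for p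
      using L that unfolding independent_tangents_def by blast
    have chart: "v p (h p) = 0" if "p < s" for p
    proof -
      have "Inr p \<in> tangent_rows m N s" using that by (simp add: tangent_rows_def)
      then show ?thesis
        using x tangent_matrix_row_Inr[where q = p and s = s and h = h and N = N and m = m and a = a and b = b and x = x, OF that h(1)[OF that]] unfolding v_def by simp
    qed
    have z: "(\<forall>i\<le>m. w p i = 0) \<and> (\<forall>j<N. v p j = 0)" if p: "p < s" for p
    proof -
      obtain l where l: "\<forall>i\<le>m. w p i = - 2 * l * a p i" "\<forall>j<N. v p j = l * b p j"
        using ker[OF p] by blast
      then have "l = 0" using chart[OF p] h[OF p] by auto
      then show ?thesis using l by simp
    qed
    obtain p r where pr: "c = (p, r)" "p < s" "r \<in> {..m} <+> {..<N}"
      using c by (auto simp: tangent_cols_def)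
    show "x c = 0" using pr(3) z[OF pr(2)] by (auto simp: pr(1) w_def v_def)
  qed
next
  assume R: "trivial_kernel (tangent_rows m N s) (tangent_cols m N s) (tangent_matrix a b h)"
  show "independent_tangents m N s a b"
    unfolding independent_tangents_def
  proof (intro conjI allI impI)
    fix w v p
    assume wv: "\<forall>i\<le>m. \<forall>j<N. \<forall>k<N. tangent_sum s a b w v i j k = 0" and p: "p < s"
    define l where "l q = v q (h q) / b q (h q)" for q
    define x where "x c = (case c of (q, Inl i) \<Rightarrow> w q i + 2 * l q * a q i
      | (q, Inr j) \<Rightarrow> v q j - l q * b q j)" for c
    have "(\<Sum>c\<in>tangent_cols m N s. tangent_matrix a b h r c * x c) = 0"
      if r: "r \<in> tangent_rows m N s" for r
    proof (cases r)
      case (Inl t)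
      obtain i j k where t: "t = (i, j, k)" by (cases t) auto
      have ijk: "i \<le> m" "j < N" "k < N" using r by (auto simp: Inl t tangent_rows_def)
      have "tangent_sum s a b (\<lambda>p i. x (p, Inl i)) (\<lambda>p l. x (p, Inr l)) i j k =
          tangent_sum s a b w v i j k"
        unfolding tangent_sum_def x_def by (intro sum.cong) (auto simp: algebra_simps)
      then show ?thesis
        unfolding Inl t tangent_matrix_row_Inl[OF ijk] using wv ijk by simp
    next
      case (Inr q)
      have "q < s" using r by (auto simp: Inr tangent_rows_def)
      then show ?thesis
        unfolding Inr using h[of q] by (subst tangent_matrix_row_Inr) (auto simp: x_def l_def)
    qed
    then have "\<forall>c\<in>tangent_cols m N s. x c = 0"
      using R unfolding trivial_kernel_def by blast
    then have x0: "x (p, Inl i) = 0" "j < N \<Longrightarrow> x (p, Inr j) = 0" if "i \<le> m" for i j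
      using p that by (auto simp: tangent_cols_def)
    have "w p i = - 2 * l p * a p i" if "i \<le> m" for i
      using x0(1)[OF that] by (simp add: x_def eq_neg_iff_add_eq_0)
    moreover have "v p j = l p * b p j" if "j < N" for j
      using x0(2)[of 0 j] that by (simp add: x_def)
    ultimately show "\<exists>l. (\<forall>i\<le>m. w p i = - 2 * l * a p i) \<and> (\<forall>j<N. v p j = l * b p j)" by blast
  qed (use a h in auto)
qed

text \<open>The point with parameter \<open>t\<close> on the line through two configurations of points.\<close>

definition segment_point :: "(nat \<Rightarrow> nat \<Rightarrow> complex) \<Rightarrow> (nat \<Rightarrow> nat \<Rightarrow> complex) \<Rightarrow> complex \<Rightarrow> nat \<Rightarrow> nat \<Rightarrow> complex" where
  "segment_point a a' t = (\<lambda>p i. a p i + t * (a' p i - a p i))"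

text \<open>The coordinates of \<open>segment_point\<close> as polynomials in the parameter.\<close>

definition segment_poly :: "(nat \<Rightarrow> nat \<Rightarrow> complex) \<Rightarrow> (nat \<Rightarrow> nat \<Rightarrow> complex) \<Rightarrow> nat \<Rightarrow> nat \<Rightarrow> complex poly" where
  "segment_poly a a' = (\<lambda>p i. [:a p i, a' p i - a p i:])"

lemma poly_segment_poly: "poly (segment_poly a a' p i) t = segment_point a a' t p i"
  by (simp add: segment_poly_def segment_point_def)

lemma segment_point_0 [simp]: "segment_point a a' 0 = a"
  by (simp add: segment_point_def)

lemma finite_segment_zeros:
  assumes "a p i \<noteq> 0"
  shows "finite {t. segment_point a a' t p i = 0}"
proof -
  have "segment_poly a a' p i \<noteq> 0" using assms by (auto simp: segment_poly_def)
  from poly_roots_finite[OF this] show ?thesis by (simp add: poly_segment_poly)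
qed

text \<open>Independence of the tangent spaces at one point of a line persists at all but finitely many points.\<close>

lemma independent_tangents_generic:
  assumes ind: "independent_tangents m N s a b"
  shows "finite {t. \<not> independent_tangents m N s (segment_point a a' t) (segment_point b b' t)}"
proof -
  have "\<forall>p. p < s \<longrightarrow> (\<exists>j<N. b p j \<noteq> 0)" "\<forall>p. p < s \<longrightarrow> (\<exists>i\<le>m. a p i \<noteq> 0)"
    using ind unfolding independent_tangents_def by auto
  then obtain h g where h: "\<And>p. p < s \<Longrightarrow> h p < N" "\<And>p. p < s \<Longrightarrow> b p (h p) \<noteq> 0"
    and g: "\<And>p. p < s \<Longrightarrow> g p \<le> m" "\<And>p. p < s \<Longrightarrow> a p (g p) \<noteq> 0"
    by metis
  let ?A = "segment_point a a'" and ?B = "segment_point b b'"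
  let ?M = "\<lambda>r c. tangent_matrix (segment_poly a a') (segment_poly b b') h r c"
  have M: "poly (?M r c) t = tangent_matrix (?A t) (?B t) h r c" for r c t
    by (auto simp: tangent_matrix_def poly_segment_poly split: sum.splits prod.splits)
  have "trivial_kernel (tangent_rows m N s) (tangent_cols m N s) (\<lambda>r c. poly (?M r c) 0)"
    unfolding M segment_point_0 
    by (subst independent_tangents_iff[symmetric]) (use ind h g in blast)+
  then have "finite {t. \<not> trivial_kernel (tangent_rows m N s) (tangent_cols m N s)
      (\<lambda>r c. poly (?M r c) t)}"
    by (intro finite_nontrivial_kernel) auto
  moreover have "finite (\<Union>p<s. {t. ?A t p (g p) = 0} \<union> {t. ?B t p (h p) = 0})"
    using finite_segment_zeros g(2) h(2) by auto
  ultimately have "finite ({t. \<not> trivial_kernel (tangent_rows m N s) (tangent_cols m N s)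
      (\<lambda>r c. poly (?M r c) t)} \<union> (\<Union>p<s. {t. ?A t p (g p) = 0} \<union> {t. ?B t p (h p) = 0}))"
    by blast
  moreover have "{t. \<not> independent_tangents m N s (?A t) (?B t)} \<subseteq> \<dots>"
  proof
    fix t assume t: "t \<in> {t. \<not> independent_tangents m N s (?A t) (?B t)}"
    show "t \<in> {t. \<not> trivial_kernel (tangent_rows m N s) (tangent_cols m N s)
      (\<lambda>r c. poly (?M r c) t)} \<union> (\<Union>p<s. {t. ?A t p (g p) = 0} \<union> {t. ?B t p (h p) = 0})"
    proof (rule ccontr)
      assume neg: "\<not> ?thesis"
      then have "\<And>p. p < s \<Longrightarrow> ?A t p (g p) \<noteq> 0" "\<And>p. p < s \<Longrightarrow> ?B t p (h p) \<noteq> 0"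
        by auto
      then have "independent_tangents m N s (?A t) (?B t) \<longleftrightarrow>
         trivial_kernel (tangent_rows m N s) (tangent_cols m N s) (tangent_matrix (?A t) (?B t) h)"
        by (intro independent_tangents_iff) (use h(1) g(1) in blast)+
      then show False using neg t by (simp add: M)
    qed
  qed
  ultimately show ?thesis by (rule rev_finite_subset)
qed

lemma independent_tangents_subset:
  assumes "independent_tangents m N s a b" "s' \<le> s"
  shows "independent_tangents m N s' a b"
  unfolding independent_tangents_def
proof (intro conjI allI impI)
  fix w v p assume wv: "\<forall>i\<le>m. \<forall>j<N. \<forall>k<N. tangent_sum s' a b w v i j k = 0" and p: "p < s'"
  define w' where "w' q = (if q < s' then w q else 0)" for q
  define v' where "v' q = (if q < s' then v q else 0)" for q
  have "tangent_sum s a b w' v' i j k = tangent_sum s' a b w v i j k" for i j k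
    unfolding tangent_sum_def using assms(2)
    by (intro sum.mono_neutral_cong_right) (auto simp: w'_def v'_def)
  with assms(1) wv p assms(2) have
    "\<exists>l. (\<forall>i\<le>m. w' p i = - 2 * l * a p i) \<and> (\<forall>j<N. v' p j = l * b p j)"
    unfolding independent_tangents_def by simp
  then show "\<exists>l. (\<forall>i\<le>m. w p i = - 2 * l * a p i) \<and> (\<forall>j<N. v p j = l * b p j)"
    using p by (simp add: w'_def v'_def)
qed (use assms in \<open>auto simp: independent_tangents_def\<close>)

section \<open>Adding two dimensions and \<open>m + 1\<close> points\<close>

text \<open>
  The two coordinates of \<open>u\<^sub>i \<in> U\<close>: \<open>(0, 1)\<close> for \<open>i = m\<close>, \<open>(1, 0)\<close> for \<open>i = m - 1\<close>, and \<open>(1, i + 1)\<close> for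
  smaller \<open>i\<close>.  These vectors are pairwise linearly independent.
\<close>

definition slope0 :: "nat \<Rightarrow> nat \<Rightarrow> complex" where
  "slope0 m i = (if i = m then 0 else 1)"

definition slope1 :: "nat \<Rightarrow> nat \<Rightarrow> complex" where
  "slope1 m i = (if i = m then 1 else if Suc i = m then 0 else of_nat (Suc i))"

lemma slopes_independent:
  assumes "i \<noteq> j" "slope0 m i * y - slope1 m i * x = 0" "slope0 m j * y - slope1 m j * x = 0"
  shows "x = 0 \<and> y = 0"
  using assms by (auto simp: slope0_def slope1_def split: if_splits simp del: of_nat_Suc)

lemma slopes_nonparallel:
  assumes "i \<noteq> j"
  shows "slope0 m i * slope1 m j - slope1 m i * slope0 m j \<noteq> 0"
proof
  assume 0: "slope0 m i * slope1 m j - slope1 m i * slope0 m j = 0"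
  then have "slope0 m j = 0 \<and> slope1 m j = 0"
    using slopes_independent[OF assms, of m "slope1 m j" "slope0 m j"] by (simp add: algebra_simps)
  then show False by (auto simp: slope0_def slope1_def split: if_splits)
qed

text \<open>
  The condition on the old points under which the new ones can be added.  The pair \<open>(x\<^sub>p, y\<^sub>p)\<close> is the
  \<open>U\<close>-component of a tangent direction \<open>v\<^sub>p\<close>.  The indices \<open>j\<close> with \<open>m - 1 \<le> j < N\<close> are coordinates on the
  quotient of \<open>V\<close> by the new points, and the last factor is the area form of \<open>u\<^sub>i\<close> and \<open>(x\<^sub>p, y\<^sub>p)\<close>.
\<close>

definition extension_condition ::
  "nat \<Rightarrow> nat \<Rightarrow> nat \<Rightarrow> (nat \<Rightarrow> nat \<Rightarrow> complex) \<Rightarrow> (nat \<Rightarrow> nat \<Rightarrow> complex) \<Rightarrow> bool" where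
  "extension_condition m N s a b \<longleftrightarrow>
     (\<forall>x y. (\<forall>i\<le>m. \<forall>j<N. m \<le> Suc j \<longrightarrow>
               (\<Sum>p<s. a p i * b p j * (slope0 m i * y p - slope1 m i * x p)) = 0) \<longrightarrow>
        (\<forall>p<s. x p = 0 \<and> y p = 0))"

text \<open>
  The new point \<open>c\<^sub>l + u\<^sub>l \<in> V' \<oplus> U\<close>, with \<open>U\<close> spanned by the basis vectors of index \<open>N\<close> and \<open>N + 1\<close>, and
  with \<open>c\<^sub>l\<close> the basis vector of index \<open>l\<close> for \<open>l < m - 1\<close> and \<open>c\<^sub>l = 0\<close> for \<open>l \<in> {m - 1, m}\<close>.  As
  \<open>u\<^sub>m\<^sub>-\<^sub>1\<close> and \<open>u\<^sub>m\<close> are the basis of \<open>U\<close>, the quotient of \<open>V\<close> by the new points is the coordinate space on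
  the indices \<open>m - 1, \<dots>, N - 1\<close>.
\<close>

definition new_point :: "nat \<Rightarrow> nat \<Rightarrow> nat \<Rightarrow> nat \<Rightarrow> complex" where
  "new_point m N l j =
     (if j < N then (if j = l \<and> Suc l < m then 1 else 0)
      else if j = N then slope0 m l else slope1 m l)"

text \<open>
  The extended configuration: the old points, with \<open>b\<^sub>p\<close> cut off to \<open>V'\<close>, followed by the \<open>m + 1\<close> new ones,
  where the \<open>i\<close>-th new point has the \<open>i\<close>-th basis vector of \<open>W\<close> as its first component.
\<close>

definition extend_a :: "nat \<Rightarrow> (nat \<Rightarrow> nat \<Rightarrow> complex) \<Rightarrow> nat \<Rightarrow> nat \<Rightarrow> complex" where
  "extend_a s a p = (if p < s then a p else (\<lambda>i. if i = p - s then 1 else 0))"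

definition extend_b :: "nat \<Rightarrow> nat \<Rightarrow> nat \<Rightarrow> (nat \<Rightarrow> nat \<Rightarrow> complex) \<Rightarrow> nat \<Rightarrow> nat \<Rightarrow> complex" where
  "extend_b m N s b p = (if p < s then (\<lambda>j. if j < N then b p j else 0) else new_point m N (p - s))"

lemma sum_lessThan_add_nat: "(\<Sum>p<s + r. f p) = (\<Sum>p<s. f p) + (\<Sum>l<r. f (s + l))"
  for f :: "nat \<Rightarrow> 'a::comm_monoid_add"
  by (induction r) (auto simp: add.assoc)

text \<open>
  Only the \<open>i\<close>-th new point has \<open>e\<^sub>i\<close> as its first component.  Its kernel vector is used to move \<open>w\<^sub>i\<^sub>,\<^sub>i\<close> into
  \<open>v\<^sub>i\<close>, which leads to the modified unknowns \<open>W\<close> with \<open>W\<^sub>i = 0\<close> and \<open>V\<close>.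
\<close>

lemma tangent_sum_extend:
  assumes "i \<le> m"
    and W: "\<And>l. W l = (if l = i then 0 else w (s + l) i)"
    and V: "\<And>j. V j = v (s + i) j + w (s + i) i / 2 * new_point m N i j"
  shows "tangent_sum (s + Suc m) (extend_a s a) (extend_b m N s b) w v i j k =
    tangent_sum s a (\<lambda>p j. if j < N then b p j else 0) w v i j k
    + (\<Sum>l\<le>m. W l * new_point m N l j * new_point m N l k)
    + new_point m N i j * V k + new_point m N i k * V j"
proof -
  let ?c = "new_point m N"
  have "(\<Sum>l<Suc m. w (s + l) i * extend_b m N s b (s + l) j * extend_b m N s b (s + l) k
      + extend_a s a (s + l) i * (extend_b m N s b (s + l) j * v (s + l) k + extend_b m N s b (s + l) k * v (s + l) j))
    = (\<Sum>l\<le>m. W l * ?c l j * ?c l k + (if l = i then w (s + i) i * ?c i j * ?c i k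
          + ?c i j * v (s + i) k + ?c i k * v (s + i) j else 0))"
    by (intro sum.cong) (auto simp: extend_a_def extend_b_def W)
  also have "\<dots> = (\<Sum>l\<le>m. W l * ?c l j * ?c l k) + (w (s + i) i * ?c i j * ?c i k
          + ?c i j * v (s + i) k + ?c i k * v (s + i) j)"
    using assms(1) by (simp add: sum.distrib)
  also have "w (s + i) i * ?c i j * ?c i k + ?c i j * v (s + i) k + ?c i k * v (s + i) j =
      ?c i j * V k + ?c i k * V j"
    by (simp add: V algebra_simps)
  finally show ?thesis
    unfolding tangent_sum_def sum_lessThan_add_nat
    by (simp add: extend_a_def extend_b_def add.assoc cong: sum.cong_simp)
qed

text \<open>
  The tangent spaces at the new points are independent modulo \<open>W \<otimes> S\<^sup>2 V'\<close>.  For a fixed index \<open>i\<close> of \<open>W\<close>, the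
  hypotheses are the equations in the blocks \<open>V' \<otimes> U\<close> and \<open>S\<^sup>2 U\<close>.
\<close>

lemma new_tangents_vanish:
  assumes m: "1 \<le> m" "m \<le> Suc N" and i: "i \<le> m"
    and W: "W i = 0"
    and mixed0: "\<And>j. j < N \<Longrightarrow> (\<Sum>l\<le>m. W l * new_point m N l j * slope0 m l)
        + new_point m N i j * V N + slope0 m i * V j = 0"
    and mixed1: "\<And>j. j < N \<Longrightarrow> (\<Sum>l\<le>m. W l * new_point m N l j * slope1 m l)
        + new_point m N i j * V (Suc N) + slope1 m i * V j = 0"
    and top00: "(\<Sum>l\<le>m. W l * slope0 m l * slope0 m l) + 2 * slope0 m i * V N = 0"
    and top01: "(\<Sum>l\<le>m. W l * slope0 m l * slope1 m l) + slope0 m i * V (Suc N) + slope1 m i * V N = 0"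
    and top11: "(\<Sum>l\<le>m. W l * slope1 m l * slope1 m l) + 2 * slope1 m i * V (Suc N) = 0"
  shows "(\<forall>l\<le>m. W l = 0) \<and> (\<forall>j<N + 2. V j = 0)"
proof -
  let ?X = "slope0 m i" and ?Y = "slope1 m i"
  have sum_np: "(\<Sum>l\<le>m. W l * new_point m N l j * f l) = W j * f j"
    if "Suc j < m" for j and f :: "nat \<Rightarrow> complex"
  proof -
    have "(\<Sum>l\<le>m. W l * new_point m N l j * f l) = (\<Sum>l\<le>m. if l = j then W l * f l else 0)"
      using that m by (intro sum.cong) (auto simp: new_point_def)
    then show ?thesis using that by simp
  qed
  \<comment> \<open>pairing with \<open>u\<^sub>i\<close> under the area form eliminates the unknown \<open>V j\<close>\<close>
  have comb: "W j * (?X * slope1 m j - ?Y * slope0 m j) + new_point m N i j * (?X * V (Suc N) - ?Y * V N) = 0"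
    if "Suc j < m" for j
  proof -
    have "j < N" using that m by simp
    then have "?X * (W j * slope1 m j + new_point m N i j * V (Suc N) + slope1 m i * V j) -
        ?Y * (W j * slope0 m j + new_point m N i j * V N + slope0 m i * V j) = 0"
      using mixed0[of j] mixed1[of j] sum_np[OF that] by simp
    then show ?thesis by (simp add: algebra_simps)
  qed
  have Wlow: "W j = 0" if "Suc j < m" for j
  proof (cases "j = i")
    case False
    then have "new_point m N i j = 0" using that m by (auto simp: new_point_def)
    then show ?thesis using comb[OF that] slopes_nonparallel[of i j m] False by auto
  qed (simp add: W)
  have top: "(\<Sum>l\<le>m. W l * f l) = W (m - 1) * f (m - 1) + W m * f m" for f
  proof -
    have "(\<Sum>l\<le>m. W l * f l) = (\<Sum>l\<in>{m - 1, m}. W l * f l)"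
    proof (rule sum.mono_neutral_right)
      show "\<forall>l\<in>{..m} - {m - 1, m}. W l * f l = 0"
        using Wlow by (auto intro!: Wlow)
    qed auto
    then show ?thesis using m by simp
  qed
  have sl: "slope0 m (m - 1) = 1" "slope1 m (m - 1) = 0" "slope0 m m = 0" "slope1 m m = 1"
    using m by (auto simp: slope0_def slope1_def)
  have e0: "W (m - 1) + 2 * ?X * V N = 0"
    using top00 top[of "\<lambda>l. slope0 m l * slope0 m l"] sl by (simp add: mult.assoc)
  have e1: "?X * V (Suc N) + ?Y * V N = 0"
    using top01 top[of "\<lambda>l. slope0 m l * slope1 m l"] sl by (simp add: mult.assoc)
  have e2: "W m + 2 * ?Y * V (Suc N) = 0"
    using top11 top[of "\<lambda>l. slope1 m l * slope1 m l"] sl by (simp add: mult.assoc)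
  have "W (m - 1) = 0 \<and> W m = 0 \<and> V N = 0 \<and> V (Suc N) = 0"
  proof -
    consider "i = m" | "i = m - 1" "i \<noteq> m" | "Suc i < m" using i m by linarith
    then show ?thesis
    proof cases
      case 1
      then show ?thesis using W sl e0 e1 e2 by auto
    next
      case 2
      then show ?thesis using W sl e0 e1 e2 by auto
    next
      case 3
      then have "new_point m N i i = 1" using m by (auto simp: new_point_def)
      then have "?X * V (Suc N) - ?Y * V N = 0" using comb[OF 3] W by simp
      moreover have "?X = 1" "?Y \<noteq> 0" using 3
        by (auto simp: slope0_def slope1_def simp del: of_nat_Suc)
      ultimately show ?thesis using e0 e1 e2 by auto
    qed
  qed
  note VN = this
  have W0: "W l = 0" if "l \<le> m" for l
  proof -
    consider "l = m" | "l = m - 1" | "Suc l < m" using \<open>l \<le> m\<close> by linarith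
    then show ?thesis using VN Wlow by cases auto
  qed
  have "V j = 0" if "j < N + 2" for j
  proof (cases "j < N")
    case True
    have "?X * V j = 0" "?Y * V j = 0"
      using mixed0[OF True] mixed1[OF True] VN W0 by auto
    moreover have "?X \<noteq> 0 \<or> ?Y \<noteq> 0" by (simp add: slope0_def slope1_def)
    ultimately show ?thesis by auto
  next
    case False
    then have "j = N \<or> j = Suc N" using that by auto
    then show ?thesis using VN by auto
  qed
  then show ?thesis using W0 by blast
qed

lemma independent_tangents_extend:
  assumes m: "1 \<le> m" "m \<le> Suc N"
    and ind: "independent_tangents m N s a b" and ext: "extension_condition m N s a b"
  shows "independent_tangents m (N + 2) (s + Suc m) (extend_a s a) (extend_b m N s b)"
  unfolding independent_tangents_def
proof (rule conjI)
  show "\<forall>p<s + Suc m. (\<exists>i\<le>m. extend_a s a p i \<noteq> 0) \<and> (\<exists>j<N + 2. extend_b m N s b p j \<noteq> 0)"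
  proof (intro allI impI)
    fix p assume p: "p < s + Suc m"
    show "(\<exists>i\<le>m. extend_a s a p i \<noteq> 0) \<and> (\<exists>j<N + 2. extend_b m N s b p j \<noteq> 0)"
    proof (cases "p < s")
      case True
      then obtain i j where "i \<le> m" "a p i \<noteq> 0" "j < N" "b p j \<noteq> 0"
        using ind unfolding independent_tangents_def by blast
      then have "extend_a s a p i \<noteq> 0" "extend_b m N s b p j \<noteq> 0" "j < N + 2"
        using True by (auto simp: extend_a_def extend_b_def)
      then show ?thesis using \<open>i \<le> m\<close> by blast
    next
      case False
      have "extend_b m N s b p N \<noteq> 0 \<or> extend_b m N s b p (Suc N) \<noteq> 0"
        using False by (auto simp: extend_b_def new_point_def slope0_def slope1_def)
      moreover have "N < N + 2" "Suc N < N + 2" by auto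
      ultimately have "\<exists>j<N + 2. extend_b m N s b p j \<noteq> 0" by blast
      moreover have "extend_a s a p (p - s) \<noteq> 0" "p - s \<le> m"
        using False p by (auto simp: extend_a_def)
      ultimately show ?thesis by blast
    qed
  qed
  show "\<forall>w v. (\<forall>i\<le>m. \<forall>j<N + 2. \<forall>k<N + 2.
       tangent_sum (s + Suc m) (extend_a s a) (extend_b m N s b) w v i j k = 0) \<longrightarrow>
     (\<forall>p<s + Suc m. \<exists>l. (\<forall>i\<le>m. w p i = - 2 * l * extend_a s a p i) \<and>
        (\<forall>j<N + 2. v p j = l * extend_b m N s b p j))"
  proof (intro allI impI)
    fix w v p
    assume wv: "\<forall>i\<le>m. \<forall>j<N + 2. \<forall>k<N + 2.
      tangent_sum (s + Suc m) (extend_a s a) (extend_b m N s b) w v i j k = 0"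
      and p: "p < s + Suc m"
    define W where "W i l = (if l = i then 0 else w (s + l) i)" for i l
    define V where "V i j = v (s + i) j + w (s + i) i / 2 * new_point m N i j" for i j
    let ?b = "\<lambda>p j. if j < N then b p j else 0"
    have eq: "tangent_sum s a ?b w v i j k
        + (\<Sum>l\<le>m. W i l * new_point m N l j * new_point m N l k)
        + new_point m N i j * V i k + new_point m N i k * V i j = 0"
      if "i \<le> m" "j < N + 2" "k < N + 2" for i j k
    proof -
      have "tangent_sum (s + Suc m) (extend_a s a) (extend_b m N s b) w v i j k =
          tangent_sum s a ?b w v i j k
          + (\<Sum>l\<le>m. W i l * new_point m N l j * new_point m N l k)
          + new_point m N i j * V i k + new_point m N i k * V i j"
        by (rule tangent_sum_extend[where W = "W i" and V = "V i", OF that(1)]) (simp_all only: W_def V_def)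
      moreover have "tangent_sum (s + Suc m) (extend_a s a) (extend_b m N s b) w v i j k = 0"
        using wv that by blast
      ultimately show ?thesis by metis
    qed
    have np [simp]: "new_point m N l N = slope0 m l" "new_point m N l (Suc N) = slope1 m l" for l
      by (auto simp: new_point_def)
    have old_mixed: "tangent_sum s a ?b w v i j k = (\<Sum>p<s. a p i * b p j * v p k)"
      if "j < N" "\<not> k < N" for i j k
      unfolding tangent_sum_def using that by (intro sum.cong) auto
    have old_top: "tangent_sum s a ?b w v i j k = 0" if "\<not> j < N" "\<not> k < N" for i j k
      unfolding tangent_sum_def using that by (intro sum.neutral) auto
    have mixed0: "(\<Sum>p<s. a p i * b p j * v p N) + (\<Sum>l\<le>m. W i l * new_point m N l j * slope0 m l)
        + new_point m N i j * V i N + slope0 m i * V i j = 0" if "i \<le> m" "j < N" for i j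
      using eq[of i j N] that by (simp add: old_mixed)
    have mixed1: "(\<Sum>p<s. a p i * b p j * v p (Suc N)) + (\<Sum>l\<le>m. W i l * new_point m N l j * slope1 m l)
        + new_point m N i j * V i (Suc N) + slope1 m i * V i j = 0" if "i \<le> m" "j < N" for i j
      using eq[of i j "Suc N"] that by (simp add: old_mixed)
    \<comment> \<open>pairing the mixed equations with \<open>u\<^sub>i\<close> eliminates the new unknowns and leaves the extension condition\<close>
    have vU: "v q N = 0 \<and> v q (Suc N) = 0" if "q < s" for q
    proof -
      have "(\<Sum>p<s. a p i * b p j * (slope0 m i * v p (Suc N) - slope1 m i * v p N)) = 0"
        if ij: "i \<le> m" "j < N" "m \<le> Suc j" for i j
      proof -
        have z: "new_point m N l j = 0" for l using ij by (auto simp: new_point_def)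
        have "(\<Sum>p<s. a p i * b p j * (slope0 m i * v p (Suc N) - slope1 m i * v p N)) =
          slope0 m i * (\<Sum>p<s. a p i * b p j * v p (Suc N)) - slope1 m i * (\<Sum>p<s. a p i * b p j * v p N)"
          by (simp add: algebra_simps sum_subtractf sum_distrib_left)
        also have "(\<Sum>p<s. a p i * b p j * v p (Suc N)) = - slope1 m i * V i j"
          using mixed1[OF ij(1,2)] by (simp add: z eq_neg_iff_add_eq_0)
        also have "(\<Sum>p<s. a p i * b p j * v p N) = - slope0 m i * V i j"
          using mixed0[OF ij(1,2)] by (simp add: z eq_neg_iff_add_eq_0)
        finally show ?thesis by simp
      qed
      then have "\<forall>p<s. v p N = 0 \<and> v p (Suc N) = 0"
        by (intro mp[OF spec[OF spec[OF ext[unfolded extension_condition_def]]]]) auto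
      then show ?thesis using that by blast
    qed
    have new: "(\<forall>l\<le>m. W i l = 0) \<and> (\<forall>j<N + 2. V i j = 0)" if i: "i \<le> m" for i
    proof (rule new_tangents_vanish[OF m i])
      show "W i i = 0" by (simp add: W_def)
      show "(\<Sum>l\<le>m. W i l * new_point m N l j * slope0 m l)
        + new_point m N i j * V i N + slope0 m i * V i j = 0" if "j < N" for j
        using mixed0[OF i that] vU by simp
      show "(\<Sum>l\<le>m. W i l * new_point m N l j * slope1 m l)
        + new_point m N i j * V i (Suc N) + slope1 m i * V i j = 0" if "j < N" for j
        using mixed1[OF i that] vU by simp
      show "(\<Sum>l\<le>m. W i l * slope0 m l * slope0 m l) + 2 * slope0 m i * V i N = 0"
        using eq[OF i, of N N] by (simp add: old_top algebra_simps)
      show "(\<Sum>l\<le>m. W i l * slope0 m l * slope1 m l) + slope0 m i * V i (Suc N) + slope1 m i * V i N = 0"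
        using eq[OF i, of N "Suc N"] by (simp add: old_top)
      show "(\<Sum>l\<le>m. W i l * slope1 m l * slope1 m l) + 2 * slope1 m i * V i (Suc N) = 0"
        using eq[OF i, of "Suc N" "Suc N"] by (simp add: old_top algebra_simps)
    qed
    show "\<exists>l. (\<forall>i\<le>m. w p i = - 2 * l * extend_a s a p i) \<and>
        (\<forall>j<N + 2. v p j = l * extend_b m N s b p j)"
    proof (cases "p < s")
      case True
      have "tangent_sum s a b w v i j k = 0" if "i \<le> m" "j < N" "k < N" for i j k
      proof -
        have "tangent_sum s a b w v i j k = tangent_sum s a ?b w v i j k"
          using that by (simp add: tangent_sum_def)
        then show ?thesis using eq[of i j k] new[OF that(1)] that by simp
      qed
      then obtain l where "\<forall>i\<le>m. w p i = - 2 * l * a p i" "\<forall>j<N. v p j = l * b p j"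
        using ind True unfolding independent_tangents_def by blast
      moreover have "v p j = 0" if "\<not> j < N" "j < N + 2" for j
      proof -
        have "j = N \<or> j = Suc N" using that by auto
        then show ?thesis using vU[OF True] by auto
      qed
      ultimately show ?thesis
        using True by (intro exI[of _ l]) (auto simp: extend_a_def extend_b_def)
    next
      case False
      define i where "i = p - s"
      have p_eq: "p = s + i" and i: "i \<le> m" using False p by (auto simp: i_def)
      have "w p i' = 0" if "i' \<le> m" "i' \<noteq> i" for i'
        using new[OF that(1)] i that by (auto simp: W_def p_eq)
      moreover have "v p j = - (w p i / 2) * new_point m N i j" if "j < N + 2" for j
        using new[OF i] that by (auto simp: V_def p_eq eq_neg_iff_add_eq_0)
      ultimately show ?thesis
        using False
        by (intro exI[of _ "- (w p i / 2)"]) (auto simp: extend_a_def extend_b_def simp flip: i_def)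
    qed
  qed
qed

section \<open>Existence of points with independent tangent spaces\<close>

text \<open>
  A configuration satisfying the extension condition.  The pairs (index of \<open>W\<close>, coordinate of the quotient
  of \<open>V\<close>) are regarded as cells, enumerated column by column: the cell \<open>c\<close> lies in row \<open>c mod (m + 1)\<close> and in
  column \<open>c div (m + 1)\<close>, and column \<open>k\<close> belongs to the index \<open>m - 1 + k\<close> of \<open>V\<close>.  The point \<open>p\<close> is
  responsible for the cells \<open>2 p\<close> and \<open>2 p + 1\<close>: \<open>a\<^sub>p\<close> and \<open>b\<^sub>p\<close> are the indicators of the rows and of the
  columns of these two cells.
\<close>

definition cell_a :: "nat \<Rightarrow> nat \<Rightarrow> nat \<Rightarrow> complex" where
  "cell_a m p i = (if i = (2 * p) mod Suc m \<or> i = Suc (2 * p) mod Suc m then 1 else 0)"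

definition cell_b :: "nat \<Rightarrow> nat \<Rightarrow> nat \<Rightarrow> complex" where
  "cell_b m p j =
     (if Suc j = m + (2 * p) div Suc m \<or> Suc j = m + Suc (2 * p) div Suc m then 1 else 0)"

text \<open>
  Usually the two cells of a point lie in one column, and then \<open>a\<^sub>p \<otimes> b\<^sub>p\<close> is supported on exactly these
  cells.  Otherwise they are the bottom of one column and the top of the next, and the support of
  \<open>a\<^sub>p \<otimes> b\<^sub>p\<close> has four cells.
\<close>

lemma cell_crossing:
  assumes "(2 * p) div Suc m \<noteq> Suc (2 * p) div Suc m"
  shows "(2 * p) mod Suc m = m" "Suc (2 * p) mod Suc m = 0"
    "Suc (2 * p) div Suc m = Suc ((2 * p) div Suc m)"
  using assms div_Suc[of "2 * p" "Suc m"] mod_Suc[of "2 * p" "Suc m"] 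
  by (auto split: if_splits)

lemma cell_noncrossing:
  assumes "(2 * q) div Suc m = Suc (2 * q) div Suc m"
    and "cell_a m q (c mod Suc m) * cell_b m q (m - 1 + c div Suc m) \<noteq> 0" "1 \<le> m"
  shows "c = 2 * q \<or> c = Suc (2 * q)"
proof -
  have "c div Suc m = (2 * q) div Suc m"
    using assms by (auto simp: cell_b_def split: if_splits)
  moreover have "c mod Suc m = (2 * q) mod Suc m \<or> c mod Suc m = Suc (2 * q) mod Suc m"
    using assms(2) by (auto simp: cell_a_def split: if_splits)
  ultimately show ?thesis
    using assms(1) by (metis div_mod_decomp)
qed

text \<open>
  Two different crossing points do not interfere.  Crossings only exist for even \<open>m\<close>, and then the column
  where a crossing begins has even index, so that different crossings use disjoint pairs of columns.
\<close>

lemma cell_crossing_disjoint: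
  assumes p: "(2 * p) div Suc m \<noteq> Suc (2 * p) div Suc m"
    and q: "(2 * q) div Suc m \<noteq> Suc (2 * q) div Suc m"
    and c: "c = 2 * p \<or> c = Suc (2 * p)" and "1 \<le> m"
    and nz: "cell_a m q (c mod Suc m) * cell_b m q (m - 1 + c div Suc m) \<noteq> 0"
  shows "q = p"
proof -
  define u where "u = (2 * p) div Suc m"
  define v where "v = (2 * q) div Suc m"
  have P: "2 * p = u * Suc m + m" and Q: "2 * q = v * Suc m + m"
    using cell_crossing(1)[OF p] cell_crossing(1)[OF q] div_mod_decomp[of "2 * p" "Suc m"]
      div_mod_decomp[of "2 * q" "Suc m"] by (auto simp: u_def v_def)
  have "c div Suc m = u \<or> c div Suc m = Suc u"
    using c cell_crossing(3)[OF p] by (auto simp: u_def)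
  moreover have "c div Suc m = v \<or> c div Suc m = Suc v"
    using nz \<open>1 \<le> m\<close> cell_crossing(3)[OF q] by (auto simp: cell_b_def v_def split: if_splits)
  ultimately consider "u = v" | "u = Suc v" | "v = Suc u" by linarith
  then show ?thesis
  proof cases
    case 1
    then show ?thesis using P Q by simp
  next
    case 2
    then have "2 * p = 2 * q + Suc m" using P Q by simp
    then have "odd m" by presburger
    then have "odd (v * Suc m + m)" by simp
    then show ?thesis using Q by (metis even_mult_iff even_numeral)
  next
    case 3
    then have "2 * q = 2 * p + Suc m" using P Q by simp
    then have "odd m" by presburger
    then have "odd (v * Suc m + m)" by simp
    then show ?thesis using Q by (metis even_mult_iff even_numeral)
  qed
qed

text \<open>
  At the two cells of a crossing point no other point contributes, so its unknowns vanish; after that the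
  two equations of every other point involve that point alone.
\<close>

lemma extension_condition_cells:
  assumes m: "1 \<le> m"
  shows "extension_condition m (m - 1 + K) ((m + 1) * K div 2) (cell_a m) (cell_b m)"
  unfolding extension_condition_def
proof (rule allI, rule allI, rule impI)
  fix x y
  let ?s = "(m + 1) * K div 2"
  let ?coef = "\<lambda>q c. cell_a m q (c mod Suc m) * cell_b m q (m - 1 + c div Suc m)"
  assume hyp: "\<forall>i\<le>m. \<forall>j<m - 1 + K. m \<le> Suc j \<longrightarrow>
    (\<Sum>p<?s. cell_a m p i * cell_b m p j * (slope0 m i * y p - slope1 m i * x p)) = 0"
  have step: "x p = 0 \<and> y p = 0" if p: "p < ?s" and
    others: "\<And>q c. q < ?s \<Longrightarrow> q \<noteq> p \<Longrightarrow> c = 2 * p \<or> c = Suc (2 * p) \<Longrightarrow> ?coef q c \<noteq> 0 \<Longrightarrow> x q = 0 \<and> y q = 0"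
    for p
  proof -
    have eq: "slope0 m (c mod Suc m) * y p - slope1 m (c mod Suc m) * x p = 0"
      if c: "c = 2 * p \<or> c = Suc (2 * p)" for c
    proof -
      have "c < K * Suc m" using c p by (auto simp: mult.commute)
      then have cK: "c div Suc m < K" by (rule less_mult_imp_div_less)
      have "0 = (\<Sum>q<?s. ?coef q c * (slope0 m (c mod Suc m) * y q - slope1 m (c mod Suc m) * x q))"
      proof (rule hyp[rule_format, symmetric])
        show "c mod Suc m \<le> m" using mod_less_divisor[of "Suc m" c] by simp
      qed (use cK m in auto)
      also have "\<dots> = (\<Sum>q\<in>{p}. ?coef q c * (slope0 m (c mod Suc m) * y q - slope1 m (c mod Suc m) * x q))"
      proof (rule sum.mono_neutral_right)
        show "\<forall>q\<in>{..<?s} - {p}. ?coef q c * (slope0 m (c mod Suc m) * y q - slope1 m (c mod Suc m) * x q) = 0"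
        proof
          fix q assume "q \<in> {..<?s} - {p}"
          then show "?coef q c * (slope0 m (c mod Suc m) * y q - slope1 m (c mod Suc m) * x q) = 0"
            using others[of q c] c by (cases "?coef q c = 0") auto
        qed
      qed (use p in auto)
      also have "\<dots> = slope0 m (c mod Suc m) * y p - slope1 m (c mod Suc m) * x p"
        using c m by (auto simp: cell_a_def cell_b_def)
      finally show ?thesis by simp
    qed
    have "(2 * p) mod Suc m \<noteq> Suc (2 * p) mod Suc m"
      using m mod_Suc[of "2 * p" "Suc m"] by (auto split: if_splits)
    then show ?thesis
      using slopes_independent[OF _ eq[of "2 * p"] eq[of "Suc (2 * p)"]] by simp
  qed
  have crossing: "x p = 0 \<and> y p = 0"
    if p: "p < ?s" "(2 * p) div Suc m \<noteq> Suc (2 * p) div Suc m" for p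
  proof (rule step[OF p(1)])
    fix q c assume *: "q \<noteq> p" "c = 2 * p \<or> c = Suc (2 * p)" "?coef q c \<noteq> 0"
    have "q = p"
    proof (cases "(2 * q) div Suc m = Suc (2 * q) div Suc m")
      case True
      then have "c = 2 * q \<or> c = Suc (2 * q)" using cell_noncrossing *(3) m by blast
      with *(2) show ?thesis by presburger
    qed (use cell_crossing_disjoint[OF p(2) _ *(2) m *(3)] in blast)
    then show "x q = 0 \<and> y q = 0" using * by simp
  qed
  have "x p = 0 \<and> y p = 0" if p: "p < ?s" for p
  proof (rule step[OF p])
    fix q c assume *: "q < ?s" "q \<noteq> p" "c = 2 * p \<or> c = Suc (2 * p)" "?coef q c \<noteq> 0"
    have "(2 * q) div Suc m \<noteq> Suc (2 * q) div Suc m"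
    proof
      assume "(2 * q) div Suc m = Suc (2 * q) div Suc m"
      then have "c = 2 * q \<or> c = Suc (2 * q)" using cell_noncrossing *(4) m by blast
      with *(2,3) show False by presburger
    qed
    then show "x q = 0 \<and> y q = 0" using crossing * by blast
  qed
  then show "\<forall>p<?s. x p = 0 \<and> y p = 0" by blast
qed

lemma extension_condition_generic:
  assumes ext: "extension_condition m N s a b"
  shows "finite {t. \<not> extension_condition m N s (segment_point a a' t) (segment_point b b' t)}"
proof -
  define R where "R = {(i, j). i \<le> m \<and> j < N \<and> m \<le> Suc j}"
  define C where "C = {..<s} \<times> (UNIV :: bool set)"
  define f where "f a b r c = (case r of (i, j) \<Rightarrow> case c of (p, e) \<Rightarrow>
     a p i * b p j * (if e then slope0 m i else - slope1 m i))"
    for a b :: "nat \<Rightarrow> nat \<Rightarrow> complex" and r c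
  define F where "F r c = (case r of (i, j) \<Rightarrow> case c of (p, e) \<Rightarrow>
     segment_poly a a' p i * segment_poly b b' p j * [:if e then slope0 m i else - slope1 m i:])"
    for r c
  have sumC: "(\<Sum>c\<in>C. f a b (i, j) c * z c) =
      (\<Sum>p<s. a p i * b p j * (slope0 m i * z (p, True) - slope1 m i * z (p, False)))"
    for a b i j and z :: "nat \<times> bool \<Rightarrow> complex"
  proof -
    have "(\<Sum>c\<in>C. f a b (i, j) c * z c) = (\<Sum>p<s. \<Sum>e\<in>UNIV. f a b (i, j) (p, e) * z (p, e))"
      unfolding C_def by (simp add: sum.cartesian_product)
    then show ?thesis by (simp add: UNIV_bool f_def algebra_simps)
  qed
  have iff: "extension_condition m N s a b \<longleftrightarrow> trivial_kernel R C (f a b)" for a b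
  proof
    assume L: "extension_condition m N s a b"
    show "trivial_kernel R C (f a b)"
      unfolding trivial_kernel_def
    proof (intro allI impI ballI)
      fix z c assume z: "\<forall>r\<in>R. (\<Sum>c\<in>C. f a b r c * z c) = 0" and "c \<in> C"
      then obtain p e where c: "c = (p, e)" "p < s" by (auto simp: C_def)
      have "\<forall>i\<le>m. \<forall>j<N. m \<le> Suc j \<longrightarrow>
         (\<Sum>p<s. a p i * b p j * (slope0 m i * z (p, True) - slope1 m i * z (p, False))) = 0"
        using z unfolding R_def by (auto simp: sumC)
      then have "z (p, False) = 0 \<and> z (p, True) = 0"
        using L[unfolded extension_condition_def, rule_format, of "\<lambda>p. z (p, True)" "\<lambda>p. z (p, False)" p] c
        by blast
      then show "z c = 0" using c by (cases e) auto
    qed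
  next
    assume Rk: "trivial_kernel R C (f a b)"
    show "extension_condition m N s a b"
      unfolding extension_condition_def
    proof (intro allI impI)
      fix x y p
      assume xy: "\<forall>i\<le>m. \<forall>j<N. m \<le> Suc j \<longrightarrow>
         (\<Sum>p<s. a p i * b p j * (slope0 m i * y p - slope1 m i * x p)) = 0" and p: "p < s"
      have "(\<Sum>c\<in>C. f a b r c * (case c of (p, e) \<Rightarrow> if e then y p else x p)) = 0" if "r \<in> R" for r
        using that xy by (auto simp: R_def sumC)
      from trivial_kernelD[OF Rk this, of "(p, True)"] trivial_kernelD[OF Rk this, of "(p, False)"]
      show "x p = 0 \<and> y p = 0" using p by (simp add: C_def)
    qed
  qed
  have F: "(\<lambda>r c. poly (F r c) t) = f (segment_point a a' t) (segment_point b b' t)" for t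
    by (auto simp: F_def f_def poly_segment_poly fun_eq_iff)
  have "finite C" by (simp add: C_def)
  moreover have "trivial_kernel R C (\<lambda>r c. poly (F r c) 0)"
    unfolding F using ext iff by simp
  ultimately have "finite {t. \<not> trivial_kernel R C (\<lambda>r c. poly (F r c) t)}"
    by (rule finite_nontrivial_kernel)
  then show ?thesis unfolding F iff .
qed

text \<open>The odd case of the induction starts with \<open>dim V = m\<close> and at most \<open>m\<close> points \<open>e\<^sub>p \<otimes> e\<^sub>p\<^sup>2\<close>.\<close>

lemma independent_tangents_base:
  assumes "1 \<le> m"
  shows "independent_tangents m m ((m + 1) div 2)
    (\<lambda>p i. if i = p then 1 else 0) (\<lambda>p i. if i = p then 1 else 0)"
  unfolding independent_tangents_def
proof (intro conjI allI impI)
  let ?e = "\<lambda>p i. if i = p then 1 else 0 :: complex"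
  let ?s = "(m + 1) div 2"
  have s: "p < m" if "p < ?s" for p using that assms by linarith
  fix p assume p: "p < ?s"
  show "\<exists>i\<le>m. ?e p i \<noteq> 0" using s[OF p] by (intro exI[of _ p]) auto
  show "\<exists>i<m. ?e p i \<noteq> 0" using s[OF p] by (intro exI[of _ p]) auto
  fix w v
  assume wv: "\<forall>i\<le>m. \<forall>j<m. \<forall>k<m. tangent_sum ?s ?e ?e w v i j k = 0"
  have T: "(if j = k then w j i else 0) + (if i = j then v i k else 0) + (if i = k then v i j else 0) = 0"
    if "i \<le> m" "j < ?s" "k < m" "i < ?s \<or> i \<noteq> k" for i j k
  proof -
    have "tangent_sum ?s ?e ?e w v i j k =
      (\<Sum>p<?s. (if p = j then (if j = k then w p i else 0) else 0) +
         ((if p = i then (if i = j then v p k else 0) else 0)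
         + (if p = i then (if i = k then v p j else 0) else 0)))"
      unfolding tangent_sum_def by (intro sum.cong) auto
    also have "\<dots> = (if j = k then w j i else 0) +
        (if i < ?s then (if i = j then v i k else 0) + (if i = k then v i j else 0) else 0)"
      using that(2) by (simp add: sum.distrib)
    finally have "\<dots> = 0" using wv that s[OF that(2)] by simp
    then show ?thesis using that(2,4) by (cases "i < ?s") (simp_all only: if_True if_False add.assoc, auto)
  qed
  show "\<exists>l. (\<forall>i\<le>m. w p i = - 2 * l * ?e p i) \<and> (\<forall>j<m. v p j = l * ?e p j)"
  proof (intro exI[of _ "v p p"] conjI allI impI)
    fix i assume "i \<le> m"
    then show "w p i = - 2 * v p p * ?e p i"
      using T[of i p p] p s[OF p] by (auto simp: eq_neg_iff_add_eq_0 ac_simps split: if_splits)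
  next
    fix j assume "j < m"
    then show "v p j = v p p * ?e p j"
      using T[of p p j] p s[OF p] by (auto split: if_splits)
  qed
qed

lemma exists_independent_tangents:
  assumes m: "1 \<le> m"
  shows "\<exists>a b. independent_tangents m (m - 1 + K) ((m + 1) * K div 2) a b"
proof (induction K rule: induct_nat_012)
  case 0
  show ?case by (simp add: independent_tangents_def)
next
  case 1
  then show ?case using independent_tangents_base[OF m] m by auto
next
  case (ge2 K)
  let ?N = "m - 1 + K" and ?s = "(m + 1) * K div 2"
  obtain a b where ab: "independent_tangents m ?N ?s a b" using ge2.IH(1) by blast
  let ?A = "segment_point (cell_a m) a" and ?B = "segment_point (cell_b m) b"
  have seg: "segment_point a (cell_a m) t = ?A (1 - t)" "segment_point b (cell_b m) t = ?B (1 - t)" for t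
    by (auto simp: segment_point_def fun_eq_iff algebra_simps)
  have "finite {t. \<not> extension_condition m ?N ?s (?A t) (?B t)}"
    by (rule extension_condition_generic[OF extension_condition_cells[OF m]])
  moreover have "finite {t. \<not> independent_tangents m ?N ?s (?A (1 - t)) (?B (1 - t))}"
    using independent_tangents_generic[OF ab, of "cell_a m" "cell_b m"] by (simp add: seg)
  then have "finite ((\<lambda>t. 1 - t) ` {t. \<not> independent_tangents m ?N ?s (?A (1 - t)) (?B (1 - t))})"
    by (rule finite_imageI)
  moreover have "(\<lambda>t. 1 - t) ` {t. \<not> independent_tangents m ?N ?s (?A (1 - t)) (?B (1 - t))} =
      {t. \<not> independent_tangents m ?N ?s (?A t) (?B t)}" (is "_ = ?R")
  proof
    show "?R \<subseteq> (\<lambda>t. 1 - t) ` {t. \<not> independent_tangents m ?N ?s (?A (1 - t)) (?B (1 - t))}"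
    proof
      fix t assume "t \<in> ?R"
      then show "t \<in> (\<lambda>t. 1 - t) ` {t. \<not> independent_tangents m ?N ?s (?A (1 - t)) (?B (1 - t))}"
        by (intro image_eqI[of _ _ "1 - t"]) auto
    qed
  qed auto
  ultimately have "finite ({t. \<not> extension_condition m ?N ?s (?A t) (?B t)} \<union>
      {t. \<not> independent_tangents m ?N ?s (?A t) (?B t)})" by simp
  then obtain t where "t \<notin> {t. \<not> extension_condition m ?N ?s (?A t) (?B t)} \<union>
      {t. \<not> independent_tangents m ?N ?s (?A t) (?B t)}"
    using ex_new_if_finite[OF infinite_UNIV_char_0] by blast
  then have "independent_tangents m (?N + 2) (?s + Suc m) (extend_a ?s (?A t)) (extend_b m ?N ?s (?B t))"
    using m by (intro independent_tangents_extend) auto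
  moreover have "?N + 2 = m - 1 + Suc (Suc K)" by simp
  moreover have "?s + Suc m = (m + 1) * Suc (Suc K) div 2"
    by (simp add: algebra_simps)
  ultimately show ?case by metis
qed

section \<open>Forms and polynomial functions\<close>

text \<open>
  Homogeneous polynomials of degree \<open>d\<close> in the coordinates \<open>I\<close>, considered as functions on vectors.
\<close>

definition form :: "'i set \<Rightarrow> nat \<Rightarrow> (('i \<Rightarrow> complex) \<Rightarrow> complex) \<Rightarrow> bool" where
  "form I d g \<longleftrightarrow> (\<exists>f. homogeneous I d f \<and> g = poly_eval f)"

lemma form_zero: "form I d (\<lambda>x. 0)"
  unfolding form_def by (rule exI[of _ 0]) (auto simp: homogeneous_def)

lemma form_const: "form I 0 (\<lambda>x. c)"
  unfolding form_def
  by (rule exI[of _ "Poly_Mapping.single 0 c"])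
    (auto simp: homogeneous_def monom_degree_def poly_eval_single monom_eval_def)

lemma form_coord: "i \<in> I \<Longrightarrow> form I 1 (\<lambda>x. x i)"
  unfolding form_def
  by (rule exI[of _ "Poly_Mapping.single (Poly_Mapping.single i 1) 1"])
    (auto simp: homogeneous_def monom_degree_def poly_eval_single monom_eval_def)

lemma form_add:
  assumes "form I d f" "form I d g"
  shows "form I d (\<lambda>x. f x + g x)"
proof -
  obtain p q where p: "homogeneous I d p" "f = poly_eval p" and q: "homogeneous I d q" "g = poly_eval q"
    using assms unfolding form_def by blast
  have "homogeneous I d (p + q)"
    using p(1) q(1) Poly_Mapping.keys_add[of p q] unfolding homogeneous_def by blast
  then show ?thesis
    unfolding form_def using p q by (intro exI[of _ "p + q"]) (auto simp: poly_eval_add)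
qed

lemma form_mult:
  assumes "form I d f" "form I e g"
  shows "form I (d + e) (\<lambda>x. f x * g x)"
proof -
  obtain p q where p: "homogeneous I d p" "f = poly_eval p" and q: "homogeneous I e q" "g = poly_eval q"
    using assms unfolding form_def by blast
  show ?thesis
    unfolding form_def using p q homogeneous_mult[OF p(1) q(1)]
    by (intro exI[of _ "p * q"]) (auto simp: poly_eval_mult)
qed

lemma form_scale: "form I d f \<Longrightarrow> form I d (\<lambda>x. c * f x)"
  using form_mult[OF form_const, of I d f c] by simp

lemma form_sum: "(\<And>i. i \<in> A \<Longrightarrow> form I d (f i)) \<Longrightarrow> form I d (\<lambda>x. \<Sum>i\<in>A. f i x)"
  by (induction A rule: infinite_finite_induct) (auto intro: form_zero form_add)

lemma form_power: "form I d f \<Longrightarrow> form I (k * d) (\<lambda>x. f x ^ k)"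
proof (induction k)
  case (Suc k)
  then show ?case using form_mult[of I d f "k * d" "\<lambda>x. f x ^ k"] by simp
qed (simp add: form_const)

lemma form_prod:
  "(\<And>i. i \<in> A \<Longrightarrow> form I (d i) (f i)) \<Longrightarrow> form I (\<Sum>i\<in>A. d i) (\<lambda>x. \<Prod>i\<in>A. f i x)"
  by (induction A rule: infinite_finite_induct) (auto intro: form_const form_mult)

lemma form_cscale: "form I d g \<Longrightarrow> g (cscale c x) = c ^ d * g x"
  unfolding form_def using poly_eval_cscale by blast

text \<open>
  Functions on a space of parameters that are polynomial of degree at most \<open>k\<close>; there may be infinitely many
  parameters, but each such function depends on finitely many.
\<close>

inductive polyfn :: "nat \<Rightarrow> (('v \<Rightarrow> complex) \<Rightarrow> complex) \<Rightarrow> bool" where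
  const: "polyfn k (\<lambda>x. c)"
| var: "polyfn (Suc k) (\<lambda>x. x v)"
| add: "polyfn k f \<Longrightarrow> polyfn k g \<Longrightarrow> polyfn k (\<lambda>x. f x + g x)"
| mult: "polyfn k f \<Longrightarrow> polyfn l g \<Longrightarrow> polyfn (k + l) (\<lambda>x. f x * g x)"

lemma polyfn_sum: "(\<And>i. i \<in> A \<Longrightarrow> polyfn k (f i)) \<Longrightarrow> polyfn k (\<lambda>x. \<Sum>i\<in>A. f i x)"
  by (induction A rule: infinite_finite_induct) (auto intro: polyfn.intros)

lemma polyfn_prod:
  "(\<And>i. i \<in> A \<Longrightarrow> polyfn (d i) (f i)) \<Longrightarrow> polyfn (\<Sum>i\<in>A. d i) (\<lambda>x. \<Prod>i\<in>A. f i x)"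
  by (induction A rule: infinite_finite_induct) (auto intro: polyfn.intros)

lemma polyfn_power: "polyfn k f \<Longrightarrow> polyfn (n * k) (\<lambda>x. f x ^ n)"
  using polyfn_prod[of "{..<n}" "\<lambda>_. k" "\<lambda>_. f"] by simp

lemma polyfn_form:
  assumes "form I d g" "\<And>i. i \<in> I \<Longrightarrow> polyfn e (\<lambda>x. \<Phi> x i)"
  shows "polyfn (d * e) (\<lambda>x. g (\<Phi> x))"
proof -
  obtain p where p: "homogeneous I d p" "g = poly_eval p"
    using assms(1) unfolding form_def by blast
  have "polyfn (0 + d * e) (\<lambda>x. Poly_Mapping.lookup p a * monom_eval a (\<Phi> x))"
    if a: "a \<in> Poly_Mapping.keys p" for a
  proof (rule polyfn.mult[OF polyfn.const])
    have "polyfn (\<Sum>i\<in>Poly_Mapping.keys a. Poly_Mapping.lookup a i * e)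
        (\<lambda>x. \<Prod>i\<in>Poly_Mapping.keys a. \<Phi> x i ^ Poly_Mapping.lookup a i)"
      using p(1) a assms(2) by (intro polyfn_prod polyfn_power) (auto simp: homogeneous_def)
    also have "(\<Sum>i\<in>Poly_Mapping.keys a. Poly_Mapping.lookup a i * e) = d * e"
      using p(1) a by (simp add: homogeneous_def monom_degree_def flip: sum_distrib_right)
    finally show "polyfn (d * e) (\<lambda>x. monom_eval a (\<Phi> x))"
      by (simp add: monom_eval_def)
  qed
  then show ?thesis
    unfolding p(2) poly_eval_def by (intro polyfn_sum) simp
qed

text \<open>
  The point with parameter \<open>t\<close> on the line through \<open>x\<close> and \<open>y\<close>.  Polynomial functions become univariate
  polynomials along such lines; therefore two polynomial functions that are nonzero somewhere have a common
  point, on a line, where both are nonzero.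
\<close>

definition segment :: "('v \<Rightarrow> complex) \<Rightarrow> ('v \<Rightarrow> complex) \<Rightarrow> complex \<Rightarrow> 'v \<Rightarrow> complex" where
  "segment x y t = (\<lambda>v. x v + t * (y v - x v))"

lemma segment_0 [simp]: "segment x y 0 = x" and segment_1 [simp]: "segment x y 1 = y"
  by (simp_all add: segment_def)

lemma polyfn_segment: "polyfn k f \<Longrightarrow> \<exists>p. \<forall>t. f (segment x y t) = poly p t"
proof (induction rule: polyfn.induct)
  case (const k c)
  then show ?case by (intro exI[of _ "[:c:]"]) simp
next
  case (var k v)
  then show ?case by (intro exI[of _ "[:x v, y v - x v:]"]) (simp add: segment_def)
next
  case (add k f g)
  then show ?case by (metis poly_add)
next
  case (mult k f l g)
  then show ?case by (metis poly_mult)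
qed

lemma finite_polyfn_segment_zeros:
  assumes "polyfn k f" "f (segment x y t0) \<noteq> 0"
  shows "finite {t. f (segment x y t) = 0}"
proof -
  obtain p where p: "\<And>t. f (segment x y t) = poly p t" using polyfn_segment[OF assms(1)] by blast
  then have "p \<noteq> 0" using assms(2) by auto
  then show ?thesis using poly_roots_finite p by simp
qed

lemma polyfn_common_nonzero:
  assumes "polyfn k f" "polyfn l g" "f x \<noteq> 0" "g y \<noteq> 0"
  obtains t where "f (segment x y t) \<noteq> 0" "g (segment x y t) \<noteq> 0"
proof -
  have "finite ({t. f (segment x y t) = 0} \<union> {t. g (segment x y t) = 0})"
    using finite_polyfn_segment_zeros[OF assms(1), of x y 0] finite_polyfn_segment_zeros[OF assms(2), of x y 1]
      assms(3,4) by simp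
  then obtain t where "t \<notin> {t. f (segment x y t) = 0} \<union> {t. g (segment x y t) = 0}"
    using ex_new_if_finite[OF infinite_UNIV_char_0] by blast
  then show ?thesis using that by blast
qed

text \<open>The affine subspace on which only the parameters in \<open>E\<close> are free and the others are as in \<open>x0\<close>.\<close>

definition slice :: "'v set \<Rightarrow> ('v \<Rightarrow> complex) \<Rightarrow> ('v \<Rightarrow> complex) set" where
  "slice E x0 = {x. \<forall>v. v \<notin> E \<longrightarrow> x v = x0 v}"

lemma segment_slice: "x \<in> slice E x0 \<Longrightarrow> y \<in> slice E x0 \<Longrightarrow> segment x y t \<in> slice E x0"
  by (auto simp: slice_def segment_def)

lemma base_in_slice [simp]: "x0 \<in> slice E x0"
  by (simp add: slice_def)

text \<open>The monomial in the variables \<open>E\<close> with exponents \<open>\<beta>\<close>, as a function.\<close>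

definition box_monomial :: "'v set \<Rightarrow> ('v \<Rightarrow> nat) \<Rightarrow> ('v \<Rightarrow> complex) \<Rightarrow> complex" where
  "box_monomial E \<beta> = (\<lambda>x. \<Prod>v\<in>E. x v ^ \<beta> v)"

text \<open>The monomials in the variables \<open>E\<close> with all exponents at most \<open>k\<close>.\<close>

definition box_monomials :: "'v set \<Rightarrow> nat \<Rightarrow> (('v \<Rightarrow> complex) \<Rightarrow> complex) set" where
  "box_monomials E k = box_monomial E ` (E \<rightarrow> {..k})"

lemma box_monomial_cong: "(\<And>v. v \<in> E \<Longrightarrow> \<beta> v = \<gamma> v) \<Longrightarrow> box_monomial E \<beta> = box_monomial E \<gamma>"
  by (auto simp: box_monomial_def fun_eq_iff intro!: prod.cong)

lemma box_monomials_PiE: "box_monomials E k = box_monomial E ` (E \<rightarrow>\<^sub>E {..k})"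
proof -
  have "box_monomial E \<beta> = box_monomial E (restrict \<beta> E)" for \<beta> :: "'a \<Rightarrow> nat"
    by (rule box_monomial_cong) simp
  then have "box_monomial E \<beta> \<in> box_monomial E ` (E \<rightarrow>\<^sub>E {..k})" if "\<beta> \<in> E \<rightarrow> {..k}" for \<beta>
    using that by (metis image_eqI restrict_PiE_iff Pi_iff)
  moreover have "E \<rightarrow>\<^sub>E {..k} \<subseteq> E \<rightarrow> {..k}" by (auto simp: PiE_iff)
  ultimately show ?thesis unfolding box_monomials_def by blast
qed

lemma
  assumes "finite E"
  shows finite_box_monomials: "finite (box_monomials E k)"
    and card_box_monomials: "card (box_monomials E k) \<le> (k + 1) ^ card E"
proof -
  have "finite (E \<rightarrow>\<^sub>E {..k})" using assms by (simp add: finite_PiE)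
  then show "finite (box_monomials E k)" unfolding box_monomials_PiE by (rule finite_imageI)
  have "card (box_monomials E k) \<le> card (E \<rightarrow>\<^sub>E {..k})"
    unfolding box_monomials_PiE by (rule card_image_le) fact
  also have "\<dots> = (k + 1) ^ card E" using assms by (simp add: card_PiE)
  finally show "card (box_monomials E k) \<le> (k + 1) ^ card E" .
qed

lemma span_box_monomials_mult:
  assumes f: "f \<in> cspan (box_monomials E k)" and g: "g \<in> cspan (box_monomials E l)"
  shows "(\<lambda>x. f x * g x) \<in> cspan (box_monomials E (k + l))"
  using f
proof (induction rule: cfun.span_induct_alt)
  case base
  have "(\<lambda>x. (0 :: ('a \<Rightarrow> complex) \<Rightarrow> complex) x * g x) = 0" by auto
  then show ?case by (metis cfun.span_zero)
next
  case (step c m f)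
  then obtain \<beta> where \<beta>: "\<beta> \<in> E \<rightarrow> {..k}" "m = box_monomial E \<beta>"
    by (auto simp: box_monomials_def)
  have "(\<lambda>x. m x * g x) \<in> cspan (box_monomials E (k + l))"
    using g
  proof (induction rule: cfun.span_induct_alt)
    case base
    have "(\<lambda>x. m x * (0 :: ('a \<Rightarrow> complex) \<Rightarrow> complex) x) = 0" by auto
    then show ?case by (metis cfun.span_zero)
  next
    case (step d m' g)
    then obtain \<gamma> where \<gamma>: "\<gamma> \<in> E \<rightarrow> {..l}" "m' = box_monomial E \<gamma>"
      by (auto simp: box_monomials_def)
    have "(\<lambda>x. m x * m' x) = box_monomial E (\<lambda>v. \<beta> v + \<gamma> v)"
      by (simp add: \<beta>(2) \<gamma>(2) box_monomial_def power_add prod.distrib)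
    moreover have "(\<lambda>v. \<beta> v + \<gamma> v) \<in> E \<rightarrow> {..k + l}"
      using \<beta>(1) \<gamma>(1) by (auto simp: Pi_iff intro: add_mono)
    ultimately have "(\<lambda>x. m x * m' x) \<in> box_monomials E (k + l)"
      unfolding box_monomials_def by blast
    then have "cscale d (\<lambda>x. m x * m' x) + (\<lambda>x. m x * g x) \<in> cspan (box_monomials E (k + l))"
      using step(2) by (intro cfun.span_add cfun.span_scale[OF cfun.span_base])
    moreover have "cscale d (\<lambda>x. m x * m' x) + (\<lambda>x. m x * g x) = (\<lambda>x. m x * (cscale d m' + g) x)"
      by (auto simp: cscale_def algebra_simps)
    ultimately show ?case by simp
  qed
  then have "cscale c (\<lambda>x. m x * g x) + (\<lambda>x. f x * g x) \<in> cspan (box_monomials E (k + l))"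
    using step(2) by (intro cfun.span_add cfun.span_scale)
  moreover have "cscale c (\<lambda>x. m x * g x) + (\<lambda>x. f x * g x) = (\<lambda>x. (cscale c m + f) x * g x)"
    by (auto simp: cscale_def algebra_simps)
  ultimately show ?case by simp
qed

lemma const_in_span_box_monomials:
  assumes "finite E"
  shows "(\<lambda>x. c) \<in> cspan (box_monomials E k)"
proof -
  have "cscale c (box_monomial E (\<lambda>v. 0)) \<in> cspan (box_monomials E k)"
    by (intro cfun.span_scale cfun.span_base) (auto simp: box_monomials_def)
  moreover have "cscale c (box_monomial E (\<lambda>v. 0)) = (\<lambda>x. c)"
    by (auto simp: cscale_def box_monomial_def)
  ultimately show ?thesis by simp
qed

text \<open>The projection of the parameter space onto \<open>slice E x0\<close>.\<close>

definition patch :: "'v set \<Rightarrow> ('v \<Rightarrow> complex) \<Rightarrow> ('v \<Rightarrow> complex) \<Rightarrow> 'v \<Rightarrow> complex" where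
  "patch E x0 x = (\<lambda>v. if v \<in> E then x v else x0 v)"

lemma patch_in_slice [simp]: "patch E x0 x \<in> slice E x0"
  by (simp add: patch_def slice_def)

lemma polyfn_span_box_monomials:
  assumes "polyfn k f" "finite E"
  shows "(\<lambda>x. f (patch E x0 x)) \<in> cspan (box_monomials E k)"
  using assms(1)
proof induction
  case (const k c)
  show ?case by (rule const_in_span_box_monomials) fact
next
  case (var k v)
  show ?case
  proof (cases "v \<in> E")
    case True
    have "(\<lambda>x. patch E x0 x v) = box_monomial E (\<lambda>u. if u = v then 1 else 0)"
      using True assms(2)
      by (auto simp: patch_def box_monomial_def fun_eq_iff if_distrib[of "\<lambda>n. _ ^ n"] prod.delta cong: if_cong)
    also have "\<dots> \<in> cspan (box_monomials E (Suc k))"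
      by (intro cfun.span_base) (auto simp: box_monomials_def)
    finally show ?thesis .
  qed (use assms(2) in \<open>simp add: patch_def const_in_span_box_monomials\<close>)
next
  case (add k f g)
  from cfun.span_add[OF add.IH] show ?case by (simp add: plus_fun_def)
next
  case (mult k f l g)
  from span_box_monomials_mult[OF mult.IH] show ?case .
qed

text \<open>
  There are \<open>n\<close> forms of degree \<open>d\<close> whose restrictions to \<open>S\<close> are linearly independent: if \<open>S\<close> is the cone
  over a projective variety, then its Hilbert function at \<open>d\<close> is at least \<open>n\<close>.
\<close>

definition independent_forms :: "'i set \<Rightarrow> nat \<Rightarrow> nat \<Rightarrow> ('i \<Rightarrow> complex) set \<Rightarrow> bool" where
  "independent_forms I d n S \<longleftrightarrow> (\<exists>g. (\<forall>l<n. form I d (g l)) \<and>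
     (\<forall>c. (\<forall>x\<in>S. (\<Sum>l<n. c l * g l x) = 0) \<longrightarrow> (\<forall>l<n. c l = 0)))"

lemma independent_formsI:
  fixes A :: "'a set"
  assumes "finite A" "\<And>a. a \<in> A \<Longrightarrow> form I d (g a)"
    and ind: "\<And>c a. (\<And>x. x \<in> S \<Longrightarrow> (\<Sum>a\<in>A. c a * g a x) = 0) \<Longrightarrow> a \<in> A \<Longrightarrow> c a = 0"
  shows "independent_forms I d (card A) S"
proof -
  obtain h where h: "bij_betw h {..<card A} A"
    using ex_bij_betw_nat_finite[OF assms(1)] by (auto simp: atLeast0LessThan)
  show ?thesis
    unfolding independent_forms_def
  proof (intro exI[of _ "\<lambda>l. g (h l)"] conjI allI impI)
    fix l assume "l < card A"
    then show "form I d (g (h l))" using h assms(2) by (auto simp: bij_betw_def)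
  next
    fix c l assume 0: "\<forall>x\<in>S. (\<Sum>l<card A. c l * g (h l) x) = 0" and l: "l < card A"
    let ?i = "inv_into {..<card A} h"
    have "(\<Sum>a\<in>A. c (?i a) * g a x) = (\<Sum>l<card A. c (?i (h l)) * g (h l) x)" for x
      using sum.reindex_bij_betw[OF h, of "\<lambda>a. c (?i a) * g a x"] by simp
    also have "\<dots> x = (\<Sum>l<card A. c l * g (h l) x)" for x
      using h by (intro sum.cong) (auto simp: bij_betw_def)
    finally have "c (?i (h l)) = 0"
      using 0 l h by (intro ind[of "\<lambda>a. c (?i a)" "h l"]) (auto simp: bij_betw_def)
    then show "c l = 0" using h l by (auto simp: bij_betw_def)
  qed
qed

text \<open>Independence only depends on which forms vanish on the set, so it passes to Zariski dense subsets.\<close>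

lemma independent_forms_mono:
  assumes "independent_forms I d n S"
    and "\<And>g. form I d g \<Longrightarrow> (\<forall>x\<in>S'. g x = 0) \<Longrightarrow> (\<forall>x\<in>S. g x = 0)"
  shows "independent_forms I d n S'"
proof -
  obtain g where g: "\<And>l. l < n \<Longrightarrow> form I d (g l)"
    "\<And>c. (\<forall>x\<in>S. (\<Sum>l<n. c l * g l x) = 0) \<Longrightarrow> (\<forall>l<n. c l = 0)"
    using assms(1) unfolding independent_forms_def by blast
  have "\<forall>l<n. c l = 0" if "\<forall>x\<in>S'. (\<Sum>l<n. c l * g l x) = 0" for c
    using that by (intro g(2) assms(2) form_sum form_scale g(1)) auto
  then show ?thesis unfolding independent_forms_def using g(1) by blast
qed

text \<open>
  Forms of degree \<open>d\<close> pull back to polynomials of degree at most \<open>d e\<close> in the variables \<open>E\<close>.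
\<close>

lemma independent_forms_slice_le:
  assumes "finite E" "\<And>i. i \<in> I \<Longrightarrow> polyfn e (\<lambda>x. \<Phi> x i)"
    and "independent_forms I d n (\<Phi> ` slice E x0)"
  shows "n \<le> (d * e + 1) ^ card E"
proof -
  obtain g where g: "\<And>l. l < n \<Longrightarrow> form I d (g l)"
    "\<And>c. (\<forall>x\<in>\<Phi> ` slice E x0. (\<Sum>l<n. c l * g l x) = 0) \<Longrightarrow> (\<forall>l<n. c l = 0)"
    using assms(3) unfolding independent_forms_def by blast
  have "card {..<n} \<le> card (box_monomials E (d * e))"
  proof (rule card_le_of_independent_family[where g = "\<lambda>l x. g l (\<Phi> (patch E x0 x))"])
    fix l assume "l \<in> {..<n}"
    then show "(\<lambda>x. g l (\<Phi> (patch E x0 x))) \<in> cspan (box_monomials E (d * e))"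
      using polyfn_span_box_monomials[OF polyfn_form[OF g(1) assms(2)] assms(1)] by simp
  next
    fix c l assume 0: "\<forall>x. (\<Sum>l<n. c l * g l (\<Phi> (patch E x0 x))) = 0" and l: "l \<in> {..<n}"
    have "(\<Sum>l<n. c l * g l (\<Phi> x)) = 0" if "x \<in> slice E x0" for x
    proof -
      have "patch E x0 x = x" using that by (auto simp: patch_def slice_def)
      then show ?thesis using 0 by metis
    qed
    then show "c l = 0" using g(2)[of c] l by blast
  qed (simp_all add: assms(1) finite_box_monomials)
  then show ?thesis using card_box_monomials[OF assms(1), of "d * e"] by simp
qed

lemma degree_le_of_growth:
  assumes "\<And>D::nat. (D + 1) ^ k \<le> (D * e + 1) ^ j"
  shows "k \<le> j"
proof (rule ccontr)
  assume "\<not> k \<le> j"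
  define D where "D = (e + 1) ^ j"
  have "(D + 1) ^ Suc j \<le> (D + 1) ^ k"
    using \<open>\<not> k \<le> j\<close> by (intro power_increasing) auto
  also have "\<dots> \<le> (D * e + 1) ^ j" by (rule assms)
  also have "\<dots> \<le> ((e + 1) * (D + 1)) ^ j" by (intro power_mono) auto
  also have "\<dots> = D * (D + 1) ^ j" by (simp only: D_def power_mult_distrib)
  finally have "(D + 1) * (D + 1) ^ j \<le> D * (D + 1) ^ j" by simp
  then show False by simp
qed

section \<open>Growth of the number of independent forms\<close>

text \<open>
  The homogeneous ideal of \<open>S\<close> satisfies the condition for prime ideals, tested on forms (the unit ideal is
  not excluded).
\<close>

definition prime_on :: "'i set \<Rightarrow> ('i \<Rightarrow> complex) set \<Rightarrow> bool" where
  "prime_on I S \<longleftrightarrow> (\<forall>d e g h. form I d g \<longrightarrow> form I e h \<longrightarrow> (\<forall>x\<in>S. g x * h x = 0) \<longrightarrow>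
     (\<forall>x\<in>S. g x = 0) \<or> (\<forall>x\<in>S. h x = 0))"

lemma prime_onD:
  assumes "prime_on I S" "form I d g" "form I e h" "\<And>x. x \<in> S \<Longrightarrow> g x * h x = 0"
    and "\<exists>x\<in>S. g x \<noteq> 0" "x \<in> S"
  shows "h x = 0"
  using assms unfolding prime_on_def by meson

text \<open>
  If \<open>f\<close> vanishes on \<open>S\<close> but not on \<open>S'\<close>, then independent forms on \<open>S\<close> multiplied by \<open>1, f, \<dots>, f\<^sup>D\<close> are
  independent on \<open>S'\<close>: restricting a relation to \<open>S\<close> kills the coefficients of \<open>f\<^sup>0\<close>, and the rest can be
  divided by \<open>f\<close>.  The powers of \<open>y\<close> make the degrees equal.
\<close>

lemma independent_forms_step:
  assumes S: "S \<subseteq> S'" "prime_on I S" "prime_on I S'"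
    and f: "form I e f" "\<And>x. x \<in> S \<Longrightarrow> f x = 0" "\<exists>x\<in>S'. f x \<noteq> 0"
    and y: "form I 1 y" "\<exists>x\<in>S. y x \<noteq> 0"
    and ind: "independent_forms I d n S"
  shows "independent_forms I (d + D * e) ((D + 1) * n) S'"
proof -
  obtain g where g: "\<And>l. l < n \<Longrightarrow> form I d (g l)"
    "\<And>c. (\<forall>x\<in>S. (\<Sum>l<n. c l * g l x) = 0) \<Longrightarrow> (\<forall>l<n. c l = 0)"
    using ind unfolding independent_forms_def by blast
  define G where "G D a l x = g l x * f x ^ a * y x ^ ((D - a) * e)" for D a l x
  have form_G: "form I (d + D * e) (G D a l)" if "a \<le> D" "l < n" for D a l
  proof -
    have "form I (d + a * e + (D - a) * e * 1) (G D a l)"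
      unfolding G_def by (intro form_mult form_power g(1) f(1) y(1) that)
    also have "d + a * e + (D - a) * e * 1 = d + D * e"
      using that(1) by (simp flip: distrib_right)
    finally show ?thesis .
  qed
  have main: "\<forall>a\<le>D. \<forall>l<n. c a l = 0"
    if "\<forall>x\<in>S'. (\<Sum>a\<le>D. \<Sum>l<n. c a l * G D a l x) = 0" for D c
    using that
  proof (induction D arbitrary: c)
    have first: "\<forall>l<n. c 0 l = 0"
      if 0: "\<forall>x\<in>S'. (\<Sum>a\<le>D. \<Sum>l<n. c a l * G D a l x) = 0" for D and c :: "nat \<Rightarrow> nat \<Rightarrow> complex"
    proof (rule g(2), rule ballI)
      fix x assume x: "x \<in> S"
      show "(\<Sum>l<n. c 0 l * g l x) = 0"
      proof (rule prime_onD[OF S(2) form_power[OF y(1), of "D * e"] form_sum[OF form_scale[OF g(1)]] _ _ x])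
        fix x assume x: "x \<in> S"
        have "0 = (\<Sum>a\<le>D. \<Sum>l<n. c a l * G D a l x)" using x 0 S(1) by auto
        also have "\<dots> = (\<Sum>a\<in>{0}. \<Sum>l<n. c a l * G D a l x)"
        proof (rule sum.mono_neutral_right)
          show "\<forall>a\<in>{..D} - {0}. (\<Sum>l<n. c a l * G D a l x) = 0"
          proof
            fix a assume "a \<in> {..D} - {0}"
            then have fa: "f x ^ a = 0" using f(2)[OF x] by simp
            show "(\<Sum>l<n. c a l * G D a l x) = 0" unfolding G_def fa by simp
          qed
        qed auto
        finally show "y x ^ (D * e) * (\<Sum>l<n. c 0 l * g l x) = 0"
          by (simp add: G_def sum_distrib_left mult_ac)
      qed (use y(2) in auto)
    qed
    {
      case 0
      then show ?case using first[where D = 0 and c = c] by simp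
    next
      case (Suc D)
      have c0: "\<forall>l<n. c 0 l = 0" using first[OF Suc.prems] .
      have "\<forall>x\<in>S'. (\<Sum>a\<le>D. \<Sum>l<n. c (Suc a) l * G D a l x) = 0"
      proof
        fix x assume x: "x \<in> S'"
        show "(\<Sum>a\<le>D. \<Sum>l<n. c (Suc a) l * G D a l x) = 0"
        proof (rule prime_onD[OF S(3) f(1) form_sum[OF form_sum[OF form_scale[OF form_G]]] _ f(3) x])
          fix x assume x: "x \<in> S'"
          have "0 = (\<Sum>a\<le>Suc D. \<Sum>l<n. c a l * G (Suc D) a l x)" using Suc.prems x by auto
          also have "\<dots> = (\<Sum>a\<le>D. \<Sum>l<n. c (Suc a) l * G (Suc D) (Suc a) l x)"
            unfolding sum.atMost_Suc_shift using c0 by simp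
          finally show "f x * (\<Sum>a\<le>D. \<Sum>l<n. c (Suc a) l * G D a l x) = 0"
            by (simp add: G_def sum_distrib_left mult_ac)
        qed auto
      qed
      from Suc.IH[OF this] c0 show ?case by (metis Suc_le_mono not0_implies_Suc)
    }
  qed
  have "independent_forms I (d + D * e) (card ({..D} \<times> {..<n})) S'"
  proof (rule independent_formsI[where g = "\<lambda>(a, l). G D a l"])
    fix p assume "p \<in> {..D} \<times> {..<n}"
    then show "form I (d + D * e) (case p of (a, l) \<Rightarrow> G D a l)" using form_G by auto
  next
    fix c p assume 0: "\<And>x. x \<in> S' \<Longrightarrow> (\<Sum>p\<in>{..D} \<times> {..<n}. c p * (case p of (a, l) \<Rightarrow> G D a l) x) = 0"
      and p: "p \<in> {..D} \<times> {..<n}"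
    have "\<forall>a\<le>D. \<forall>l<n. c (a, l) = 0"
    proof (rule main, rule ballI)
      fix x assume "x \<in> S'"
      from 0[OF this] show "(\<Sum>a\<le>D. \<Sum>l<n. c (a, l) * G D a l x) = 0"
        by (simp add: sum.cartesian_product split_def)
    qed
    then show "c p = 0" using p by auto
  qed simp
  then show ?thesis by simp
qed

lemma independent_forms_chain:
  assumes "\<And>i. i \<le> k \<Longrightarrow> prime_on I (S i)"
    and "\<And>i. i < k \<Longrightarrow> S i \<subseteq> S (Suc i)"
    and "\<And>i. i < k \<Longrightarrow> \<exists>e f. form I e f \<and> (\<forall>x\<in>S i. f x = 0) \<and> (\<exists>x\<in>S (Suc i). f x \<noteq> 0)"
    and y: "form I 1 y" "\<exists>x\<in>S 0. y x \<noteq> 0"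
  shows "\<exists>e. \<forall>D. independent_forms I (D * e) ((D + 1) ^ k) (S k)"
  using assms(1-3)
proof (induction k)
  case 0
  have "independent_forms I D (card {0::nat}) (S 0)" for D
  proof (rule independent_formsI[where g = "\<lambda>_ x. y x ^ D"])
    show "form I D (\<lambda>x. y x ^ D)" using form_power[OF y(1), of D] by simp
  next
    fix c and a :: nat
    assume 0: "\<And>x. x \<in> S 0 \<Longrightarrow> (\<Sum>a\<in>{0::nat}. c a * y x ^ D) = 0" and "a \<in> {0}"
    obtain x where "x \<in> S 0" "y x \<noteq> 0" using y(2) by blast
    with 0[of x] \<open>a \<in> {0}\<close> show "c a = 0" by simp
  qed simp
  then show ?case by (intro exI[of _ 1]) simp
next
  case (Suc k)
  have "\<exists>e. \<forall>D. independent_forms I (D * e) ((D + 1) ^ k) (S k)"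
    by (rule Suc.IH) (use Suc.prems in auto)
  then obtain e where e: "\<And>D. independent_forms I (D * e) ((D + 1) ^ k) (S k)" by blast
  obtain e' f where f: "form I e' f" "\<forall>x\<in>S k. f x = 0" "\<exists>x\<in>S (Suc k). f x \<noteq> 0"
    using Suc.prems(3)[of k] by auto
  have "S 0 \<subseteq> S i" if "i \<le> k" for i
    using that
  proof (induction i)
    case (Suc i)
    then show ?case using Suc.prems \<open>\<And>i. i < Suc k \<Longrightarrow> S i \<subseteq> S (Suc i)\<close>[of i] by simp
  qed simp
  then have "S 0 \<subseteq> S k" by simp
  then have "\<exists>x\<in>S k. y x \<noteq> 0" using y(2) by blast
  then have "independent_forms I (D * e + D * e') ((D + 1) * (D + 1) ^ k) (S (Suc k))" for D
    using Suc.prems f y(1) by (intro independent_forms_step[OF _ _ _ f(1) _ f(3) y(1) _ e]) auto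
  then show ?case by (intro exI[of _ "e + e'"]) (simp add: distrib_left)
qed

lemma vanishes_on_line:
  assumes "form I d g" "g x = 0" "y \<in> line x"
  shows "g y = 0"
  using assms(3) form_cscale[OF assms(1)] by (auto simp: line_eq assms(2))

lemma mem_line [simp]: "x \<in> line x"
  by (simp add: line_def cfun.span_base)

lemma form_poly_eval: "f \<in> homogeneous_polys I \<Longrightarrow> \<exists>d. form I d (poly_eval f)"
  unfolding homogeneous_polys_def form_def by blast

lemma prime_on_irreducible:
  assumes Z: "Z \<subseteq> proj_space I" and irr: "irreducible_space (subtopology (zariski I) Z)"
  shows "prime_on I (\<Union>Z)"
  unfolding prime_on_def
proof (intro allI impI)
  fix d e g h assume gh: "form I d g" "form I e h" and 0: "\<forall>x\<in>\<Union>Z. g x * h x = 0"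
  obtain p q where p: "homogeneous I d p" "g = poly_eval p" and q: "homogeneous I e q" "h = poly_eval q"
    using gh unfolding form_def by blast
  have top: "topspace (subtopology (zariski I) Z) = Z"
    using Z by (auto simp: topspace_zariski)
  let ?A = "Z \<inter> zero_locus I {p}" and ?B = "Z \<inter> zero_locus I {q}"
  have "closedin (zariski I) (zero_locus I {r})" if "homogeneous I n r" for n r
    unfolding closedin_zariski using that
    by (intro exI[of _ "{r}"]) (auto simp: homogeneous_polys_def)
  then have closed: "closedin (subtopology (zariski I) Z) ?A" "closedin (subtopology (zariski I) Z) ?B"
    unfolding closedin_subtopology using p(1) q(1) by blast+
  have "Z \<subseteq> ?A \<union> ?B"
  proof
    fix l assume l: "l \<in> Z"
    then obtain x where x: "l = line x" using Z by (auto simp: proj_space_def)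
    then have "x \<in> \<Union>Z" using l by auto
    then have "g x = 0 \<or> h x = 0" using 0 by auto
    then show "l \<in> ?A \<union> ?B"
      using l Z vanishes_on_line[OF gh(1), of x] vanishes_on_line[OF gh(2), of x]
      by (auto simp: zero_locus_def x simp flip: p(2) q(2))
  qed
  then have "Z = ?A \<union> ?B" by blast
  then have "?A = Z \<or> ?B = Z"
    using irr closed unfolding irreducible_space_def top by blast
  then show "(\<forall>x\<in>\<Union>Z. g x = 0) \<or> (\<forall>x\<in>\<Union>Z. h x = 0)"
    by (auto simp: zero_locus_def simp flip: p(2) q(2))
qed

lemma dimension_le:
  assumes T: "T \<subseteq> proj_space I" and "finite E"
    and \<Phi>: "\<And>i. i \<in> I \<Longrightarrow> polyfn e (\<lambda>x. \<Phi> x i)"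
    and dense: "\<And>d g x. form I d g \<Longrightarrow> (\<And>z. z \<in> slice E x0 \<Longrightarrow> g (\<Phi> z) = 0) \<Longrightarrow> x \<in> \<Union>T \<Longrightarrow> g x = 0"
  shows "dimension I T \<le> enat (card E)"
  unfolding dimension_def krull_dim_def
proof (rule Sup_least)
  fix n assume "n \<in> {enat k |k. \<exists>Z. (\<forall>i\<le>k. closedin (subtopology (zariski I) T) (Z i) \<and>
      irreducible_space (subtopology (subtopology (zariski I) T) (Z i))) \<and> (\<forall>i<k. Z i \<subset> Z (Suc i))}"
  then obtain k Z where n: "n = enat k"
    and Z: "\<And>i. i \<le> k \<Longrightarrow> closedin (subtopology (zariski I) T) (Z i)"
      "\<And>i. i \<le> k \<Longrightarrow> irreducible_space (subtopology (subtopology (zariski I) T) (Z i))"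
    and chain: "\<And>i. i < k \<Longrightarrow> Z i \<subset> Z (Suc i)" by blast
  have ZT: "Z i \<subseteq> T" if "i \<le> k" for i
    using closedin_subset[OF Z(1)[OF that]] by simp
  have irr: "irreducible_space (subtopology (zariski I) (Z i))" if "i \<le> k" for i
  proof -
    have "T \<inter> Z i = Z i" using ZT[OF that] by blast
    then show ?thesis using Z(2)[OF that] by (simp add: subtopology_subtopology)
  qed
  have "Z 0 \<noteq> {}" using irr[of 0] by (auto simp: irreducible_space_def)
  then obtain x where x: "line x \<in> Z 0" "x \<in> coord_space I" "x \<noteq> 0"
    using ZT[of 0] T by (auto simp: proj_space_def)
  obtain i where i: "x i \<noteq> 0" using x(3) by (auto simp: fun_eq_iff)
  then have "i \<in> I" using x(2) by (auto simp: coord_space_def)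
  have "\<exists>e. \<forall>D. independent_forms I (D * e) ((D + 1) ^ k) (\<Union>(Z k))"
  proof (rule independent_forms_chain[where y = "\<lambda>x. x i"])
    show "prime_on I (\<Union>(Z i))" if "i \<le> k" for i
      using ZT[OF that] T irr[OF that] by (intro prime_on_irreducible) auto
    show "\<Union>(Z i) \<subseteq> \<Union>(Z (Suc i))" if "i < k" for i
      using chain[OF that] by auto
    show "\<exists>x\<in>\<Union>(Z 0). x i \<noteq> 0" using x(1) i mem_line by blast
    show "\<exists>e f. form I e f \<and> (\<forall>x\<in>\<Union>(Z i). f x = 0) \<and> (\<exists>x\<in>\<Union>(Z (Suc i)). f x \<noteq> 0)" if i: "i < k" for i
    proof -
      obtain l where l: "l \<in> Z (Suc i)" "l \<notin> Z i" using chain[OF i] by blast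
      have lT: "l \<in> T" using l(1) ZT[of "Suc i"] i by auto
      obtain F where F: "F \<subseteq> homogeneous_polys I" "Z i = T \<inter> zero_locus I F"
      proof -
        obtain W where "closedin (zariski I) W" "Z i = W \<inter> T"
          using Z(1)[of i] i unfolding closedin_subtopology by auto
        then show ?thesis using that unfolding closedin_zariski by blast
      qed
      then obtain f y where f: "f \<in> F" "y \<in> l" "poly_eval f y \<noteq> 0"
        using l(2) lT T by (auto simp: zero_locus_def)
      obtain d where "form I d (poly_eval f)" using F(1) f(1) form_poly_eval by blast
      moreover have "\<forall>x\<in>\<Union>(Z i). poly_eval f x = 0"
        using F(2) f(1) by (auto simp: zero_locus_def)
      ultimately show ?thesis using f(2,3) l(1) by blast
    qed
  qed (rule form_coord[OF \<open>i \<in> I\<close>])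
  then obtain d where d: "\<And>D. independent_forms I (D * d) ((D + 1) ^ k) (\<Union>(Z k))" by blast
  have ind: "independent_forms I (D * d) ((D + 1) ^ k) (\<Phi> ` slice E x0)" for D
    by (rule independent_forms_mono[OF d]) (use dense ZT[of k] in blast)
  have "(D + 1) ^ k \<le> (D * (d * e) + 1) ^ card E" for D
    using independent_forms_slice_le[where \<Phi> = \<Phi>, OF \<open>finite E\<close> \<Phi> ind] by (simp add: mult.assoc)
  then have "k \<le> card E" by (rule degree_le_of_growth)
  then show "n \<le> enat (card E)" by (simp add: n)
qed

text \<open>Distinct monomials in finitely many variables are linearly independent as functions.\<close>

lemma monomials_independent:
  assumes "finite E" "finite A"
    and "\<And>\<alpha> \<beta>. \<alpha> \<in> A \<Longrightarrow> \<beta> \<in> A \<Longrightarrow> (\<And>e. e \<in> E \<Longrightarrow> \<alpha> e = \<beta> e) \<Longrightarrow> \<alpha> = \<beta>"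
    and "\<And>v. (\<Sum>\<alpha>\<in>A. c \<alpha> * (\<Prod>e\<in>E. v e ^ \<alpha> e)) = (0::complex)"
    and "\<alpha> \<in> A"
  shows "c \<alpha> = 0"
  using assms
proof (induction E arbitrary: A \<alpha> rule: finite_induct)
  case empty
  then have "A = {\<alpha>}" by auto
  then show ?case using empty.prems(3) by simp
next
  case (insert e0 E)
  let ?B = "{\<beta> \<in> A. \<beta> e0 = \<alpha> e0}"
  have "(\<Sum>\<beta>\<in>?B. c \<beta> * (\<Prod>e\<in>E. v e ^ \<beta> e)) = 0" for v
  proof -
    define P where "P = (\<Sum>\<beta>\<in>A. monom (c \<beta> * (\<Prod>e\<in>E. v e ^ \<beta> e)) (\<beta> e0))"
    have "poly P t = 0" for t
    proof -
      have "(\<Prod>e\<in>E. (v(e0 := t)) e ^ \<beta> e) = (\<Prod>e\<in>E. v e ^ \<beta> e)" for \<beta>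
        using insert.hyps(2) by (intro prod.cong) auto
      then have "poly P t = (\<Sum>\<beta>\<in>A. c \<beta> * (\<Prod>e\<in>insert e0 E. (v(e0 := t)) e ^ \<beta> e))"
        using insert.hyps by (simp add: P_def poly_sum poly_monom mult_ac)
      then show ?thesis using insert.prems(3) by simp
    qed
    then have "P = 0" using poly_all_0_iff_0[of P] by blast
    then have "0 = coeff P (\<alpha> e0)" by simp
    also have "\<dots> = (\<Sum>\<beta>\<in>A. if \<beta> e0 = \<alpha> e0 then c \<beta> * (\<Prod>e\<in>E. v e ^ \<beta> e) else 0)"
      by (simp add: P_def coeff_sum)
    also have "\<dots> = (\<Sum>\<beta>\<in>?B. c \<beta> * (\<Prod>e\<in>E. v e ^ \<beta> e))"
      using insert.prems(1) by (simp add: sum.If_cases Int_def)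
    finally show ?thesis by simp
  qed
  then show ?case
  proof (intro insert.IH[of ?B])
    fix \<beta> \<gamma> assume *: "\<beta> \<in> ?B" "\<gamma> \<in> ?B" "\<And>e. e \<in> E \<Longrightarrow> \<beta> e = \<gamma> e"
    then have "\<beta> e = \<gamma> e" if "e \<in> insert e0 E" for e using that by auto
    then show "\<beta> = \<gamma>" using insert.prems(2)[of \<beta> \<gamma>] * by blast
  qed (use insert.prems in auto)
qed

text \<open>
  The linear forms \<open>y0\<close> and \<open>y e\<close> are dual to the vector \<open>\<Phi> x0\<close> and the partial derivatives of \<open>\<Phi>\<close> at \<open>x0\<close>.
  Consider the forms \<open>y0 ^ (card E * D - w \<alpha>) * (\<Prod>e\<in>E. y e ^ \<alpha> e)\<close>, where \<open>w \<alpha> = (\<Sum>e\<in>E. \<alpha> e)\<close> and every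
  \<open>\<alpha> e\<close> is at most \<open>D\<close>.  Along the line \<open>x0 + t v\<close> the lowest order term of such a form is
  \<open>t ^ w \<alpha> * (\<Prod>e\<in>E. v e ^ \<alpha> e)\<close>.  Hence the terms of lowest weight \<open>w \<alpha>\<close> in a relation between these
  forms give a relation between monomials in \<open>v\<close>.
\<close>

lemma independent_forms_tangent:
  assumes "finite E" and y0: "form I 1 y0" and y: "\<And>e. e \<in> E \<Longrightarrow> form I 1 (y e)"
    and y0_exp: "\<And>v. (\<And>u. u \<notin> E \<Longrightarrow> v u = 0) \<Longrightarrow>
       \<exists>q. \<forall>t. y0 (\<Phi> (\<lambda>u. x0 u + t * v u)) = 1 + t * poly q t"
    and y_exp: "\<And>v e. (\<And>u. u \<notin> E \<Longrightarrow> v u = 0) \<Longrightarrow> e \<in> E \<Longrightarrow>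
       \<exists>q. \<forall>t. y e (\<Phi> (\<lambda>u. x0 u + t * v u)) = t * (v e + t * poly q t)"
  shows "independent_forms I (card E * D) ((D + 1) ^ card E) (\<Phi> ` slice E x0)"
proof -
  define A where "A = E \<rightarrow>\<^sub>E {..D}"
  define N where "N = card E * D"
  have finA: "finite A" and cardA: "card A = (D + 1) ^ card E"
    using assms(1) by (simp_all add: A_def finite_PiE card_PiE)
  define w where "w \<alpha> = (\<Sum>e\<in>E. \<alpha> e)" for \<alpha> :: "'a \<Rightarrow> nat"
  have w_le: "w \<alpha> \<le> N" if "\<alpha> \<in> A" for \<alpha>
    unfolding w_def N_def using that by (intro sum_bounded_above[of E \<alpha> D, simplified]) (auto simp: A_def)
  define g where "g \<alpha> x = y0 x ^ (N - w \<alpha>) * (\<Prod>e\<in>E. y e x ^ \<alpha> e)" for \<alpha> x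
  have "independent_forms I N (card A) (\<Phi> ` slice E x0)"
  proof (rule independent_formsI[OF finA, where g = g])
    fix \<alpha> assume "\<alpha> \<in> A"
    have "form I ((N - w \<alpha>) * 1 + (\<Sum>e\<in>E. \<alpha> e * 1)) (g \<alpha>)"
      unfolding g_def by (intro form_mult form_power form_prod y0 y)
    then show "form I N (g \<alpha>)" using w_le[OF \<open>\<alpha> \<in> A\<close>] by (simp add: w_def)
  next
    fix c \<alpha> assume 0: "\<And>x. x \<in> \<Phi> ` slice E x0 \<Longrightarrow> (\<Sum>\<alpha>\<in>A. c \<alpha> * g \<alpha> x) = 0" and "\<alpha> \<in> A"
    show "c \<alpha> = 0"
    proof (rule ccontr)
      assume "c \<alpha> \<noteq> 0"
      define k where "k = Min (w ` {\<beta> \<in> A. c \<beta> \<noteq> 0})"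
      have fin: "finite (w ` {\<beta> \<in> A. c \<beta> \<noteq> 0})" using finA by simp
      have ne: "w ` {\<beta> \<in> A. c \<beta> \<noteq> 0} \<noteq> {}" using \<open>c \<alpha> \<noteq> 0\<close> \<open>\<alpha> \<in> A\<close> by blast
      obtain \<beta>0 where \<beta>0: "\<beta>0 \<in> A" "c \<beta>0 \<noteq> 0" "w \<beta>0 = k"
        using Min_in[OF fin ne] by (auto simp: k_def)
      have k_le: "k \<le> w \<beta>" if "\<beta> \<in> A" "c \<beta> \<noteq> 0" for \<beta>
        unfolding k_def using that fin by (intro Min_le) auto
      let ?B = "{\<beta> \<in> A. w \<beta> = k}"
      have low: "(\<Sum>\<beta>\<in>?B. c \<beta> * (\<Prod>e\<in>E. v e ^ \<beta> e)) = 0" for v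
      proof -
        define v' where "v' u = (if u \<in> E then v u else 0)" for u
        have v': "v' u = 0" if "u \<notin> E" for u using that by (simp add: v'_def)
        obtain q0 where q0: "\<And>t. y0 (\<Phi> (\<lambda>u. x0 u + t * v' u)) = 1 + t * poly q0 t"
          using y0_exp[of v', OF v'] by blast
        have "\<forall>e\<in>E. \<exists>q. \<forall>t. y e (\<Phi> (\<lambda>u. x0 u + t * v' u)) = t * (v' e + t * poly q t)"
          using y_exp[of v', OF v'] by blast
        then obtain q where q: "\<And>e t. e \<in> E \<Longrightarrow> y e (\<Phi> (\<lambda>u. x0 u + t * v' u)) = t * (v' e + t * poly (q e) t)"
          by metis
        define R where "R \<beta> = pCons 1 q0 ^ (N - w \<beta>) * (\<Prod>e\<in>E. pCons (v' e) (q e) ^ \<beta> e)" for \<beta>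
        define P where "P = (\<Sum>\<beta>\<in>A. smult (c \<beta>) (monom 1 (w \<beta>) * R \<beta>))"
        have gR: "g \<beta> (\<Phi> (\<lambda>u. x0 u + t * v' u)) = t ^ w \<beta> * poly (R \<beta>) t" for \<beta> t
          by (simp add: g_def R_def q0 q poly_prod power_mult_distrib prod.distrib w_def power_sum)
        have "poly P t = 0" for t
        proof -
          have "(\<lambda>u. x0 u + t * v' u) \<in> slice E x0" by (simp add: slice_def v')
          then have "(\<Sum>\<alpha>\<in>A. c \<alpha> * g \<alpha> (\<Phi> (\<lambda>u. x0 u + t * v' u))) = 0" by (intro 0 imageI)
          then show ?thesis by (simp add: P_def gR poly_sum poly_monom)
        qed
        then have "P = 0" using poly_all_0_iff_0[of P] by blast
        then have "0 = coeff P k" by simp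
        also have "\<dots> = (\<Sum>\<beta>\<in>A. if w \<beta> = k then c \<beta> * (\<Prod>e\<in>E. v e ^ \<beta> e) else 0)"
          unfolding P_def coeff_sum
        proof (rule sum.cong[OF refl])
          fix \<beta> assume \<beta>: "\<beta> \<in> A"
          have "coeff (R \<beta>) 0 = (\<Prod>e\<in>E. v' e ^ \<beta> e)"
            by (simp add: R_def poly_prod flip: poly_0_coeff_0)
          also have "\<dots> = (\<Prod>e\<in>E. v e ^ \<beta> e)" by (simp add: v'_def)
          finally show "coeff (smult (c \<beta>) (monom 1 (w \<beta>) * R \<beta>)) k =
              (if w \<beta> = k then c \<beta> * (\<Prod>e\<in>E. v e ^ \<beta> e) else 0)"
            using k_le[OF \<beta>] by (cases "c \<beta> = 0") (auto simp: coeff_monom_mult)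
        qed
        also have "\<dots> = (\<Sum>\<beta>\<in>?B. c \<beta> * (\<Prod>e\<in>E. v e ^ \<beta> e))"
          using finA by (simp add: sum.If_cases Int_def)
        finally show ?thesis by simp
      qed
      have "c \<beta>0 = 0"
      proof (rule monomials_independent[OF assms(1) _ _ low])
        fix \<alpha> \<beta> assume *: "\<alpha> \<in> ?B" "\<beta> \<in> ?B" "\<And>e. e \<in> E \<Longrightarrow> \<alpha> e = \<beta> e"
        then show "\<alpha> = \<beta>" by (intro PiE_ext[of \<alpha> E "\<lambda>_. {..D}" \<beta>]) (auto simp: A_def)
      qed (use finA \<beta>0 in auto)
      then show False using \<beta>0(2) by simp
    qed
  qed
  then show ?thesis by (simp add: cardA N_def)
qed

section \<open>A lower bound for the dimension of an image\<close>

text \<open>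
  The points of projective space represented by the nonzero values of \<open>\<Phi>\<close> on \<open>S\<close>.
\<close>

definition image_points ::
  "(('v \<Rightarrow> complex) \<Rightarrow> 'i \<Rightarrow> complex) \<Rightarrow> ('v \<Rightarrow> complex) set \<Rightarrow> ('i \<Rightarrow> complex) set set" where
  "image_points \<Phi> S = {line (\<Phi> x) | x. x \<in> S \<and> \<Phi> x \<noteq> 0}"

lemma image_points_mono: "S \<subseteq> S' \<Longrightarrow> image_points \<Phi> S \<subseteq> image_points \<Phi> S'"
  unfolding image_points_def by blast

lemma image_points_subset:
  "(\<And>x. \<Phi> x \<in> coord_space I) \<Longrightarrow> image_points \<Phi> S \<subseteq> proj_space I"
  unfolding image_points_def proj_space_def by blast

lemma form_vanishes_closure:
  assumes g: "form I d g" and Y: "Y \<subseteq> proj_space I" "\<And>x. x \<in> \<Union>Y \<Longrightarrow> g x = 0"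
    and x: "x \<in> \<Union>(zariski I closure_of Y)"
  shows "g x = 0"
proof -
  obtain f where f: "homogeneous I d f" "g = poly_eval f" using g unfolding form_def by blast
  have "closedin (zariski I) (zero_locus I {f})"
    unfolding closedin_zariski using f(1)
    by (intro exI[of _ "{f}"]) (auto simp: homogeneous_polys_def)
  moreover have "Y \<subseteq> zero_locus I {f}"
    using Y by (auto simp: zero_locus_def f(2))
  ultimately have "zariski I closure_of Y \<subseteq> zero_locus I {f}" by (rule closure_of_minimal[rotated])
  then show ?thesis using x by (auto simp: zero_locus_def f(2))
qed

lemma form_vanishes_slice:
  assumes \<Phi>: "\<And>i. i \<in> I \<Longrightarrow> polyfn e (\<lambda>x. \<Phi> x i)" "\<And>x. \<Phi> x \<in> coord_space I"
    and "\<Phi> x0 \<noteq> 0" and g: "form I d g"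
    and van: "\<And>x. x \<in> \<Union>(image_points \<Phi> (slice E x0)) \<Longrightarrow> g x = 0" and x: "x \<in> slice E x0"
  shows "g (\<Phi> x) = 0"
proof (rule ccontr)
  assume nz: "g (\<Phi> x) \<noteq> 0"
  obtain i where i: "\<Phi> x0 i \<noteq> 0" using \<open>\<Phi> x0 \<noteq> 0\<close> by (auto simp: fun_eq_iff)
  then have "i \<in> I" using \<Phi>(2)[of x0] by (auto simp: coord_space_def)
  obtain t where t: "g (\<Phi> (segment x x0 t)) \<noteq> 0" "\<Phi> (segment x x0 t) i \<noteq> 0"
  proof -
    have "polyfn (d * e) (\<lambda>x. g (\<Phi> x))" using polyfn_form[OF g \<Phi>(1)] .
    from polyfn_common_nonzero[where f = "\<lambda>x. g (\<Phi> x)" and g = "\<lambda>x. \<Phi> x i", OF this \<Phi>(1)[OF \<open>i \<in> I\<close>] nz i]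
    show ?thesis using that by blast
  qed
  have "\<Phi> (segment x x0 t) \<in> \<Union>(image_points \<Phi> (slice E x0))"
  proof (rule UnionI[OF _ mem_line])
    have "\<Phi> (segment x x0 t) \<noteq> 0" using t(2) by auto
    then show "line (\<Phi> (segment x x0 t)) \<in> image_points \<Phi> (slice E x0)"
      using segment_slice[OF x base_in_slice, of t] unfolding image_points_def by blast
  qed
  then show False using van t(1) by blast
qed

lemma irreducible_closure_image:
  assumes \<Phi>: "\<And>i. i \<in> I \<Longrightarrow> polyfn e (\<lambda>x. \<Phi> x i)" "\<And>x. \<Phi> x \<in> coord_space I"
    and "\<Phi> x0 \<noteq> 0" and YT: "image_points \<Phi> (slice E x0) \<subseteq> T"
    and Z: "Z = T \<inter> zariski I closure_of (image_points \<Phi> (slice E x0))"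
  shows "irreducible_space (subtopology (zariski I) Z)"
proof -
  let ?Y = "image_points \<Phi> (slice E x0)"
  have Y: "?Y \<subseteq> proj_space I" using \<Phi>(2) by (rule image_points_subset)
  have YZ: "?Y \<subseteq> Z" using closure_of_subset[of ?Y "zariski I"] Y YT by (simp add: Z topspace_zariski)
  have top: "topspace (subtopology (zariski I) Z) = Z"
    using closure_of_subset_topspace[of "zariski I" ?Y] by (auto simp: Z)
  obtain i where i: "\<Phi> x0 i \<noteq> 0" using \<open>\<Phi> x0 \<noteq> 0\<close> by (auto simp: fun_eq_iff)
  then have iI: "i \<in> I" using \<Phi>(2)[of x0] by (auto simp: coord_space_def)
  have witness: "\<exists>f d x. form I d (poly_eval f) \<and> f \<in> F \<and> x \<in> slice E x0 \<and> poly_eval f (\<Phi> x) \<noteq> 0"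
    if F: "F \<subseteq> homogeneous_polys I" "\<not> Z \<subseteq> zero_locus I F" for F
  proof -
    obtain l where l: "l \<in> Z" "l \<notin> zero_locus I F" using F(2) by blast
    moreover have "l \<in> proj_space I"
      using l(1) closure_of_subset_topspace[of "zariski I" ?Y] by (auto simp: Z topspace_zariski)
    ultimately obtain f y where f: "f \<in> F" "y \<in> l" "poly_eval f y \<noteq> 0"
      by (auto simp: zero_locus_def)
    obtain d where d: "form I d (poly_eval f)" using F(1) f(1) form_poly_eval by blast
    have "\<exists>x\<in>\<Union>?Y. poly_eval f x \<noteq> 0"
      using form_vanishes_closure[OF d Y, of y] f l(1) by (auto simp: Z)
    then obtain x y where x: "x \<in> slice E x0" "y \<in> line (\<Phi> x)" "poly_eval f y \<noteq> 0"
      by (auto simp: image_points_def)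
    then have "poly_eval f (\<Phi> x) \<noteq> 0" using vanishes_on_line[OF d] by blast
    then show ?thesis using d f(1) x(1) by blast
  qed
  have "A = Z \<or> B = Z"
    if A: "closedin (subtopology (zariski I) Z) A" and B: "closedin (subtopology (zariski I) Z) B"
      and AB: "Z = A \<union> B" for A B
  proof (rule ccontr)
    assume neg: "\<not> (A = Z \<or> B = Z)"
    obtain F where F: "F \<subseteq> homogeneous_polys I" "A = zero_locus I F \<inter> Z"
      using A unfolding closedin_subtopology closedin_zariski by blast
    obtain G where G: "G \<subseteq> homogeneous_polys I" "B = zero_locus I G \<inter> Z"
      using B unfolding closedin_subtopology closedin_zariski by blast
    obtain f d x where f: "form I d (poly_eval f)" "f \<in> F" "x \<in> slice E x0" "poly_eval f (\<Phi> x) \<noteq> 0"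
      using witness[OF F(1)] F(2) neg by blast
    obtain g d' y where g: "form I d' (poly_eval g)" "g \<in> G" "y \<in> slice E x0" "poly_eval g (\<Phi> y) \<noteq> 0"
      using witness[OF G(1)] G(2) neg by blast
    have pf: "polyfn (d * e) (\<lambda>x. poly_eval f (\<Phi> x))" and pg: "polyfn (d' * e) (\<lambda>x. poly_eval g (\<Phi> x))"
      using f(1) g(1) \<Phi>(1) by (auto intro: polyfn_form)
    obtain t where t: "poly_eval f (\<Phi> (segment x x0 t)) \<noteq> 0" "\<Phi> (segment x x0 t) i \<noteq> 0"
        using polyfn_common_nonzero[where f = "\<lambda>x. poly_eval f (\<Phi> x)" and g = "\<lambda>x. \<Phi> x i",
          OF pf \<Phi>(1)[OF iI] f(4) i] by blast
    let ?z = "segment x x0 t"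
    have z: "?z \<in> slice E x0" by (intro segment_slice f(3)) simp
    have "poly_eval f (\<Phi> ?z) * \<Phi> ?z i \<noteq> 0" using t by simp
    from polyfn_common_nonzero[where f = "\<lambda>x. poly_eval f (\<Phi> x) * \<Phi> x i" and g = "\<lambda>x. poly_eval g (\<Phi> x)",
        OF polyfn.mult[OF pf \<Phi>(1)[OF iI]] pg this g(4)]
    obtain u where u: "poly_eval f (\<Phi> (segment ?z y u)) * \<Phi> (segment ?z y u) i \<noteq> 0"
      "poly_eval g (\<Phi> (segment ?z y u)) \<noteq> 0" by blast
    let ?w = "segment ?z y u"
    have "?w \<in> slice E x0" by (intro segment_slice z g(3))
    moreover have "\<Phi> ?w \<noteq> 0" using u(1) by auto
    ultimately have "line (\<Phi> ?w) \<in> A \<union> B" using YZ AB by (auto simp: image_points_def)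
    then have "poly_eval f (\<Phi> ?w) = 0 \<or> poly_eval g (\<Phi> ?w) = 0"
      using f(2) g(2) mem_line by (auto simp: F(2) G(2) zero_locus_def)
    then show False using u by auto
  qed
  moreover have "Z \<noteq> {}"
    using YZ \<open>\<Phi> x0 \<noteq> 0\<close> base_in_slice[of x0 E] unfolding image_points_def by blast
  ultimately show ?thesis unfolding irreducible_space_def top by blast
qed

text \<open>
  The hypotheses on \<open>y0\<close> and \<open>y\<close> express, by means of dual linear forms, that \<open>\<Phi> x0\<close> and the partial derivatives of \<open>\<Phi>\<close> at \<open>x0\<close> are independent.
  The set \<open>T\<close> need not be closed; the chain consists of the relative closures in \<open>T\<close> of the images of the
  slices in which the first \<open>j\<close> parameters are free.
\<close>

lemma dimension_ge:
  assumes T: "T \<subseteq> proj_space I" and "finite E"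
    and \<Phi>: "\<And>i. i \<in> I \<Longrightarrow> polyfn e (\<lambda>x. \<Phi> x i)" "\<And>x. \<Phi> x \<in> coord_space I"
    and x0: "\<Phi> x0 \<noteq> 0" and YT: "image_points \<Phi> (slice E x0) \<subseteq> T"
    and y0: "form I 1 y0" and y: "\<And>e. e \<in> E \<Longrightarrow> form I 1 (y e)"
    and y0_exp: "\<And>v. (\<And>u. u \<notin> E \<Longrightarrow> v u = 0) \<Longrightarrow>
       \<exists>q. \<forall>t. y0 (\<Phi> (\<lambda>u. x0 u + t * v u)) = 1 + t * poly q t"
    and y_exp: "\<And>v e. (\<And>u. u \<notin> E \<Longrightarrow> v u = 0) \<Longrightarrow> e \<in> E \<Longrightarrow>
       \<exists>q. \<forall>t. y e (\<Phi> (\<lambda>u. x0 u + t * v u)) = t * (v e + t * poly q t)"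
  shows "enat (card E) \<le> dimension I T"
proof -
  obtain es where es: "set es = E" "distinct es" using finite_distinct_list[OF \<open>finite E\<close>] by blast
  have len: "length es = card E" using distinct_card[OF es(2)] es(1) by simp
  define F where "F j = set (take j es)" for j
  have F: "F j \<subseteq> E" "finite (F j)" "F j \<subseteq> F (Suc j)" for j
    using es(1) set_take_subset[of j es] set_take_subset_set_take[of j "Suc j" es] by (auto simp: F_def)
  have card_F: "card (F j) = j" if "j \<le> card E" for j
    using that es(2) len by (simp add: F_def distinct_card)
  define Y where "Y j = image_points \<Phi> (slice (F j) x0)" for j
  define Z where "Z j = T \<inter> zariski I closure_of (Y j)" for j
  have slice_mono: "slice A x0 \<subseteq> slice B x0" if "A \<subseteq> B" for A B using that by (auto simp: slice_def)
  have YT': "Y j \<subseteq> T" for j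
    using YT image_points_mono[OF slice_mono[OF F(1)[of j]]] unfolding Y_def by blast
  have Yp: "Y j \<subseteq> proj_space I" for j using YT' T by blast
  have YZ: "Y j \<subseteq> Z j" for j
    using closure_of_subset[of "Y j" "zariski I"] Yp YT' by (simp add: Z_def topspace_zariski)
  have closed: "closedin (subtopology (zariski I) T) (Z j)" for j
    unfolding closedin_subtopology Z_def by (intro exI[of _ "zariski I closure_of (Y j)"]) auto
  have irr: "irreducible_space (subtopology (subtopology (zariski I) T) (Z j))" for j
  proof -
    have "irreducible_space (subtopology (zariski I) (Z j))"
      by (rule irreducible_closure_image[where \<Phi> = \<Phi>, OF \<Phi> x0 YT'[unfolded Y_def] Z_def[unfolded Y_def]])
    moreover have "T \<inter> Z j = Z j" by (auto simp: Z_def)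
    ultimately show ?thesis by (simp add: subtopology_subtopology)
  qed
  have strict: "Z j \<subset> Z (Suc j)" if j: "j < card E" for j
  proof -
    have "Y j \<subseteq> Y (Suc j)" unfolding Y_def by (intro image_points_mono slice_mono F)
    then have sub: "Z j \<subseteq> Z (Suc j)" unfolding Z_def using closure_of_mono by blast
    have "Z j \<noteq> Z (Suc j)"
    proof
      assume eq: "Z j = Z (Suc j)"
      have "(D + 1) ^ Suc j \<le> (D * (Suc j * e) + 1) ^ j" for D
      proof -
        have "independent_forms I (card (F (Suc j)) * D) ((D + 1) ^ card (F (Suc j))) (\<Phi> ` slice (F (Suc j)) x0)"
        proof (rule independent_forms_tangent[OF F(2) y0])
          show "form I 1 (y u)" if "u \<in> F (Suc j)" for u using y F(1) that by blast
          show "\<exists>q. \<forall>t. y0 (\<Phi> (\<lambda>u. x0 u + t * v u)) = 1 + t * poly q t"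
            if "\<And>u. u \<notin> F (Suc j) \<Longrightarrow> v u = 0" for v
            using y0_exp[of v] that F(1)[of "Suc j"] by blast
          show "\<exists>q. \<forall>t. y u (\<Phi> (\<lambda>u. x0 u + t * v u)) = t * (v u + t * poly q t)"
            if "\<And>u. u \<notin> F (Suc j) \<Longrightarrow> v u = 0" "u \<in> F (Suc j)" for v u
            using y_exp[of v u] that F(1)[of "Suc j"] by blast
        qed
        then have "independent_forms I (Suc j * D) ((D + 1) ^ Suc j) (\<Phi> ` slice (F (Suc j)) x0)"
          using card_F[of "Suc j"] j by simp
        then have "independent_forms I (Suc j * D) ((D + 1) ^ Suc j) (\<Phi> ` slice (F j) x0)"
        proof (rule independent_forms_mono)
          fix g assume g: "form I (Suc j * D) g" "\<forall>x\<in>\<Phi> ` slice (F j) x0. g x = 0"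
          have "g x = 0" if x: "x \<in> \<Union>(Y j)" for x
            using x g(2) vanishes_on_line[OF g(1)] by (auto simp: Y_def image_points_def)
          then have "g x = 0" if "x \<in> \<Union>(Z j)" for x
            using form_vanishes_closure[OF g(1) Yp _, of j x] that \<open>\<And>x. x \<in> \<Union>(Y j) \<Longrightarrow> g x = 0\<close>
            unfolding Z_def by blast
          then have "g x = 0" if "x \<in> \<Union>(Y (Suc j))" for x
            using that YZ[of "Suc j"] eq by blast
          then have "g (\<Phi> x) = 0" if "x \<in> slice (F (Suc j)) x0" for x
            using form_vanishes_slice[where \<Phi> = \<Phi>, OF \<Phi> x0 g(1) _ that] unfolding Y_def by blast
          then show "\<forall>x\<in>\<Phi> ` slice (F (Suc j)) x0. g x = 0" by blast
        qed
        then have "(D + 1) ^ Suc j \<le> (Suc j * D * e + 1) ^ card (F j)"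
          using independent_forms_slice_le[where \<Phi> = \<Phi>, OF F(2) \<Phi>(1)] by blast
        moreover have "Suc j * D * e = D * (Suc j * e)" by (simp only: mult_ac)
        moreover have "card (F j) = j" using card_F j by simp
        ultimately show ?thesis by metis
      qed
      then have "Suc j \<le> j" by (rule degree_le_of_growth)
      then show False by simp
    qed
    then show ?thesis using sub by blast
  qed
  show ?thesis
    unfolding dimension_def krull_dim_def
    by (rule Sup_upper) (use closed irr strict in blast)
qed

section \<open>The parametrisation of the secant varieties\<close>

text \<open>
  The parametrisation \<open>(a\<^sub>p, b\<^sub>p)\<^sub>p \<mapsto> \<Sum>\<^sub>p a\<^sub>p \<otimes> b\<^sub>p\<^sup>2\<close> of the cone over the union of the secant spaces.  The
  parameter \<open>(p, c)\<close> is the coordinate of \<open>a\<^sub>p\<close> of index \<open>c\<close> for \<open>c \<le> m\<close>, and the coordinate of \<open>b\<^sub>p\<close> of index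
  \<open>c - m - 1\<close> otherwise.
\<close>

definition secant_param ::
  "nat \<Rightarrow> nat \<Rightarrow> nat \<Rightarrow> (nat \<times> nat \<Rightarrow> complex) \<Rightarrow> nat \<times> nat \<times> nat \<Rightarrow> complex" where
  "secant_param m n s x =
     (\<Sum>p<s. sv_map m n (\<lambda>i. x (p, i)) (\<lambda>j. x (p, Suc m + j)))"

lemma secant_param_apply:
  "secant_param m n s x (i, j, k) = (if (i, j, k) \<in> sv_index m n
     then \<Sum>p<s. x (p, i) * x (p, Suc (m + j)) * x (p, Suc (m + k)) else 0)"
  by (simp add: secant_param_def sum_fun_apply sv_map_def)

lemma secant_param_coord_space: "secant_param m n s x \<in> coord_space (sv_index m n)"
  unfolding coord_space_def
proof (intro CollectI allI impI)
  fix r assume "r \<notin> sv_index m n"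
  then show "secant_param m n s x r = 0" by (cases r) (simp add: secant_param_apply)
qed

lemma polyfn_secant_param: "polyfn 3 (\<lambda>x. secant_param m n s x r)"
proof -
  obtain i j k where r: "r = (i, j, k)" by (cases r)
  have "polyfn (1 + 1 + 1) (\<lambda>x. x (p, i) * x (p, Suc (m + j)) * x (p, Suc (m + k)))" for p :: nat
    using polyfn.var[of 0] by (intro polyfn.mult) simp_all
  then have "polyfn 3 (\<lambda>x. x (p, i) * x (p, Suc (m + j)) * x (p, Suc (m + k)))" for p :: nat
    by (simp add: numeral_3_eq_3)
  then have "polyfn 3 (\<lambda>x. \<Sum>p<s. x (p, i) * x (p, Suc (m + j)) * x (p, Suc (m + k)))"
    by (intro polyfn_sum)
  then show ?thesis
    unfolding r secant_param_apply by (cases "(i, j, k) \<in> sv_index m n") (simp_all add: polyfn.const)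
qed

text \<open>The parameters on which \<open>secant_param m n s\<close> depends.\<close>

abbreviation param_index :: "nat \<Rightarrow> nat \<Rightarrow> nat \<Rightarrow> (nat \<times> nat) set" where
  "param_index m n s \<equiv> {..<s} \<times> {..<m + n + 2}"

text \<open>
  The parameters that stay free in an affine chart: one coordinate of each \<open>b\<^sub>p\<close> is fixed, because
  \<open>a\<^sub>p \<otimes> b\<^sub>p\<^sup>2\<close> does not determine the scale of \<open>b\<^sub>p\<close>, and one coordinate of \<open>a\<^sub>0\<close> is fixed, because points of
  projective space are only determined up to scale.
\<close>

definition chart :: "nat \<Rightarrow> nat \<Rightarrow> nat \<Rightarrow> nat \<Rightarrow> (nat \<Rightarrow> nat) \<Rightarrow> (nat \<times> nat) set" where
  "chart m n s i0 h = param_index m n s - insert (0, i0) ((\<lambda>p. (p, Suc m + h p)) ` {..<s})"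

lemma finite_chart [simp]: "finite (chart m n s i0 h)"
  by (simp add: chart_def)

lemma card_chart:
  assumes "1 \<le> s" "i0 \<le> m" "\<And>p. p < s \<Longrightarrow> h p \<le> n"
  shows "card (chart m n s i0 h) = s * (m + n + 1) - 1"
proof -
  let ?R = "(\<lambda>p. (p, Suc m + h p)) ` {..<s}"
  have "card ?R = s" by (simp add: card_image inj_on_def)
  moreover have "(0, i0) \<notin> ?R" using assms(2) by auto
  ultimately have "card (insert (0, i0) ?R) = s + 1" by simp
  moreover have "insert (0, i0) ?R \<subseteq> param_index m n s"
    using assms by (force simp: less_Suc_eq_le)
  ultimately have "card (chart m n s i0 h) = s * (m + n + 2) - (s + 1)"
    unfolding chart_def by (subst card_Diff_subset) auto
  then show ?thesis by (simp add: algebra_simps)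
qed

lemma image_points_secant_param:
  "image_points (secant_param m n s) S \<subseteq> proj_space (sv_index m n)"
  by (rule image_points_subset) (rule secant_param_coord_space)

text \<open>
  A form vanishing on the chart where the fixed coordinates are \<open>1\<close> vanishes on the whole image, since a
  generic parameter can be rescaled into the chart.
\<close>

lemma dimension_secant_le:
  assumes s: "1 \<le> s" and T: "T \<subseteq> proj_space (sv_index m n)"
    and dense: "\<And>d g x. form (sv_index m n) d g \<Longrightarrow>
      (\<And>x. g (secant_param m n s x) = 0) \<Longrightarrow> x \<in> \<Union>T \<Longrightarrow> g x = 0"
  shows "dimension (sv_index m n) T \<le> enat (s * (m + n + 1) - 1)"
proof -
  let ?I = "sv_index m n" and ?\<Phi> = "secant_param m n s"
  define E where "E = chart m n s 0 (\<lambda>_. 0)"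
  have "dimension ?I T \<le> enat (card E)"
  proof (rule dimension_le[OF T, where \<Phi> = ?\<Phi> and ?x0.0 = "\<lambda>_. 1"])
    show "finite E" by (simp add: E_def)
    show "polyfn 3 (\<lambda>x. ?\<Phi> x i)" for i by (rule polyfn_secant_param)
    fix d g x
    assume g: "form ?I d g" and van: "\<And>z. z \<in> slice E (\<lambda>_. 1) \<Longrightarrow> g (?\<Phi> z) = 0" and x: "x \<in> \<Union>T"
    show "g x = 0"
    proof (rule dense[OF g _ x], rule ccontr)
      fix x assume nz: "g (?\<Phi> x) \<noteq> 0"
      have pg: "polyfn (d * 3) (\<lambda>x. g (?\<Phi> x))" by (intro polyfn_form[OF g] polyfn_secant_param)
      have ph: "polyfn (1 + (\<Sum>p<s. 1)) (\<lambda>x. x (0::nat, 0::nat) * (\<Prod>p<s. x (p, Suc m)))"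
        using polyfn.var[of 0] by (intro polyfn.mult polyfn_prod) simp_all
      obtain t where t: "g (?\<Phi> (segment x (\<lambda>_. 1) t)) \<noteq> 0"
        "segment x (\<lambda>_. 1) t (0, 0) * (\<Prod>p<s. segment x (\<lambda>_. 1) t (p, Suc m)) \<noteq> 0"
        by (rule polyfn_common_nonzero[OF pg ph, of x "\<lambda>_. 1"]) (use nz in auto)
      define y where "y = segment x (\<lambda>_. 1) t"
      have y0: "y (0, 0) \<noteq> 0" and yp: "\<And>p. p < s \<Longrightarrow> y (p, Suc m) \<noteq> 0"
        using t(2) by (auto simp: y_def)
      define \<kappa> where "\<kappa> = y (0, 0) * y (0, Suc m) ^ 2"
      have \<kappa>: "\<kappa> \<noteq> 0" using y0 yp[of 0] s by (simp add: \<kappa>_def)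
      define z where "z u = (if u \<in> param_index m n s
         then (if snd u \<le> m then y u * y (fst u, Suc m) ^ 2 / \<kappa> else y u / y (fst u, Suc m)) else 1)" for u
      have "z \<in> slice E (\<lambda>_. 1)"
        unfolding slice_def
      proof (intro CollectI allI impI)
        fix u assume "u \<notin> E"
        then consider "u \<notin> param_index m n s" | "u = (0, 0)" | p where "p < s" "u = (p, Suc m)"
          by (auto simp: E_def chart_def)
        then show "z u = 1"
        proof cases
          case 2
          then show ?thesis using \<kappa> s by (simp add: z_def \<kappa>_def)
        next
          case 3
          then show ?thesis using yp by (simp add: z_def)
        qed (simp add: z_def)
      qed
      then have "g (?\<Phi> z) = 0" by (rule van)
      moreover have "?\<Phi> z = cscale (1 / \<kappa>) (?\<Phi> y)"
      proof
        fix r :: "nat \<times> nat \<times> nat"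
        obtain i j k where r: "r = (i, j, k)" by (cases r)
        have "z (p, i) * z (p, Suc (m + j)) * z (p, Suc (m + k)) =
            1 / \<kappa> * (y (p, i) * y (p, Suc (m + j)) * y (p, Suc (m + k)))"
          if "(i, j, k) \<in> sv_index m n" "p < s" for p
          using that \<kappa> yp[of p] by (simp add: sv_index_def z_def field_simps power2_eq_square)
        then show "?\<Phi> z r = cscale (1 / \<kappa>) (?\<Phi> y) r"
          by (simp add: r secant_param_apply cscale_def sum_divide_distrib)
      qed
      ultimately have "(1 / \<kappa>) ^ d * g (?\<Phi> y) = 0" by (simp add: form_cscale[OF g])
      then show False using t(1) \<kappa> by (simp add: y_def)
    qed
  qed
  then show ?thesis using card_chart[OF s, of 0 m "\<lambda>_. 0" n] by (simp add: E_def)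
qed

text \<open>The parameter belonging to the configuration \<open>(a, b)\<close>.\<close>

definition base_point :: "nat \<Rightarrow> (nat \<Rightarrow> nat \<Rightarrow> complex) \<Rightarrow> (nat \<Rightarrow> nat \<Rightarrow> complex) \<Rightarrow> nat \<times> nat \<Rightarrow> complex" where
  "base_point m a b = (\<lambda>(p, c). if c \<le> m then a p c else b p (c - Suc m))"

lemma base_point_simps:
  "c \<le> m \<Longrightarrow> base_point m a b (p, c) = a p c" "base_point m a b (p, Suc (m + j)) = b p j"
  by (simp_all add: base_point_def)

text \<open>The partial derivative of the parametrisation at \<open>base_point m a b\<close> with respect to \<open>(p, c)\<close>.\<close>

definition tangent_vector ::
  "nat \<Rightarrow> (nat \<Rightarrow> nat \<Rightarrow> complex) \<Rightarrow> (nat \<Rightarrow> nat \<Rightarrow> complex) \<Rightarrow> nat \<times> nat \<Rightarrow> nat \<times> nat \<times> nat \<Rightarrow> complex" where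
  "tangent_vector m a b = (\<lambda>(p, c) (i, j, k).
     (if c = i then b p j * b p k else 0) + (if c = Suc m + j then a p i * b p k else 0)
     + (if c = Suc m + k then a p i * b p j else 0))"

lemma secant_param_base_point:
  assumes "(i, j, k) \<in> sv_index m n"
  shows "secant_param m n s (base_point m a b) (i, j, k) = (\<Sum>p<s. a p i * b p j * b p k)"
  using assms by (simp add: secant_param_apply base_point_simps sv_index_def)

lemma sum_tangent_vector:
  assumes E: "E \<subseteq> param_index m n s" "\<And>u. u \<notin> E \<Longrightarrow> v u = 0" and r: "(i, j, k) \<in> sv_index m n"
  shows "(\<Sum>u\<in>E. v u * tangent_vector m a b u (i, j, k)) =
    tangent_sum s a b (\<lambda>p i. v (p, i)) (\<lambda>p j. v (p, Suc m + j)) i j k"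
proof -
  have "(\<Sum>u\<in>E. v u * tangent_vector m a b u (i, j, k)) =
      (\<Sum>u\<in>param_index m n s. v u * tangent_vector m a b u (i, j, k))"
    by (rule sum.mono_neutral_left) (use E in auto)
  also have "\<dots> = (\<Sum>p<s. \<Sum>c<m + n + 2. v (p, c) * tangent_vector m a b (p, c) (i, j, k))"
    by (simp only: sum.cartesian_product split_def prod.collapse)
  also have "\<dots> = tangent_sum s a b (\<lambda>p i. v (p, i)) (\<lambda>p j. v (p, Suc m + j)) i j k"
    unfolding tangent_sum_def
  proof (rule sum.cong[OF refl])
    fix p
    have "(\<Sum>c<m + n + 2. v (p, c) * tangent_vector m a b (p, c) (i, j, k)) =
      (\<Sum>c<m + n + 2. (if c = i then v (p, c) * b p j * b p k else 0)
         + (if c = Suc m + j then v (p, c) * a p i * b p k else 0)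
         + (if c = Suc m + k then v (p, c) * a p i * b p j else 0))"
      by (intro sum.cong) (auto simp: tangent_vector_def algebra_simps)
    also have "\<dots> = v (p, i) * b p j * b p k + v (p, Suc m + j) * a p i * b p k + v (p, Suc m + k) * a p i * b p j"
      using r by (simp only: sum.distrib sum.delta finite_lessThan) (auto simp: sv_index_def)
    finally show "(\<Sum>c<m + n + 2. v (p, c) * tangent_vector m a b (p, c) (i, j, k)) =
      v (p, i) * b p j * b p k + a p i * (b p j * v (p, Suc m + k) + b p k * v (p, Suc m + j))"
      by (simp add: algebra_simps)
  qed
  finally show ?thesis .
qed

lemma secant_param_expansion:
  assumes E: "E \<subseteq> param_index m n s" "\<And>u. u \<notin> E \<Longrightarrow> v u = 0"
  shows "\<exists>R2 R3. \<forall>t. \<forall>r\<in>sv_index m n. secant_param m n s (\<lambda>u. base_point m a b u + t * v u) r =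
    secant_param m n s (base_point m a b) r + t * (\<Sum>u\<in>E. v u * tangent_vector m a b u r)
    + t ^ 2 * (R2 r + t * R3 r)"
proof (intro exI allI ballI)
  fix t r assume r: "r \<in> sv_index m n"
  obtain i j k where ijk: "r = (i, j, k)" by (cases r)
  have i: "i \<le> m" using r by (simp add: ijk sv_index_def)
  show "secant_param m n s (\<lambda>u. base_point m a b u + t * v u) r =
    secant_param m n s (base_point m a b) r + t * (\<Sum>u\<in>E. v u * tangent_vector m a b u r)
    + t ^ 2 * ((\<lambda>(i, j, k). \<Sum>p<s. v (p, i) * (b p j * v (p, Suc m + k) + v (p, Suc m + j) * b p k)
                + a p i * v (p, Suc m + j) * v (p, Suc m + k)) r
       + t * (\<lambda>(i, j, k). \<Sum>p<s. v (p, i) * v (p, Suc m + j) * v (p, Suc m + k)) r)"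
  proof -
    note rr = r[unfolded ijk]
    have 1: "secant_param m n s (\<lambda>u. base_point m a b u + t * v u) (i, j, k) =
        (\<Sum>p<s. (a p i + t * v (p, i)) * (b p j + t * v (p, Suc m + j)) * (b p k + t * v (p, Suc m + k)))"
      using rr i by (simp add: secant_param_apply base_point_simps)
    have 2: "(\<Sum>u\<in>E. v u * tangent_vector m a b u (i, j, k)) =
        (\<Sum>p<s. v (p, i) * b p j * b p k + a p i * (b p j * v (p, Suc m + k) + b p k * v (p, Suc m + j)))"
      using sum_tangent_vector[where v = v, OF E rr] unfolding tangent_sum_def by simp
    show ?thesis
      unfolding ijk 1 2 secant_param_base_point[OF rr] prod.case sum_distrib_left sum.distrib[symmetric]
      by (intro sum.cong) (simp_all add: power2_eq_square algebra_simps)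
  qed
qed

text \<open>
  Together with the point itself (the column \<open>None\<close>), the partial derivatives in the chart are independent.
  The point is \<open>\<Sum>\<^sub>p a\<^sub>p \<otimes> b\<^sub>p\<^sup>2\<close>, so it makes up for the direction of the coordinate \<open>i0\<close> of \<open>a\<^sub>0\<close> that the
  chart omits.
\<close>

lemma tangents_trivial_kernel:
  assumes ind: "independent_tangents m (Suc n) s a b" and s: "1 \<le> s"
    and h: "\<And>p. p < s \<Longrightarrow> h p \<le> n" "\<And>p. p < s \<Longrightarrow> b p (h p) \<noteq> 0"
    and i0: "i0 \<le> m" "a 0 i0 \<noteq> 0" and E: "E = chart m n s i0 h"
  shows "trivial_kernel (sv_index m n) (insert None (Some ` E))
    (\<lambda>r c. case c of None \<Rightarrow> secant_param m n s (base_point m a b) r | Some u \<Rightarrow> tangent_vector m a b u r)"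
  unfolding trivial_kernel_def
proof (rule allI, rule impI)
  fix y
  assume y: "\<forall>r\<in>sv_index m n. (\<Sum>c\<in>insert None (Some ` E). (case c of
     None \<Rightarrow> secant_param m n s (base_point m a b) r | Some u \<Rightarrow> tangent_vector m a b u r) * y c) = 0"
  define v where "v u = (if u \<in> E then y (Some u) else 0)" for u
  have v: "v u = 0" if "u \<notin> E" for u using that by (simp add: v_def)
  have Ep: "E \<subseteq> param_index m n s" by (auto simp: E chart_def)
  define w where "w p i = v (p, i) + y None * a p i" for p i
  define z where "z p j = v (p, Suc m + j)" for p j
  have T: "tangent_sum s a b w z i j k = 0" if r: "(i, j, k) \<in> sv_index m n" for i j k
  proof -
    have "0 = (\<Sum>c\<in>insert None (Some ` E). (case c of
     None \<Rightarrow> secant_param m n s (base_point m a b) (i, j, k) | Some u \<Rightarrow> tangent_vector m a b u (i, j, k)) * y c)"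
      using y r by auto
    also have "\<dots> = secant_param m n s (base_point m a b) (i, j, k) * y None +
        (\<Sum>u\<in>E. v u * tangent_vector m a b u (i, j, k))"
      by (subst sum.insert) (auto simp: E sum.reindex v_def mult.commute intro!: sum.cong)
    also have "(\<Sum>u\<in>E. v u * tangent_vector m a b u (i, j, k)) =
        tangent_sum s a b (\<lambda>p i. v (p, i)) (\<lambda>p j. v (p, Suc m + j)) i j k"
      by (rule sum_tangent_vector[where v = v, OF Ep v r])
    also have "secant_param m n s (base_point m a b) (i, j, k) * y None
        + tangent_sum s a b (\<lambda>p i. v (p, i)) (\<lambda>p j. v (p, Suc m + j)) i j k = tangent_sum s a b w z i j k"
      unfolding tangent_sum_def secant_param_base_point[OF r] sum_distrib_right sum.distrib[symmetric]
      by (intro sum.cong) (simp_all add: w_def z_def algebra_simps)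
    finally show ?thesis by simp
  qed
  have "tangent_sum s a b w z i j k = 0" if "i \<le> m" "j < Suc n" "k < Suc n" for i j k
  proof (cases "j \<le> k")
    case True
    then show ?thesis using that by (intro T) (simp add: sv_index_def)
  next
    case False
    have "tangent_sum s a b w z i j k = tangent_sum s a b w z i k j"
      unfolding tangent_sum_def by (intro sum.cong) (auto simp: algebra_simps)
    also have "\<dots> = 0" using that False by (intro T) (simp add: sv_index_def)
    finally show ?thesis .
  qed
  then have ker: "\<exists>l. (\<forall>i\<le>m. w p i = - 2 * l * a p i) \<and> (\<forall>j<Suc n. z p j = l * b p j)" if "p < s" for p
    using ind that unfolding independent_tangents_def by blast
  have wz: "(\<forall>i\<le>m. w p i = 0) \<and> (\<forall>j\<le>n. z p j = 0)" if p: "p < s" for p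
  proof -
    obtain l where l: "\<forall>i\<le>m. w p i = - 2 * l * a p i" "\<forall>j<Suc n. z p j = l * b p j"
      using ker[OF p] by blast
    have "(p, Suc m + h p) \<notin> E" using p by (auto simp: E chart_def)
    then have "z p (h p) = 0" unfolding z_def by (rule v)
    then have "l = 0" using l(2) h[OF p] by auto
    then show ?thesis using l by auto
  qed
  have "(0, i0) \<notin> E" by (simp add: E chart_def)
  then have "y None = 0" using wz[of 0] s i0 v[of "(0, i0)"] by (auto simp: w_def)
  moreover have "y (Some u) = 0" if u: "u \<in> E" for u
  proof -
    obtain p c where pc: "u = (p, c)" "p < s" "c < m + n + 2" using u Ep by (cases u) auto
    show ?thesis
    proof (cases "c \<le> m")
      case True
      then show ?thesis using wz[OF pc(2)] \<open>y None = 0\<close> u by (auto simp: w_def v_def pc)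
    next
      case False
      define j where "j = c - Suc m"
      have j: "c = Suc m + j" "j \<le> n" using False pc(3) by (auto simp: j_def)
      then show ?thesis using wz[OF pc(2)] u by (auto simp: z_def v_def pc)
    qed
  qed
  ultimately show "\<forall>c\<in>insert None (Some ` E). y c = 0" by auto
qed

lemma finite_sv_index: "finite (sv_index m n)"
proof (rule finite_subset)
  show "sv_index m n \<subseteq> {..m} \<times> {..n} \<times> {..n}" by (auto simp: sv_index_def)
qed simp

lemma dimension_secant_ge:
  assumes ind: "independent_tangents m (Suc n) s a b" and s: "1 \<le> s"
    and T: "T \<subseteq> proj_space (sv_index m n)" "image_points (secant_param m n s) UNIV \<subseteq> T"
  shows "enat (s * (m + n + 1) - 1) \<le> dimension (sv_index m n) T"
proof -
  let ?I = "sv_index m n" and ?\<Phi> = "secant_param m n s" and ?x0 = "base_point m a b"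
  have "\<forall>p. p < s \<longrightarrow> (\<exists>j\<le>n. b p j \<noteq> 0)"
    using ind unfolding independent_tangents_def less_Suc_eq_le by blast
  then obtain h where h: "\<And>p. p < s \<Longrightarrow> h p \<le> n" "\<And>p. p < s \<Longrightarrow> b p (h p) \<noteq> 0" by metis
  obtain i0 where i0: "i0 \<le> m" "a 0 i0 \<noteq> 0"
    using ind s unfolding independent_tangents_def by (metis less_eq_Suc_le One_nat_def)
  define E where "E = chart m n s i0 h"
  define f where "f r c = (case c of None \<Rightarrow> ?\<Phi> ?x0 r | Some u \<Rightarrow> tangent_vector m a b u r)" for r c
  have finE: "finite E" and Ep: "E \<subseteq> param_index m n s" by (auto simp: E_def chart_def)
  have "trivial_kernel ?I (insert None (Some ` E)) f"
    using tangents_trivial_kernel[OF ind s h i0 E_def] unfolding f_def .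
  moreover have "finite (insert None (Some ` E))" using finE by simp
  ultimately obtain \<eta> where \<eta>: "\<And>c c'. c \<in> insert None (Some ` E) \<Longrightarrow> c' \<in> insert None (Some ` E) \<Longrightarrow>
    (\<Sum>r\<in>?I. \<eta> c r * f r c') = (if c = c' then 1 else 0)"
    using trivial_kernel_left_inverse[OF _ finite_sv_index, of "insert None (Some ` E)" m n f] by blast
  define Y where "Y c x = (\<Sum>r\<in>?I. \<eta> c r * x r)" for c and x :: "nat \<times> nat \<times> nat \<Rightarrow> complex"
  have form_Y: "form ?I 1 (Y c)" for c
    unfolding Y_def by (intro form_sum form_scale form_coord)
  have Y_exp: "\<exists>A B. \<forall>t. Y c (?\<Phi> (\<lambda>u. ?x0 u + t * v u)) =
      (if c = None then 1 else 0) + t * (case c of None \<Rightarrow> 0 | Some u \<Rightarrow> v u) + t ^ 2 * (A + t * B)"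
    if c: "c \<in> insert None (Some ` E)" and v: "\<And>u. u \<notin> E \<Longrightarrow> v u = 0" for c v
  proof -
    obtain R2 R3 where R: "\<And>t r. r \<in> ?I \<Longrightarrow> ?\<Phi> (\<lambda>u. ?x0 u + t * v u) r =
        f r None + t * (\<Sum>u\<in>E. v u * f r (Some u)) + t ^ 2 * (R2 r + t * R3 r)"
      using secant_param_expansion[where v = v and a = a and b = b, OF Ep v] unfolding f_def by auto
    have expand: "Y c (?\<Phi> (\<lambda>u. ?x0 u + t * v u)) =
        (\<Sum>r\<in>?I. \<eta> c r * f r None) + t * (\<Sum>u\<in>E. v u * (\<Sum>r\<in>?I. \<eta> c r * f r (Some u)))
        + t ^ 2 * ((\<Sum>r\<in>?I. \<eta> c r * R2 r) + t * (\<Sum>r\<in>?I. \<eta> c r * R3 r))" for t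
    proof -
      have "Y c (?\<Phi> (\<lambda>u. ?x0 u + t * v u)) = (\<Sum>r\<in>?I. \<eta> c r * f r None
         + t * (\<Sum>u\<in>E. v u * (\<eta> c r * f r (Some u))) + t ^ 2 * (\<eta> c r * R2 r + t * (\<eta> c r * R3 r)))"
        unfolding Y_def
      proof (rule sum.cong[OF refl])
        fix r assume "r \<in> ?I"
        show "\<eta> c r * ?\<Phi> (\<lambda>u. ?x0 u + t * v u) r = \<eta> c r * f r None
         + t * (\<Sum>u\<in>E. v u * (\<eta> c r * f r (Some u))) + t ^ 2 * (\<eta> c r * R2 r + t * (\<eta> c r * R3 r))"
        proof -
          have "(\<Sum>u\<in>E. v u * (\<eta> c r * f r (Some u))) = \<eta> c r * (\<Sum>u\<in>E. v u * f r (Some u))"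
            unfolding sum_distrib_left by (intro sum.cong refl) (rule mult.left_commute)
          then show ?thesis
            using R[OF \<open>r \<in> ?I\<close>, of t] by (simp only: distrib_left mult.left_commute)
        qed
      qed
      also have "\<dots> = (\<Sum>r\<in>?I. \<eta> c r * f r None) + t * (\<Sum>r\<in>?I. \<Sum>u\<in>E. v u * (\<eta> c r * f r (Some u)))
        + t ^ 2 * ((\<Sum>r\<in>?I. \<eta> c r * R2 r) + t * (\<Sum>r\<in>?I. \<eta> c r * R3 r))"
        by (simp only: sum.distrib flip: sum_distrib_left)
      also have "(\<Sum>r\<in>?I. \<Sum>u\<in>E. v u * (\<eta> c r * f r (Some u))) = (\<Sum>u\<in>E. v u * (\<Sum>r\<in>?I. \<eta> c r * f r (Some u)))"
        by (subst sum.swap) (simp add: sum_distrib_left)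
      finally show ?thesis .
    qed
    have 0: "(\<Sum>r\<in>?I. \<eta> c r * f r None) = (if c = None then 1 else 0)"
      using \<eta>[OF c, of None] by simp
    have 1: "(\<Sum>u\<in>E. v u * (\<Sum>r\<in>?I. \<eta> c r * f r (Some u))) = (case c of None \<Rightarrow> 0 | Some u \<Rightarrow> v u)"
    proof -
      have "(\<Sum>u\<in>E. v u * (\<Sum>r\<in>?I. \<eta> c r * f r (Some u))) = (\<Sum>u\<in>E. if c = Some u then v u else 0)"
        by (intro sum.cong) (auto simp: \<eta>[OF c])
      also have "\<dots> = (case c of None \<Rightarrow> 0 | Some u \<Rightarrow> v u)"
        using c finE by (cases c) auto
      finally show ?thesis .
    qed
    show ?thesis using expand unfolding 0 1 by blast
  qed
  have "enat (card E) \<le> dimension ?I T"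
  proof (rule dimension_ge[OF T(1) finE, where \<Phi> = ?\<Phi> and ?x0.0 = ?x0 and ?y0.0 = "Y None" and y = "\<lambda>u. Y (Some u)"])
    show "polyfn 3 (\<lambda>x. ?\<Phi> x r)" for r by (rule polyfn_secant_param)
    show "?\<Phi> x \<in> coord_space ?I" for x by (rule secant_param_coord_space)
    show "?\<Phi> ?x0 \<noteq> 0"
    proof
      assume "?\<Phi> ?x0 = 0"
      then have "f r None = 0" for r by (simp add: f_def)
      then show False using \<eta>[of None None] by simp
    qed
    show "image_points ?\<Phi> (slice E ?x0) \<subseteq> T"
      using T(2) image_points_mono[of "slice E ?x0" UNIV ?\<Phi>] by blast
    show "form ?I 1 (Y None)" "form ?I 1 (Y (Some u))" for u by (rule form_Y)+
    show "\<exists>q. \<forall>t. Y None (?\<Phi> (\<lambda>u. ?x0 u + t * v u)) = 1 + t * poly q t"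
      if v: "\<And>u. u \<notin> E \<Longrightarrow> v u = 0" for v
    proof -
      obtain A B where "\<And>t. Y None (?\<Phi> (\<lambda>u. ?x0 u + t * v u)) = 1 + t ^ 2 * (A + t * B)"
        using Y_exp[of None v] v by auto
      then show ?thesis by (intro exI[of _ "[:0, A, B:]"]) (simp add: power2_eq_square algebra_simps)
    qed
    show "\<exists>q. \<forall>t. Y (Some e) (?\<Phi> (\<lambda>u. ?x0 u + t * v u)) = t * (v e + t * poly q t)"
      if v: "\<And>u. u \<notin> E \<Longrightarrow> v u = 0" and e: "e \<in> E" for v e
    proof -
      obtain A B where "\<And>t. Y (Some e) (?\<Phi> (\<lambda>u. ?x0 u + t * v u)) = t * v e + t ^ 2 * (A + t * B)"
        using Y_exp[of "Some e" v] v e by auto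
      then show ?thesis by (intro exI[of _ "[:A, B:]"]) (simp add: power2_eq_square algebra_simps)
    qed
  qed
  then show ?thesis using card_chart[OF s i0(1) h(1)] by (simp add: E_def)
qed

section \<open>Secant varieties of the Segre-Veronese variety\<close>

lemma sv_map_cong:
  "(\<And>i. i \<le> m \<Longrightarrow> a i = a' i) \<Longrightarrow> (\<And>j. j \<le> n \<Longrightarrow> b j = b' j) \<Longrightarrow> sv_map m n a b = sv_map m n a' b'"
  by (auto simp: sv_map_def fun_eq_iff sv_index_def)

lemma sv_map_scale: "sv_map m n (\<lambda>i. c * a i) b = cscale c (sv_map m n a b)"
  by (auto simp: sv_map_def fun_eq_iff cscale_def)

lemma sv_map_nonzero:
  assumes "a \<in> coord_space {..m}" "a \<noteq> 0" "b \<in> coord_space {..n}" "b \<noteq> 0"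
  shows "sv_map m n a b \<noteq> 0"
proof -
  obtain i j where ij: "a i \<noteq> 0" "b j \<noteq> 0" using assms(2,4) by (auto simp: fun_eq_iff)
  then have "i \<le> m" "j \<le> n" using assms(1,3) unfolding coord_space_def by fastforce+
  then have "sv_map m n a b (i, j, j) \<noteq> 0" using ij by (simp add: sv_map_def sv_index_def)
  then show ?thesis by auto
qed

lemma line_sv_map_in_segre_veronese:
  assumes "sv_map m n a b \<noteq> 0"
  shows "line (sv_map m n a b) \<in> segre_veronese m n"
proof -
  define a' where "a' i = (if i \<le> m then a i else 0)" for i
  define b' where "b' j = (if j \<le> n then b j else 0)" for j
  have eq: "sv_map m n a b = sv_map m n a' b'" by (rule sv_map_cong) (auto simp: a'_def b'_def)
  have "sv_map m n 0 b' = 0" "sv_map m n a' 0 = 0" by (auto simp: sv_map_def fun_eq_iff)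
  then have "a' \<noteq> 0" "b' \<noteq> 0" using assms unfolding eq by metis+
  moreover have "a' \<in> coord_space {..m}" "b' \<in> coord_space {..n}"
    by (auto simp: coord_space_def a'_def b'_def)
  ultimately show ?thesis unfolding segre_veronese_def eq by blast
qed

lemma segre_veronese_eq: "segre_veronese m n = image_points (secant_param m n 1) UNIV"
proof
  show "segre_veronese m n \<subseteq> image_points (secant_param m n 1) UNIV"
  proof
    fix l assume "l \<in> segre_veronese m n"
    then obtain a b where l: "l = line (sv_map m n a b)" and ab: "a \<in> coord_space {..m}" "a \<noteq> 0"
      "b \<in> coord_space {..n}" "b \<noteq> 0" unfolding segre_veronese_def by blast
    define x where "x = base_point m (\<lambda>_. a) (\<lambda>_. b)"
    have "secant_param m n 1 x = sv_map m n a b"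
      unfolding secant_param_def
      by (simp add: x_def base_point_simps) (intro sv_map_cong; simp add: base_point_simps)
    then show "l \<in> image_points (secant_param m n 1) UNIV"
      unfolding image_points_def l using sv_map_nonzero[OF ab] by (intro CollectI exI[of _ x]) auto
  qed
  show "image_points (secant_param m n 1) UNIV \<subseteq> segre_veronese m n"
    unfolding image_points_def secant_param_def using line_sv_map_in_segre_veronese by auto
qed

lemma span_Union_lines:
  fixes s :: nat
  assumes "z \<in> cspan (\<Union>q<s. line (u q))"
  shows "\<exists>c. z = (\<Sum>q<s. cscale (c q) (u q))"
  using assms
proof (induction rule: cfun.span_induct_alt)
  case base
  show ?case by (intro exI[of _ "\<lambda>_. 0"]) (simp add: cscale_def fun_eq_iff sum_fun_apply)
next
  case (step d y z)
  obtain c where c: "z = (\<Sum>q<s. cscale (c q) (u q))" using step by blast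
  obtain q d' where q: "q < s" "y = cscale d' (u q)" using step by (auto simp: line_eq)
  have "cscale d y + z = (\<Sum>p<s. cscale ((c(q := c q + d * d')) p) (u p))"
  proof
    fix r
    have "(\<Sum>p<s. cscale ((c(q := c q + d * d')) p) (u p)) r =
        (\<Sum>p<s. c p * u p r + (if p = q then d * d' * u q r else 0))"
      unfolding sum_fun_apply by (intro sum.cong) (auto simp: cscale_def algebra_simps)
    also have "\<dots> = (\<Sum>p<s. c p * u p r) + d * d' * u q r"
      unfolding sum.distrib using q(1) by (simp add: sum.delta)
    finally show "(cscale d y + z) r = (\<Sum>p<s. cscale ((c(q := c q + d * d')) p) (u p)) r"
      using q(2) by (simp add: c sum_fun_apply cscale_def)
  qed
  then show ?case by blast
qed

lemma union_of_secant_spans: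
  "(\<Union>P \<in> {..<s} \<rightarrow> segre_veronese m n. proj_span (sv_index m n) (P ` {..<s})) =
    image_points (secant_param m n s) UNIV"
proof (intro equalityI subsetI)
  fix l assume "l \<in> (\<Union>P \<in> {..<s} \<rightarrow> segre_veronese m n. proj_span (sv_index m n) (P ` {..<s}))"
  then obtain P where P: "P \<in> {..<s} \<rightarrow> segre_veronese m n"
    and l: "l \<in> proj_space (sv_index m n)" "l \<subseteq> cspan (\<Union>(P ` {..<s}))"
    unfolding proj_span_def by blast
  have "\<forall>q\<in>{..<s}. \<exists>a b. P q = line (sv_map m n a b)"
    using P unfolding segre_veronese_def by fastforce
  then obtain a b where ab: "\<And>q. q < s \<Longrightarrow> P q = line (sv_map m n (a q) (b q))"
    by (metis lessThan_iff)
  obtain z where z: "l = line z" "z \<noteq> 0" using l(1) unfolding proj_space_def by blast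
  have "\<Union>(P ` {..<s}) = (\<Union>q<s. line (sv_map m n (a q) (b q)))" using ab by auto
  then have "z \<in> cspan (\<Union>q<s. line (sv_map m n (a q) (b q)))" using l(2) z(1) mem_line by auto
  then obtain c where c: "z = (\<Sum>q<s. cscale (c q) (sv_map m n (a q) (b q)))"
    using span_Union_lines[of z "\<lambda>q. sv_map m n (a q) (b q)" s] by blast
  define x where "x = base_point m (\<lambda>q i. c q * a q i) b"
  have "secant_param m n s x = z"
    unfolding c secant_param_def sv_map_scale[symmetric]
    by (intro sum.cong refl sv_map_cong) (simp_all add: x_def base_point_simps)
  then show "l \<in> image_points (secant_param m n s) UNIV"
    unfolding image_points_def z(1) using z(2) by (intro CollectI exI[of _ x]) auto
next
  fix l assume "l \<in> image_points (secant_param m n s) UNIV"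
  then obtain x where x: "l = line (secant_param m n s x)" "secant_param m n s x \<noteq> 0"
    unfolding image_points_def by blast
  define u where "u p = sv_map m n (\<lambda>i. x (p, i)) (\<lambda>j. x (p, Suc m + j))" for p
  have sum_u: "secant_param m n s x = (\<Sum>p<s. u p)" by (simp add: secant_param_def u_def)
  then obtain p0 where p0: "u p0 \<noteq> 0" using x(2) by (metis sum.neutral)
  define P where "P p = line (if u p = 0 then u p0 else u p)" for p
  have P: "P p \<in> segre_veronese m n" for p
    unfolding P_def using p0 line_sv_map_in_segre_veronese by (auto simp: u_def)
  have "u p \<in> cspan (\<Union>(P ` {..<s}))" if "p < s" for p
  proof (cases "u p = 0")
    case True
    then show ?thesis by (simp add: cfun.span_zero)
  next
    case False
    then have "u p \<in> P p" by (simp add: P_def)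
    then show ?thesis using that by (intro cfun.span_base) blast
  qed
  then have "secant_param m n s x \<in> cspan (\<Union>(P ` {..<s}))"
    unfolding sum_u by (intro cfun.span_sum) auto
  then have "l \<subseteq> cspan (\<Union>(P ` {..<s}))"
    unfolding x(1) line_eq by (auto intro: cfun.span_scale)
  moreover have "l \<in> proj_space (sv_index m n)"
    using x secant_param_coord_space unfolding proj_space_def by blast
  ultimately have "l \<in> proj_span (sv_index m n) (P ` {..<s})" by (simp add: proj_span_def)
  then show "l \<in> (\<Union>P \<in> {..<s} \<rightarrow> segre_veronese m n. proj_span (sv_index m n) (P ` {..<s}))"
    using P by blast
qed

lemma secant_variety_eq:
  "secant_variety (sv_index m n) s (segre_veronese m n) =
    zariski (sv_index m n) closure_of (image_points (secant_param m n s) UNIV)"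
  unfolding secant_variety_def union_of_secant_spans ..

text \<open>
  The set \<open>T\<close> is allowed to lie anywhere between the image and its closure, so that the statement applies
  both to the Segre-Veronese variety, without knowing that it is closed, and to its secant varieties.
\<close>

lemma dimension_eq_of_independent_tangents:
  assumes ind: "independent_tangents m (Suc n) s a b" and s: "1 \<le> s"
    and T: "image_points (secant_param m n s) UNIV \<subseteq> T"
      "T \<subseteq> zariski (sv_index m n) closure_of (image_points (secant_param m n s) UNIV)"
  shows "dimension (sv_index m n) T = enat (s * (m + n + 1) - 1)"
proof (rule antisym)
  have Tp: "T \<subseteq> proj_space (sv_index m n)"
    using T(2) closure_of_subset_topspace[of "zariski (sv_index m n)"] by (auto simp: topspace_zariski)
  show "dimension (sv_index m n) T \<le> enat (s * (m + n + 1) - 1)"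
  proof (rule dimension_secant_le[OF s Tp])
    fix d g x assume g: "form (sv_index m n) d g" "\<And>x. g (secant_param m n s x) = 0" and x: "x \<in> \<Union>T"
    show "g x = 0"
    proof (rule form_vanishes_closure[OF g(1) image_points_secant_param])
      show "x \<in> \<Union>(zariski (sv_index m n) closure_of (image_points (secant_param m n s) UNIV))"
        using x T(2) by blast
    next
      fix y assume "y \<in> \<Union>(image_points (secant_param m n s) UNIV)"
      then show "g y = 0" using vanishes_on_line[OF g(1)] g(2) unfolding image_points_def by blast
    qed
  qed
  show "enat (s * (m + n + 1) - 1) \<le> dimension (sv_index m n) T"
    by (rule dimension_secant_ge[OF ind s Tp T(1)])
qed

lemma has_expected_dimension_of_independent_tangents:
  assumes ind: "independent_tangents m (Suc n) s a b" and s: "1 \<le> s"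
    and le: "s * (m + n + 1) \<le> (m + 1) * (n + 2 choose 2)"
  shows "has_expected_dimension (sv_index m n) s (segre_veronese m n)"
proof -
  let ?Y = "\<lambda>s. image_points (secant_param m n s) UNIV"
  have sub: "?Y s \<subseteq> zariski (sv_index m n) closure_of ?Y s" for s
    using image_points_secant_param by (intro closure_of_subset) (simp add: topspace_zariski)
  have "dimension (sv_index m n) (segre_veronese m n) = enat (1 * (m + n + 1) - 1)"
    unfolding segre_veronese_eq using sub
    by (intro dimension_eq_of_independent_tangents[OF independent_tangents_subset[OF ind s]]) auto
  then have X: "dimension (sv_index m n) (segre_veronese m n) = enat (m + n)" by simp
  have "dimension (sv_index m n) (secant_variety (sv_index m n) s (segre_veronese m n)) =
      enat (s * (m + n + 1) - 1)"
    unfolding secant_variety_eq using sub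
    by (intro dimension_eq_of_independent_tangents[OF ind s]) auto
  moreover have "enat s * (enat (m + n) + 1) - 1 = enat (s * (m + n + 1) - 1)"
    by (simp add: one_enat_def)
  moreover have "min (enat (card (sv_index m n) - 1)) (enat (s * (m + n + 1) - 1)) =
      enat (s * (m + n + 1) - 1)"
    using diff_le_mono[OF le, of 1] by (intro min.absorb2) (simp add: card_sv_index)
  ultimately show ?thesis
    unfolding has_expected_dimension_def expected_dimension_def X by simp
qed

lemma sv_q_le:
  assumes m: "1 \<le> m" and n: "(m + 1) ^ 3 \<le> n"
  shows "sv_q m n \<le> (m + 1) * (n + 2 - m) div 2"
proof -
  define K where "K = n + 2 - m"
  have "m \<le> (m + 1) ^ 3" using self_le_power[of "m + 1" 3] by simp
  then have "m \<le> n" using n by simp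
  define q where "q = sv_q m n"
  have choose: "2 * (n + 2 choose 2) = (n + 2) * (n + 1)"
    using choose_two[of "n + 2"] by (simp add: mult.commute)
  \<comment> \<open>for \<open>n + 2 = K + m\<close>, up to the remainder \<open>m\<^sup>2 - m\<close> the number \<open>(n + 1) (n + 2)\<close> is divisible by \<open>m + n + 1\<close>\<close>
  have key: "(n + 2) * (n + 1) + m = (m + n + 1) * K + m * m"
  proof -
    obtain j where "n = m + j" using \<open>m \<le> n\<close> le_Suc_ex by blast
    then show ?thesis by (simp add: K_def algebra_simps)
  qed
  have "q * (m + n + 1) \<le> (m + 1) * (n + 2 choose 2)"
    unfolding q_def sv_q_def by (rule div_times_less_eq_dividend)
  then have "2 * (q * (m + n + 1)) \<le> 2 * ((m + 1) * (n + 2 choose 2))"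
    by (rule mult_le_mono2)
  also have "\<dots> = (m + 1) * ((n + 2) * (n + 1))"
    unfolding choose[symmetric] by (rule mult.left_commute)
  finally have "2 * q * (m + n + 1) \<le> (m + 1) * ((n + 2) * (n + 1))"
    by (simp only: mult.assoc)
  also have "\<dots> < ((m + 1) * K + 1) * (m + n + 1)"
  proof -
    have "(m + 1) * ((n + 2) * (n + 1)) \<le> (m + 1) * ((m + n + 1) * K + m * m)"
      unfolding key[symmetric] by (intro mult_le_mono2 le_add1)
    also have "\<dots> = (m + 1) * K * (m + n + 1) + (m + 1) * (m * m)"
      by (simp add: algebra_simps)
    also have "(m + 1) * (m * m) \<le> (m + 1) ^ 3"
      unfolding power3_eq_cube mult.assoc by (intro mult_le_mono) auto
    also have "(m + 1) ^ 3 < m + n + 1" using n by simp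
    finally show ?thesis by (simp add: algebra_simps)
  qed
  finally have "2 * q < (m + 1) * K + 1" by (metis mult_less_cancel2)
  then show ?thesis by (simp add: q_def K_def)
qed

theorem corollary1p2:
  fixes m :: nat
  assumes "m \<ge> 1"
  shows "\<exists>n0. \<forall>n\<ge>n0. \<forall>s. 1 \<le> s \<and> s \<le> sv_q m n \<longrightarrow>
           has_expected_dimension (sv_index m n) s (segre_veronese m n)"
proof (intro exI allI impI)
  fix n s assume n: "(m + 1) ^ 3 \<le> n" and s: "1 \<le> s \<and> s \<le> sv_q m n"
  have "m \<le> (m + 1) ^ 3" using self_le_power[of "m + 1" 3] by simp
  then have N: "m - 1 + (n + 2 - m) = Suc n" using assms n by simp
  obtain a b where "independent_tangents m (Suc n) ((m + 1) * (n + 2 - m) div 2) a b"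
    using exists_independent_tangents[OF assms, of "n + 2 - m"] unfolding N by blast
  moreover have "s \<le> (m + 1) * (n + 2 - m) div 2"
    using s sv_q_le[OF assms n] by (rule order_trans[OF conjunct2])
  ultimately have "independent_tangents m (Suc n) s a b"
    by (rule independent_tangents_subset)
  moreover have "s * (m + n + 1) \<le> (m + 1) * (n + 2 choose 2)"
  proof -
    have "s * (m + n + 1) \<le> sv_q m n * (m + n + 1)"
      by (rule mult_le_mono1[OF conjunct2[OF s]])
    also have "\<dots> \<le> (m + 1) * (n + 2 choose 2)"
      unfolding sv_q_def by (rule div_times_less_eq_dividend)
    finally show ?thesis .
  qed
  ultimately show "has_expected_dimension (sv_index m n) s (segre_veronese m n)"
    using has_expected_dimension_of_independent_tangents conjunct1[OF s] by blast
qed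

end
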